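(* Let $k_x,k_y\ge0$, let $\mu\in\mathfrak{W}(\mathbb{H};k_x,k_y)$ be a well-projected measure on the upper half-plane $\mathbb{H}$, and let $1<p<\infty$, $p^{-1}+p'^{-1}=1$. The Cauchy integral operator $\mathcal{S}$ is a bounded operator from $L^p(\mathbb{R})$ to $L^p(d\mu)$, and the following uniform norm bound holds: $$K_4(p,k_x,k_y):=\sup_{\mu\in\mathfrak{W}(\mathbb{H};k_x,k_y)}\|\mathcal{S}\|_{L^p(\mathbb{R})\to L^p(d\mu)}\le K_3(p,k_x,k_y)\left(1+\tan\Big(\frac{\pi}{2}\max(p^{-1},p'^{-1})\Big)\right),$$ where $K_3(p,k_x,k_y)=\sup_{\mu\in\mathfrak{W}(\mathbb{H};k_x,k_y)}\|\mathcal{P}\|_{L^p(\mathbb{R})\to L^p(d\mu)}$ is the analogous supremum for the Poisson integral operator $\mathcal{P}$.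
   Context: $\mathbb{H}=\{z=x+iy: y>0\}$. For $z=x+iy\in\mathbb{H}$: the Cauchy integral is $\mathcal{S}u(z)=\int_{\mathbb{R}}S(x-t,y)u(t)\,dt$ with $S(x,y)=\frac{i}{\pi}\frac{1}{x+iy}$; the Poisson integral is $\mathcal{P}u(z)=\int_{\mathbb{R}}P(x-t,y)u(t)\,dt$ with $P(x,y)=\frac1\pi\frac{y}{x^2+y^2}$. For $A\subset\mathbb{C}$, $A_x$ and $A_y$ denote its orthogonal projections on the coordinate axes and $|A_x|,|A_y|$ their Lebesgue measures. A Borel measure $\mu$ on a domain $D\subset\mathbb{C}$ is well-projected with projection constants $k_x,k_y\ge0$ (written $\mu\in\mathfrak{W}(D;k_x,k_y)$) if $\mu(A)\le k_x|A_x|+k_y|A_y|$ for every Borel set $A\subset D$ for which the right-hand side is finite. It is known that $K_3(p,k_x,k_y)\le 2\left((3k_x+\pi^{-1}k_y)p'\right)^{1/p}<\infty$ for $1<p\le\infty$. *)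

theory Defs
  imports "HOL-Analysis.Analysis"
begin

definition Lp_space :: "real \<Rightarrow> 'a measure \<Rightarrow> ('a \<Rightarrow> complex) set" where
  "Lp_space p M =
     {f \<in> borel_measurable M. (\<integral>\<^sup>+ x. ennreal (cmod (f x) powr p) \<partial>M) < \<infinity>}"

definition Lp_norm :: "real \<Rightarrow> 'a measure \<Rightarrow> ('a \<Rightarrow> complex) \<Rightarrow> ennreal" where
  "Lp_norm p M f =
     (let I = \<integral>\<^sup>+ x. ennreal (cmod (f x) powr p) \<partial>M
      in if I = \<infinity> then \<infinity> else ennreal (enn2real I powr (1 / p)))"

text \<open>
  Elements of the spaces are functions rather than classes modulo null sets, so a bounded linear
  operator between the spaces of classes is one that respects almost-everywhere equality and is
  linear up to almost-everywhere equality.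
\<close>

definition bounded_Lp_operator ::
  "real \<Rightarrow> 'a measure \<Rightarrow> 'b measure \<Rightarrow> (('a \<Rightarrow> complex) \<Rightarrow> 'b \<Rightarrow> complex) \<Rightarrow> bool" where
  "bounded_Lp_operator p M N T \<longleftrightarrow>
     (\<forall>u \<in> Lp_space p M. T u \<in> Lp_space p N) \<and>
     (\<forall>u \<in> Lp_space p M. \<forall>v \<in> Lp_space p M.
        (AE x in M. u x = v x) \<longrightarrow> (AE z in N. T u z = T v z)) \<and>
     (\<forall>u \<in> Lp_space p M. \<forall>v \<in> Lp_space p M.
        AE z in N. T (\<lambda>x. u x + v x) z = T u z + T v z) \<and>
     (\<forall>u \<in> Lp_space p M. \<forall>c. AE z in N. T (\<lambda>x. c * u x) z = c * T u z) \<and>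
     (\<exists>C::real. 0 \<le> C \<and>
        (\<forall>u \<in> Lp_space p M. Lp_norm p N (T u) \<le> ennreal C * Lp_norm p M u))"

definition Lp_opnorm ::
  "real \<Rightarrow> 'a measure \<Rightarrow> 'b measure \<Rightarrow> (('a \<Rightarrow> complex) \<Rightarrow> 'b \<Rightarrow> complex) \<Rightarrow> ennreal" where
  "Lp_opnorm p M N T =
     (SUP u \<in> {u \<in> Lp_space p M. Lp_norm p M u \<le> 1}. Lp_norm p N (T u))"

definition upper_half_plane :: "complex set" where
  "upper_half_plane = {z. 0 < Im z}"

definition cauchy_kernel :: "real \<Rightarrow> real \<Rightarrow> complex" where
  "cauchy_kernel x y = (\<i> / of_real pi) * (1 / Complex x y)"

definition poisson_kernel :: "real \<Rightarrow> real \<Rightarrow> real" where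
  "poisson_kernel x y = (1 / pi) * (y / (x\<^sup>2 + y\<^sup>2))"

definition cauchy_integral :: "(real \<Rightarrow> complex) \<Rightarrow> complex \<Rightarrow> complex" where
  "cauchy_integral u z = (LINT t|lborel. cauchy_kernel (Re z - t) (Im z) * u t)"

definition poisson_integral :: "(real \<Rightarrow> complex) \<Rightarrow> complex \<Rightarrow> complex" where
  "poisson_integral u z = (LINT t|lborel. of_real (poisson_kernel (Re z - t) (Im z)) * u t)"

text \<open>
  Projections of Borel sets are analytic, hence Lebesgue measurable but in general not Borel;
  their size must therefore be taken with respect to the completion \<^const>\<open>lebesgue\<close>,
  since \<^const>\<open>lborel\<close> assigns \<open>0\<close> to every set that is not Borel.
\<close>

definition well_projected :: "complex set \<Rightarrow> real \<Rightarrow> real \<Rightarrow> complex measure set" where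
  "well_projected D kx ky =
     {\<mu>. sets \<mu> = sets (restrict_space borel D) \<and>
         (\<forall>A \<in> sets \<mu>.
            ennreal kx * emeasure lebesgue (Re ` A) + ennreal ky * emeasure lebesgue (Im ` A) < \<infinity>
            \<longrightarrow> emeasure \<mu> A \<le>
                 ennreal kx * emeasure lebesgue (Re ` A) + ennreal ky * emeasure lebesgue (Im ` A))}"

definition K3 :: "real \<Rightarrow> real \<Rightarrow> real \<Rightarrow> ennreal" where
  "K3 p kx ky =
     (SUP \<mu> \<in> well_projected upper_half_plane kx ky. Lp_opnorm p lborel \<mu> poisson_integral)"

definition K4 :: "real \<Rightarrow> real \<Rightarrow> real \<Rightarrow> ennreal" where
  "K4 p kx ky =
     (SUP \<mu> \<in> well_projected upper_half_plane kx ky. Lp_opnorm p lborel \<mu> cauchy_integral)"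

end

theory Submission
  imports Defs "HOL-Real_Asymp.Real_Asymp"
begin

text \<open>
  Write \<open>S = P + \<i> Q\<close> with the conjugate Poisson integral \<open>Q\<close>. The semigroup property of the
  kernels gives \<open>S u (z + \<i> \<epsilon>) = P g z\<close> for the function \<open>g x = S u (x + \<i> \<epsilon>)\<close> on the real line,
  so the norm of \<open>S\<close> into \<open>L\<^sup>p(\<mu>)\<close> is at most that of \<open>P\<close> times the norm of \<open>u \<mapsto> g\<close> on \<open>L\<^sup>p\<close> of
  the line; Fatou's lemma for \<open>\<epsilon> \<rightarrow> 0\<close> then removes the shift, and no boundary values of \<open>Q\<close> are
  needed. On the line \<open>P\<close> is a contraction, and \<open>Q\<close> is bounded with Pichorides' constant
  \<open>tan (\<pi> / 2p)\<close> for \<open>p \<le> 2\<close> and by duality for \<open>p > 2\<close>.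

  For real \<open>u\<close> and \<open>p \<le> 2\<close> put \<open>F = S u = U + \<i> V\<close>. The pointwise inequality
  \<open>\<bar>V\<bar>\<^sup>p \<le> T\<^sup>p \<bar>U\<bar>\<^sup>p - D Re ((\<bar>U\<bar> + \<i> V)\<^sup>p)\<close> reduces the claim to the nonnegativity of the integral of
  the last term over horizontal lines, which holds because that term is a subharmonic function of
  \<open>z\<close> decaying at infinity.

  That \<open>P\<close> is bounded into \<open>L\<^sup>p(\<mu>)\<close> follows by interpolation from a weak type estimate: the set
  where \<open>P \<bar>u\<bar> > \<lambda>\<close> projects on the \<open>x\<close>-axis into a set where the Hardy--Littlewood maximal function
  is large and on the \<open>y\<close>-axis into an interval of length \<open>\<parallel>u\<parallel>\<^sub>1 / (\<pi> \<lambda>)\<close>.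
\<close>

text \<open>The angle pi / (2 p) is where Re (w powr p) vanishes, so with T = tan (pi / (2 p)) the
  pointwise inequality is an equality on that ray, and tangency there determines D. Where U is
  nonzero the last term is harmonic; across the zeros of U it has a kink, which points in the
  subharmonic direction because p - 1 <= 1 makes cos ((p - 1) pi / 2) nonnegative. This is the role
  of p <= 2, and smoothing the kink without losing the sign is the main technical burden. Duality
  loses nothing: Q is skew-adjoint, and the constant at p > 2 is the one at the conjugate exponent,
  whence the maximum of the two reciprocals. The summand 1 is the contractivity of P, joined to Q by
  the triangle inequality. The decay that closes the subharmonic argument comes from bounded
  support, so the line bounds are proved for such functions; truncation and shift are then removed
  in one limit.\<close>

abbreviation pow_int :: "real \<Rightarrow> 'a measure \<Rightarrow> ('a \<Rightarrow> complex) \<Rightarrow> ennreal" where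
  "pow_int p M f \<equiv> \<integral>\<^sup>+x. ennreal (cmod (f x) powr p) \<partial>M"

abbreviation real_pow_int :: "real \<Rightarrow> 'a measure \<Rightarrow> ('a \<Rightarrow> real) \<Rightarrow> ennreal" where
  "real_pow_int p M f \<equiv> \<integral>\<^sup>+x. ennreal (\<bar>f x\<bar> powr p) \<partial>M"

abbreviation ball_integral :: "(real \<Rightarrow> ennreal) \<Rightarrow> real \<Rightarrow> real \<Rightarrow> ennreal" where
  "ball_integral f x r \<equiv> \<integral>\<^sup>+t. indicator (cball x r) t * f t \<partial>lborel"

subsection \<open>The inequality of Pichorides\<close>

lemma powr_polar_right_half_plane:
  fixes w :: complex and a :: real
  assumes "0 < Re w"
  defines "t \<equiv> Im (Ln w)"
  shows "\<bar>t\<bar> < pi / 2" "Re w = cmod w * cos t" "Im w = cmod w * sin t"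
    "Re (w powr of_real a) = cmod w powr a * cos (a * t)"
proof -
  have w0: "w \<noteq> 0" using assms by auto
  show "\<bar>t\<bar> < pi / 2" unfolding t_def using Re_Ln_pos_lt[OF w0] assms by simp
  have "w = exp (Ln w)" using w0 by simp
  then have "Re w = exp (Re (Ln w)) * cos t" "Im w = exp (Re (Ln w)) * sin t"
    unfolding t_def by (metis Re_exp, metis Im_exp)
  then show "Re w = cmod w * cos t" "Im w = cmod w * sin t" using w0 by auto
  show "Re (w powr of_real a) = cmod w powr a * cos (a * t)"
    using w0 by (simp add: powr_def Re_exp t_def)
qed

text \<open>The subtraction formula collapses the numerator of the derivative to a positive multiple
  of sin ((1 - a) x), where 0 <= (1 - a) x <= pi. With a = p - 1 this monotonicity fixes the sign of
  the derivative in \<open>pichorides_trig\<close> on either side of \<open>s\<close>.\<close>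

lemma trig_quotient_mono:
  fixes a s t :: real
  assumes "0 < a" "a \<le> 1" "0 < s" "s \<le> t" "t < pi / 2"
  shows "sin (a * s) / sin s powr a \<le> sin (a * t) / sin t powr a"
proof (rule DERIV_nonneg_imp_nondecreasing[OF assms(4)])
  fix x assume "s \<le> x" "x \<le> t"
  then have x: "0 < x" "x < pi / 2" using assms by auto
  have sx: "0 < sin x" using x by (intro sin_gt_zero) auto
  have "((\<lambda>t. sin (a * t) / sin t powr a) has_real_derivative
      (a * cos (a * x) * sin x powr a - sin (a * x) * (a * sin x powr (a - 1) * cos x)) / (sin x powr a * sin x powr a)) (at x)"
    using sx by (auto intro!: derivative_eq_intros simp: powr_diff algebra_simps)
  moreover have "a * cos (a * x) * sin x powr a - sin (a * x) * (a * sin x powr (a - 1) * cos x)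
      = a * sin x powr (a - 1) * sin ((1 - a) * x)"
  proof -
    have 1: "sin x powr a = sin x powr (a - 1) * sin x" using sx by (simp add: powr_diff)
    have 2: "sin ((1 - a) * x) = sin x * cos (a * x) - cos x * sin (a * x)"
      by (simp add: left_diff_distrib sin_diff)
    show ?thesis unfolding 1 2 by (simp add: algebra_simps)
  qed
  moreover have "0 \<le> sin ((1 - a) * x)"
  proof (rule sin_ge_zero)
    show "0 \<le> (1 - a) * x" using assms x by simp
    have "(1 - a) * x \<le> 1 * x" using assms x by (intro mult_right_mono) auto
    then show "(1 - a) * x \<le> pi" using x pi_gt_zero by linarith
  qed
  ultimately show "\<exists>y. ((\<lambda>t. sin (a * t) / sin t powr a) has_real_derivative y) (at x) \<and> 0 \<le> y"
    using assms(1) by (intro exI conjI) (assumption, simp)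
qed

text \<open>Divided by cos t powr p the inequality reads 0 <= \<open>k t\<close>. Since p s = pi /
  2, the term with cos (p t) vanishes at \<open>s\<close>, so k s = 0, and the derivative of
  \<open>k\<close> passes there from nonpositive to nonnegative.\<close>

lemma pichorides_trig:
  fixes p t :: real
  assumes p: "1 < p" "p \<le> 2" and t: "0 \<le> t" "t < pi / 2"
  defines "s \<equiv> pi / (2 * p)"
  shows "sin t powr p \<le> tan s powr p * cos t powr p - sin s powr (p - 1) / cos s * cos (p * t)"
proof -
  \<comment> \<open>Forced by tangency: the derivative of \<open>k\<close> carries the factor D sin
    ((p - 1) x) / sin x powr (p - 1) - 1, which has to vanish at x = s, where sin ((p - 1) s) = cos
    s.\<close>
  define D where "D = sin s powr (p - 1) / cos s"
  define k where "k = (\<lambda>t. tan s powr p - tan t powr p - D * cos (p * t) / cos t powr p)"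
  have s: "0 < s" "s < pi / 2" using p by (simp_all add: s_def field_simps)
  have ps: "p * s = pi / 2" using p by (simp add: s_def)
  have cs: "0 < cos s" "0 < sin s" using s by (auto intro: cos_gt_zero sin_gt_zero)
  have ks: "k s = 0" unfolding k_def ps by simp
  have sg: "D * (sin ((p - 1) * s) / sin s powr (p - 1)) = 1"
  proof -
    have "sin ((p - 1) * s) = sin (pi / 2 - s)" by (simp add: ps algebra_simps flip: ps)
    also have "\<dots> = cos s" by (simp add: cos_sin_eq)
    finally show ?thesis using cs by (simp add: D_def)
  qed
  have Dpos: "0 < D" using cs by (simp add: D_def)
  let ?k' = "\<lambda>x. p / cos x powr (p + 1) * sin x powr (p - 1) * (D * (sin ((p - 1) * x) / sin x powr (p - 1)) - 1)"
  have der: "(k has_real_derivative ?k' x) (at x)" if x: "0 < x" "x < pi / 2" for x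
  proof -
    let ?N = "D * (- sin (p * x) * p) * cos x powr p - D * cos (p * x) * (p * cos x powr (p - 1) * (- sin x))"
    have c: "0 < cos x" "0 < sin x" "0 < tan x" using x by (auto intro: cos_gt_zero sin_gt_zero tan_gt_zero)
    have sd: "sin ((p - 1) * x) = sin (p * x) * cos x - cos (p * x) * sin x"
      by (simp add: left_diff_distrib sin_diff)
    have "(k has_real_derivative - (p * tan x powr (p - 1) * inverse ((cos x)\<^sup>2)) -
       ?N / (cos x powr p * cos x powr p)) (at x)"
      unfolding k_def
      using c by (auto intro!: derivative_eq_intros simp: powr_diff algebra_simps)
    moreover have "- (p * tan x powr (p - 1) * inverse ((cos x)\<^sup>2)) - ?N / (cos x powr p * cos x powr p)
       = ?k' x" (is "?L = ?R")
    proof -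
      have t1: "tan x powr (p - 1) * inverse ((cos x)\<^sup>2) = sin x powr (p - 1) / cos x powr (p + 1)"
        using c by (simp add: tan_def powr_divide powr_diff powr_add power2_eq_square field_simps)
      have t1': "p * tan x powr (p - 1) * inverse ((cos x)\<^sup>2) = p * (sin x powr (p - 1) / cos x powr (p + 1))"
        by (simp only: mult.assoc t1)
      have t2: "?N / (cos x powr p * cos x powr p) = - (p * D * sin ((p - 1) * x) / cos x powr (p + 1))"
        unfolding sd using c by (simp add: powr_diff powr_add field_simps)
      have "?L = - (p * (sin x powr (p - 1) / cos x powr (p + 1))) + p * D * sin ((p - 1) * x) / cos x powr (p + 1)"
        unfolding t1' t2 by simp
      also have "\<dots> = ?R" using c by (simp add: field_simps)
      finally show ?thesis .
    qed
    ultimately show ?thesis by simp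
  qed
  have "k t \<ge> 0"
  proof (cases "t \<le> s")
    case True
    have "k s \<le> k t"
    \<comment> \<open>\<open>t\<close> may be 0, where \<open>der\<close> does not apply; for this
      rule differentiability inside and continuity up to the ends suffice.\<close>
    proof (rule DERIV_nonpos_imp_decreasing_open[OF True])
      fix x assume x: "t < x" "x < s"
      then have x': "0 < x" "x < pi / 2" using t s by auto
      have "D * (sin ((p - 1) * x) / sin x powr (p - 1)) \<le> D * (sin ((p - 1) * s) / sin s powr (p - 1))"
        using p x x' s Dpos by (intro mult_left_mono trig_quotient_mono) auto
      then show "\<exists>y. (k has_real_derivative y) (at x) \<and> y \<le> 0"
        using der[OF x'] p cos_gt_zero[OF x'] unfolding sg
        by (intro exI[of _ "?k' x"] conjI mult_nonneg_nonpos) auto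
    next
      have "cos x \<noteq> 0" if "x \<in> {t..s}" for x
        using that t s cos_gt_zero_pi[of x] by auto
      moreover have "0 \<le> tan x" if "x \<in> {t..s}" for x
        using that t s by (cases "x = 0") (auto intro!: less_imp_le[OF tan_gt_zero])
      ultimately show "continuous_on {t..s} k"
        unfolding k_def using p by (intro continuous_intros continuous_on_powr') auto
    qed
    then show ?thesis using ks by simp
  next
    case False
    then have "s \<le> t" by simp
    have "k s \<le> k t"
    proof (rule DERIV_nonneg_imp_nondecreasing[OF \<open>s \<le> t\<close>])
      fix x assume x: "s \<le> x" "x \<le> t"
      then have x': "0 < x" "x < pi / 2" using t s by auto
      have "D * (sin ((p - 1) * s) / sin s powr (p - 1)) \<le> D * (sin ((p - 1) * x) / sin x powr (p - 1))"
        using p x x' s Dpos by (intro mult_left_mono trig_quotient_mono) auto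
      then show "\<exists>y. (k has_real_derivative y) (at x) \<and> 0 \<le> y"
        using der[OF x'] p cos_gt_zero[OF x'] unfolding sg
        by (intro exI[of _ "?k' x"] conjI mult_nonneg_nonneg) auto
    qed
    then show ?thesis using ks by simp
  qed
  moreover have c: "0 < cos t" "0 \<le> sin t" using t by (auto intro!: cos_gt_zero_pi sin_ge_zero)
  then have "tan t powr p = sin t powr p / cos t powr p" by (simp add: tan_def powr_divide)
  ultimately have "0 \<le> (tan s powr p - sin t powr p / cos t powr p - D * cos (p * t) / cos t powr p) * cos t powr p"
    unfolding k_def by (intro mult_nonneg_nonneg) auto
  also have "\<dots> = tan s powr p * cos t powr p - sin t powr p - D * cos (p * t)"
    using c by (simp add: field_simps)
  finally show ?thesis by (simp add: D_def)
qed

text \<open>Both sides are homogeneous of degree p in |w| and even in the angle, which leaves the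
  trigonometric inequality for the absolute value of the angle. The positive real part is supplied
  later by the regularization.\<close>

lemma pichorides_pointwise:
  fixes p :: real and w :: complex
  assumes p: "1 < p" "p \<le> 2" and w: "0 < Re w"
  defines "s \<equiv> pi / (2 * p)"
  shows "\<bar>Im w\<bar> powr p \<le> tan s powr p * Re w powr p - sin s powr (p - 1) / cos s * Re (w powr of_real p)"
proof -
  note P = powr_polar_right_half_plane[OF w]
  define t where "t = \<bar>Im (Ln w)\<bar>"
  have t: "0 \<le> t" "t < pi / 2" using P(1) by (auto simp: t_def)
  have c: "0 < cos t" "0 \<le> sin t" using t by (auto intro!: cos_gt_zero_pi sin_ge_zero)
  have cp: "cos (p * Im (Ln w)) = cos (p * t)" unfolding t_def by (simp add: abs_if)
  have ct: "cos (Im (Ln w)) = cos t" unfolding t_def by (simp add: abs_if)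
  have st: "\<bar>sin (Im (Ln w))\<bar> = sin t" using c unfolding t_def by (auto simp: abs_if split: if_splits)
  have 1: "\<bar>Im w\<bar> = cmod w * sin t" using P(3) st by (simp add: abs_mult)
  have 2: "Re w = cmod w * cos t" using P(2) ct by simp
  have "\<bar>Im w\<bar> powr p = cmod w powr p * sin t powr p"
    unfolding 1 using c by (simp add: powr_mult)
  also have "\<dots> \<le> cmod w powr p * (tan s powr p * cos t powr p - sin s powr (p - 1) / cos s * cos (p * t))"
    unfolding s_def using pichorides_trig[OF p t] by (intro mult_left_mono) auto
  also have "\<dots> = tan s powr p * Re w powr p - sin s powr (p - 1) / cos s * Re (w powr of_real p)"
  proof -
    have "Re w powr p = cmod w powr p * cos t powr p" unfolding 2 using c by (simp add: powr_mult)
    then show ?thesis unfolding P(4) cp by (simp add: algebra_simps)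
  qed
  finally show ?thesis .
qed

text \<open>With w of modulus r and angle t, division by r powr a leaves cos (a t) >= a cos t cos
  ((1 - a) t). Writing a t = t - (1 - a) t, the subtraction formula gives this up to a product of
  two sines of equal sign. For a = p - 1 it decides the sign of the Laplacian of
  \<open>reg_powr\<close>.\<close>

lemma Re_powr_diff_nonneg:
  fixes a :: real and w :: complex
  assumes a: "0 < a" "a \<le> 1" and w: "0 < Re w"
  shows "0 \<le> Re (w powr of_real a - of_real (a * Re w) * w powr of_real (a - 1))"
proof -
  note P = powr_polar_right_half_plane[OF w]
  define t where "t = Im (Ln w)"
  have t: "\<bar>t\<bar> < pi / 2" using P(1) by (simp add: t_def)
  have w0: "0 < cmod w" using w by auto
  have at: "\<bar>(1 - a) * t\<bar> \<le> \<bar>t\<bar>" unfolding abs_mult using a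
    by (intro mult_left_le_one_le) auto
  have c1: "0 \<le> cos t" using t by (intro cos_ge_zero) auto
  have c2: "0 \<le> cos ((1 - a) * t)" using t at by (intro cos_ge_zero) auto
  have s: "0 \<le> sin t * sin ((1 - a) * t)"
  proof (cases "0 \<le> t")
    case True
    then show ?thesis using t at a by (intro mult_nonneg_nonneg sin_ge_zero) auto
  next
    case False
    then have "0 \<le> sin (- t) * sin ((1 - a) * (- t))"
      using t at a by (intro mult_nonneg_nonneg sin_ge_zero mult_nonneg_nonneg) auto
    then show ?thesis by simp
  qed
  have "cos (a * t) = cos (t - (1 - a) * t)" by (simp add: algebra_simps)
  also have "\<dots> = cos t * cos ((1 - a) * t) + sin t * sin ((1 - a) * t)" by (rule cos_diff)
  finally have "cos t * cos ((1 - a) * t) \<le> cos (a * t)" using s by simp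
  moreover have "a * (cos t * cos ((1 - a) * t)) \<le> 1 * (cos t * cos ((1 - a) * t))"
    using a c1 c2 by (intro mult_right_mono) auto
  ultimately have "0 \<le> cmod w powr a * (cos (a * t) - a * (cos t * cos ((1 - a) * t)))"
    by (intro mult_nonneg_nonneg) auto
  also have "\<dots> = Re (w powr of_real a - of_real (a * Re w) * w powr of_real (a - 1))"
  proof -
    have "cos ((a - 1) * t) = cos ((1 - a) * t)"
      by (metis cos_minus minus_diff_eq mult_minus_left)
    moreover have "cmod w powr a = cmod w * cmod w powr (a - 1)" using w0 by (simp add: powr_diff)
    moreover have "Re (w powr (of_real a - 1)) = cmod w powr (a - 1) * cos ((a - 1) * t)"
      using P(4)[of "a - 1"] by (simp add: t_def)
    ultimately show ?thesis
      using P(2) by (simp add: P(4) t_def[symmetric] algebra_simps)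
  qed
  finally show ?thesis .
qed

text \<open>A second-order integration by parts in \<open>y\<close> with the weight \<open>y - e\<close>; the resulting area
  integral of \<open>v\<^sub>y\<^sub>y\<close> is bounded below by that of \<open>- v\<^sub>x\<^sub>x\<close>, which is a boundary term.\<close>

lemma subharmonic_rectangle_bound:
  fixes v vx vy vxx vyy :: "real \<Rightarrow> real \<Rightarrow> real"
  assumes eY: "0 < e" "e \<le> Y" and X: "0 \<le> X"
    and dy: "\<And>x y. 0 < y \<Longrightarrow> ((\<lambda>y. v x y) has_real_derivative vy x y) (at y)"
    and dyy: "\<And>x y. 0 < y \<Longrightarrow> ((\<lambda>y. vy x y) has_real_derivative vyy x y) (at y)"
    and dx: "\<And>x y. 0 < y \<Longrightarrow> ((\<lambda>x. v x y) has_real_derivative vx x y) (at x)"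
    and dxx: "\<And>x y. 0 < y \<Longrightarrow> ((\<lambda>x. vx x y) has_real_derivative vxx x y) (at x)"
    and cont: "continuous_on (cbox (-X, e) (X, Y)) (\<lambda>(x, y). vyy x y)"
    and sub: "\<And>x y. 0 < y \<Longrightarrow> 0 \<le> vxx x y + vyy x y"
    and bv: "\<And>x. \<bar>x\<bar> \<le> X \<Longrightarrow> \<bar>v x Y\<bar> \<le> m"
    and bvy: "\<And>x. \<bar>x\<bar> \<le> X \<Longrightarrow> \<bar>vy x Y\<bar> \<le> M"
    and bvx: "\<And>x y. \<bar>x\<bar> = X \<Longrightarrow> e \<le> y \<Longrightarrow> y \<le> Y \<Longrightarrow> \<bar>vx x y\<bar> \<le> M"
  shows "- (2 * X * (m + Y * M) + 2 * M * Y\<^sup>2) \<le> integral {-X..X} (\<lambda>x. v x e)"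
proof -
  have Y: "0 < Y" using eY by simp
  have M0: "0 \<le> M" using bvy[of 0] X by simp
  have cont': "continuous_on (cbox (-X, e) (X, Y)) (\<lambda>(x, y). (y - e) * vyy x y)"
    using cont by (auto simp: split_def intro!: continuous_intros)
  let ?K = "\<lambda>x. integral {e..Y} (\<lambda>y. (y - e) * vyy x y)"
  let ?B = "\<lambda>x. (Y - e) * vy x Y - v x Y + v x e"
  \<comment> \<open>The weight vanishes at y = e and removes \<open>vy\<close> from the lower side,
    where only \<open>v\<close> itself survives.\<close>
  have inner: "?K x = ?B x" for x
  proof -
    have "((\<lambda>y. (y - e) * vyy x y) has_integral ((Y - e) * vy x Y - v x Y) - ((e - e) * vy x e - v x e)) {e..Y}"
    proof (rule fundamental_theorem_of_calculus[OF eY(2)])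
      fix y assume y: "y \<in> {e..Y}"
      then have "0 < y" using eY by auto
      then have "((\<lambda>y. (y - e) * vy x y - v x y) has_real_derivative (y - e) * vyy x y) (at y)"
        by (auto intro!: derivative_eq_intros dy dyy)
      then show "((\<lambda>y. (y - e) * vy x y - v x y) has_vector_derivative (y - e) * vyy x y) (at y within {e..Y})"
        by (simp add: has_real_derivative_iff_has_vector_derivative has_vector_derivative_at_within)
    qed
    then show ?thesis by (simp add: integral_unique)
  qed
  have swap: "integral {-X..X} ?K = integral {e..Y} (\<lambda>y. integral {-X..X} (\<lambda>x. (y - e) * vyy x y))"
    using integral_swap_continuous[OF cont'] by simp
  have cx: "continuous_on {-X..X} (\<lambda>x. vyy x y)" if "y \<in> {e..Y}" for y
  proof -
    have "continuous_on {-X..X} (\<lambda>x. (\<lambda>(x, y). vyy x y) (x, y))"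
      by (rule continuous_on_compose2[OF cont]) (use that in \<open>auto intro!: continuous_intros\<close>)
    then show ?thesis by simp
  qed
  let ?J = "\<lambda>y. integral {-X..X} (\<lambda>x. (y - e) * vyy x y)"
  have low: "- 2 * M * Y \<le> ?J y" if y: "y \<in> {e..Y}" for y
  proof -
    have "0 < y" using y eY by auto
    have fx: "((\<lambda>x. vxx x y) has_integral vx X y - vx (-X) y) {-X..X}"
      using X dxx[OF \<open>0 < y\<close>]
      by (intro fundamental_theorem_of_calculus)
        (auto simp: has_real_derivative_iff_has_vector_derivative[symmetric] has_field_derivative_at_within)
    have "- (vx X y - vx (-X) y) = integral {-X..X} (\<lambda>x. - vxx x y)"
      using fx by (simp add: integral_unique)
    also have "\<dots> \<le> integral {-X..X} (\<lambda>x. vyy x y)"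
    proof (rule integral_le)
      show "(\<lambda>x. - vxx x y) integrable_on {-X..X}" using fx by (auto simp: integrable_on_def intro: has_integral_neg)
      show "(\<lambda>x. vyy x y) integrable_on {-X..X}" by (rule integrable_continuous_real[OF cx[OF y]])
      show "- vxx x y \<le> vyy x y" if "x \<in> {-X..X}" for x using sub[OF \<open>0 < y\<close>, of x] by simp
    qed
    finally have *: "- (vx X y - vx (-X) y) \<le> integral {-X..X} (\<lambda>x. vyy x y)" .
    have "\<bar>vx X y\<bar> \<le> M" "\<bar>vx (-X) y\<bar> \<le> M" using bvx[of X y] bvx[of "-X" y] y X by auto
    then have "- 2 * M \<le> integral {-X..X} (\<lambda>x. vyy x y)" using * by linarith
    then have "(y - e) * (- 2 * M) \<le> (y - e) * integral {-X..X} (\<lambda>x. vyy x y)"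
      using y by (intro mult_left_mono) auto
    moreover have "(y - e) * M \<le> Y * M" using y eY M0 by (intro mult_right_mono) auto
    moreover have "?J y = (y - e) * integral {-X..X} (\<lambda>x. vyy x y)"
      by simp
    moreover have "- 2 * M * Y = - 2 * (Y * M)" "(y - e) * (- 2 * M) = - 2 * ((y - e) * M)" by simp_all
    ultimately show ?thesis by linarith
  qed
  have c2: "continuous_on ({e..Y} \<times> {-X..X}) (\<lambda>z. vyy (snd z) (fst z))"
  proof -
    have "continuous_on ({e..Y} \<times> {-X..X}) (\<lambda>z. (\<lambda>(x, y). vyy x y) (snd z, fst z))"
      by (rule continuous_on_compose2[OF cont]) (auto intro!: continuous_intros)
    then show ?thesis by simp
  qed
  have ci: "?J integrable_on {e..Y}"
  proof (rule integrable_continuous_real)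
    have "continuous_on (cbox e Y) (\<lambda>y. integral (cbox (-X) X) (\<lambda>x. (y - e) * vyy x y))"
      by (rule integral_continuous_on_param)
        (use c2 in \<open>auto simp: split_def intro!: continuous_intros\<close>)
    then show "continuous_on {e..Y} ?J" by simp
  qed
  have "- 2 * M * Y * Y \<le> (Y - e) * (- 2 * M * Y)"
    using M0 Y eY by (simp add: algebra_simps)
  also have "\<dots> = integral {e..Y} (\<lambda>y. - 2 * M * Y)" using eY by simp
  also have "\<dots> \<le> integral {e..Y} ?J"
    by (rule integral_le[OF _ ci]) (use low in auto)
  also have "\<dots> = integral {-X..X} ?B"
    unfolding swap[symmetric] inner ..
  finally have A: "- 2 * M * Y * Y \<le> integral {-X..X} ?B" .
  have cy: "continuous_on {-X..X} ?K"
  proof -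
    have "continuous_on (cbox (-X) X) (\<lambda>x. integral (cbox e Y) (\<lambda>y. (y - e) * vyy x y))"
      by (rule integral_continuous_on_param)
        (use cont in \<open>auto simp: split_def cbox_Pair_eq intro!: continuous_intros\<close>)
    then show ?thesis by simp
  qed
  have cv: "continuous_on {-X..X} (\<lambda>x. v x e)"
    using dx[OF eY(1)] by (intro continuous_at_imp_continuous_on) (auto intro: DERIV_isCont)
  have "integral {-X..X} ?B \<le> integral {-X..X} (\<lambda>x. (m + Y * M) + v x e)"
  proof (rule integral_le)
    show "?B integrable_on {-X..X}"
      using integrable_continuous_real[OF cy] unfolding inner .
    show "(\<lambda>x. (m + Y * M) + v x e) integrable_on {-X..X}"
      by (intro integrable_continuous_real continuous_intros cv)
    fix x assume x: "x \<in> {-X..X}"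
    then have ax: "\<bar>x\<bar> \<le> X" by auto
    have "(Y - e) * vy x Y \<le> (Y - e) * M"
      using bvy[OF ax] eY by (intro mult_left_mono) auto
    moreover have "(Y - e) * M \<le> Y * M" using eY M0 by (intro mult_right_mono) auto
    moreover have "- v x Y \<le> m" using bv[OF ax] by auto
    ultimately show "?B x \<le> (m + Y * M) + v x e" by simp
  qed
  also have "\<dots> = 2 * X * (m + Y * M) + integral {-X..X} (\<lambda>x. v x e)"
    using X by (subst integral_add) (auto intro!: integrable_continuous_real cv)
  finally show ?thesis using A by (simp add: power2_eq_square algebra_simps)
qed

text \<open>
  Replacing \<open>\<bar>Re w\<bar>\<close> by \<open>sqrt ((Re w)\<^sup>2 + d\<^sup>2)\<close> keeps the values in the open right half-plane, where the
  complex power is smooth, and preserves subharmonicity. The functions with suffix \<open>d1\<close>, \<open>d2\<close> are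
  the first and second derivatives along a curve through \<open>w\<close> with velocity \<open>a\<close> and acceleration \<open>b\<close>.
\<close>

definition regularize :: "real \<Rightarrow> complex \<Rightarrow> complex" where
  "regularize d w = Complex (sqrt ((Re w)\<^sup>2 + d\<^sup>2)) (Im w)"

definition regularize_d1 :: "real \<Rightarrow> complex \<Rightarrow> complex \<Rightarrow> complex" where
  "regularize_d1 d w a = Complex (Re w * Re a / Re (regularize d w)) (Im a)"

definition regularize_d2 :: "real \<Rightarrow> complex \<Rightarrow> complex \<Rightarrow> complex \<Rightarrow> complex" where
  "regularize_d2 d w a b = Complex
     ((Re a)\<^sup>2 * d\<^sup>2 / Re (regularize d w) ^ 3 + Re w * Re b / Re (regularize d w)) (Im b)"

definition reg_powr :: "real \<Rightarrow> real \<Rightarrow> complex \<Rightarrow> real" where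
  "reg_powr p d w = Re (regularize d w powr of_real p)"

definition reg_powr_d1 :: "real \<Rightarrow> real \<Rightarrow> complex \<Rightarrow> complex \<Rightarrow> real" where
  "reg_powr_d1 p d w a = Re (of_real p * regularize d w powr of_real (p - 1) * regularize_d1 d w a)"

definition reg_powr_d2 :: "real \<Rightarrow> real \<Rightarrow> complex \<Rightarrow> complex \<Rightarrow> complex \<Rightarrow> real" where
  "reg_powr_d2 p d w a b = Re (of_real p * (of_real (p - 1) * regularize d w powr of_real (p - 2) *
      (regularize_d1 d w a)\<^sup>2 + regularize d w powr of_real (p - 1) * regularize_d2 d w a b))"

lemma Re_regularize: "0 < d \<Longrightarrow> 0 < Re (regularize d w)"
  by (simp add: regularize_def add_nonneg_pos)

lemma norm_regularize_le: "0 < d \<Longrightarrow> cmod (regularize d w) \<le> cmod w + d"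
proof -
  assume d: "0 < d"
  have "cmod (regularize d w) = sqrt ((cmod w)\<^sup>2 + d\<^sup>2)"
    by (simp add: regularize_def cmod_def add_ac)
  also have "\<dots> \<le> cmod w + d"
    using d by (intro real_le_lsqrt) (auto simp: power2_sum)
  finally show ?thesis .
qed

lemma norm_regularize_d1_le: "0 < d \<Longrightarrow> cmod (regularize_d1 d w a) \<le> 2 * cmod a"
proof -
  assume d: "0 < d"
  have "\<bar>Re w\<bar> \<le> Re (regularize d w)"
    by (simp add: regularize_def real_le_rsqrt)
  then have "\<bar>Re w * Re a / Re (regularize d w)\<bar> \<le> \<bar>Re a\<bar>"
    using Re_regularize[OF d, of w] by (simp add: abs_mult field_simps) (auto intro!: mult_left_mono)
  then show ?thesis
    using cmod_le[of "regularize_d1 d w a"] abs_Re_le_cmod[of a] abs_Im_le_cmod[of a]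
    by (simp add: regularize_d1_def)
qed

lemma regularize_derivative:
  assumes d: "0 < d" and f: "(f has_vector_derivative a) (at t)"
  shows "((\<lambda>t. regularize d (f t)) has_vector_derivative regularize_d1 d (f t) a) (at t)"
proof -
  have "0 < (Re (f t))\<^sup>2 + d\<^sup>2" using d by (simp add: add_nonneg_pos)
  then show ?thesis
    unfolding has_vector_derivative_complex_iff regularize_def regularize_d1_def
    using f by (auto intro!: derivative_eq_intros simp: field_simps)
qed

lemma regularize_d1_derivative:
  assumes d: "0 < d" and f: "(f has_vector_derivative g t) (at t)"
    and g: "(g has_vector_derivative b) (at t)"
  shows "((\<lambda>t. regularize_d1 d (f t) (g t)) has_vector_derivative regularize_d2 d (f t) (g t) b) (at t)"
proof -
  note g' = g[unfolded has_vector_derivative_complex_iff]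
  let ?R = "Re (regularize d (f t))"
  have R: "0 < ?R" by (rule Re_regularize[OF d])
  have R2: "?R\<^sup>2 = (Re (f t))\<^sup>2 + d\<^sup>2" by (simp add: regularize_def)
  note r' = regularize_derivative[OF d f]
  have "((\<lambda>t. Re (f t) * Re (g t) / Re (regularize d (f t))) has_real_derivative
      ((Re (g t) * Re (g t) + Re (f t) * Re b) * ?R - Re (f t) * Re (g t) * (Re (f t) * Re (g t) / ?R)) / (?R * ?R)) (at t)"
    using f g R r' by (auto intro!: derivative_eq_intros simp: regularize_d1_def algebra_simps)
  moreover have "((Re (g t) * Re (g t) + Re (f t) * Re b) * ?R - Re (f t) * Re (g t) * (Re (f t) * Re (g t) / ?R)) / (?R * ?R)
      = (Re (g t))\<^sup>2 * (?R\<^sup>2 - (Re (f t))\<^sup>2) / ?R ^ 3 + Re (f t) * Re b / ?R"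
    using R by (simp add: field_simps power2_eq_square power3_eq_cube)
  ultimately show ?thesis
    using g' unfolding has_vector_derivative_complex_iff regularize_d1_def regularize_d2_def
    by (simp add: R2)
qed

lemma powr_vector_derivative:
  fixes f :: "real \<Rightarrow> complex" and p :: real
  assumes "(f has_vector_derivative a) (at t)" "0 < Re (f t)"
  shows "((\<lambda>t. f t powr of_real p) has_vector_derivative of_real p * f t powr of_real (p - 1) * a) (at t)"
proof -
  have "f t \<notin> \<real>\<^sub>\<le>\<^sub>0" using assms(2) by (auto simp: complex_nonpos_Reals_iff)
  from field_vector_diff_chain_at[OF assms(1) has_field_derivative_powr[OF this, where s = "of_real p"]]
  show ?thesis by (simp add: o_def mult_ac)
qed

lemma reg_powr_derivative:
  assumes d: "0 < d" and f: "(f has_vector_derivative a) (at t)"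
  shows "((\<lambda>t. reg_powr p d (f t)) has_real_derivative reg_powr_d1 p d (f t) a) (at t)"
  unfolding reg_powr_def reg_powr_d1_def
  by (intro has_field_derivative_Re powr_vector_derivative regularize_derivative Re_regularize d f)

lemma reg_powr_d1_derivative:
  assumes d: "0 < d" and f: "(f has_vector_derivative g t) (at t)"
    and g: "(g has_vector_derivative b) (at t)"
  shows "((\<lambda>t. reg_powr_d1 p d (f t) (g t)) has_real_derivative reg_powr_d2 p d (f t) (g t) b) (at t)"
proof -
  have 1: "((\<lambda>t. regularize d (f t) powr of_real (p - 1)) has_vector_derivative
      of_real (p - 1) * regularize d (f t) powr of_real (p - 2) * regularize_d1 d (f t) (g t)) (at t)"
    using powr_vector_derivative[OF regularize_derivative[OF d f] Re_regularize[OF d], of "p - 1"]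
    by (simp add: algebra_simps)
  have "((\<lambda>t. of_real p * (regularize d (f t) powr of_real (p - 1) * regularize_d1 d (f t) (g t))) has_vector_derivative
     of_real p * (regularize d (f t) powr of_real (p - 1) * regularize_d2 d (f t) (g t) b +
       (of_real (p - 1) * regularize d (f t) powr of_real (p - 2) * regularize_d1 d (f t) (g t)) * regularize_d1 d (f t) (g t))) (at t)"
    by (intro has_vector_derivative_mult_right has_vector_derivative_mult 1 regularize_d1_derivative[OF d f g])
  from has_field_derivative_Re[OF this] show ?thesis
    unfolding reg_powr_d1_def reg_powr_d2_def by (simp add: power2_eq_square algebra_simps)
qed

text \<open>
  The curves \<open>x \<mapsto> F (x + \<i> y)\<close> and \<open>y \<mapsto> F (x + \<i> y)\<close> have velocities \<open>a\<close>, \<open>\<i> * a\<close> and accelerations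
  \<open>b\<close>, \<open>- b\<close>, so the sum below is a Laplacian.
\<close>

lemma reg_powr_laplacian_nonneg:
  assumes p: "1 < p" "p \<le> 2" and d: "0 < d"
  shows "0 \<le> reg_powr_d2 p d w a b + reg_powr_d2 p d w (\<i> * a) (- b)"
proof -
  let ?S = "(regularize_d1 d w a)\<^sup>2 + (regularize_d1 d w (\<i> * a))\<^sup>2" and ?L = "regularize_d2 d w a b + regularize_d2 d w (\<i> * a) (- b)"
  define W where "W = regularize d w"
  define R where "R = Re W"
  have R: "0 < R" unfolding R_def W_def by (rule Re_regularize[OF d])
  have R2: "R\<^sup>2 = (Re w)\<^sup>2 + d\<^sup>2" by (simp add: R_def W_def regularize_def)
  \<comment> \<open>For holomorphic data the squares of a and i a cancel, and so do b and - b. What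
    remains is due to the regularization: multiples of the same \<open>c\<close> in the squared
    velocities and in the accelerations.\<close>
  define c where "c = (cmod a)\<^sup>2 * d\<^sup>2 / R ^ 3"
  have c: "0 \<le> c" using R by (simp add: c_def)
  have sq: "?S = - of_real (c * R)"
  proof (rule complex_eqI)
    have "Re ?S = ((Re w)\<^sup>2 - R\<^sup>2) * (cmod a)\<^sup>2 / R\<^sup>2"
      unfolding cmod_power2 using R by (simp add: regularize_d1_def power2_eq_square field_simps flip: W_def R_def)
    also have "\<dots> = - (c * R)"
    proof -
      have "(Re w)\<^sup>2 - R\<^sup>2 = - d\<^sup>2" using R2 by simp
      moreover have "c * R = d\<^sup>2 * (cmod a)\<^sup>2 / R\<^sup>2"
        using R by (simp add: c_def power2_eq_square power3_eq_cube)
      ultimately show ?thesis by simp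
    qed
    finally show "Re ?S = Re (- of_real (c * R))" by simp
    show "Im ?S = Im (- of_real (c * R))"
      by (simp add: regularize_d1_def power2_eq_square)
  qed
  have lin: "?L = of_real c"
    by (rule complex_eqI) (simp_all add: regularize_d2_def c_def cmod_power2 add_divide_distrib distrib_right
      flip: W_def R_def)
  have "reg_powr_d2 p d w a b + reg_powr_d2 p d w (\<i> * a) (- b) =
      Re (of_real p * (of_real (p - 1) * W powr of_real (p - 2) * ?S + W powr of_real (p - 1) * ?L))"
    unfolding reg_powr_d2_def W_def plus_complex.sel(1)[symmetric] by (simp only: algebra_simps)
  also have "\<dots> = Re (of_real (p * c) * (W powr of_real (p - 1) - of_real ((p - 1) * R) * W powr of_real (p - 1 - 1)))"
    unfolding sq lin by (simp add: algebra_simps)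
  also have "\<dots> = p * c * Re (W powr of_real (p - 1) - of_real ((p - 1) * R) * W powr of_real (p - 1 - 1))"
    by (simp only: Re_complex_of_real Re_divide_of_real times_complex.sel Im_complex_of_real)
  also have "\<dots> \<ge> 0"
    using p c R unfolding R_def by (intro mult_nonneg_nonneg Re_powr_diff_nonneg) auto
  finally show ?thesis .
qed

lemma abs_reg_powr_le: "0 < d \<Longrightarrow> 0 < p \<Longrightarrow> \<bar>reg_powr p d w\<bar> \<le> (cmod w + d) powr p"
proof -
  assume d: "0 < d" and p: "0 < p"
  have "\<bar>reg_powr p d w\<bar> \<le> cmod (regularize d w powr of_real p)"
    unfolding reg_powr_def by (rule abs_Re_le_cmod)
  also have "\<dots> = cmod (regularize d w) powr p" by (simp add: norm_powr_real_powr')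
  also have "\<dots> \<le> (cmod w + d) powr p" using p by (intro powr_mono2 norm_regularize_le d) auto
  finally show ?thesis .
qed

lemma abs_reg_powr_d1_le:
  assumes d: "0 < d" and p: "1 \<le> p"
  shows "\<bar>reg_powr_d1 p d w a\<bar> \<le> 2 * p * (cmod w + d) powr (p - 1) * cmod a"
proof -
  have "\<bar>reg_powr_d1 p d w a\<bar> \<le> cmod (of_real p * regularize d w powr of_real (p - 1) * regularize_d1 d w a)"
    unfolding reg_powr_d1_def by (rule abs_Re_le_cmod)
  also have "\<dots> = p * (cmod (regularize d w) powr (p - 1) * cmod (regularize_d1 d w a))"
    using p by (simp add: norm_mult norm_powr_real_powr' del: of_real_diff)
  also have "\<dots> \<le> p * ((cmod w + d) powr (p - 1) * (2 * cmod a))"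
    using p d by (intro mult_left_mono mult_mono powr_mono2 norm_regularize_le norm_regularize_d1_le) auto
  finally show ?thesis by (simp add: mult_ac)
qed

lemma continuous_on_regularize:
  assumes "continuous_on A f" shows "continuous_on A (\<lambda>z. regularize d (f z))"
  unfolding regularize_def Complex_eq using assms by (intro continuous_intros) auto

lemma continuous_on_reg_powr_d2:
  assumes d: "0 < d" and "continuous_on A f" "continuous_on A g" "continuous_on A h"
  shows "continuous_on A (\<lambda>z. reg_powr_d2 p d (f z) (g z) (h z))"
proof -
  have "Re (regularize d (f z)) \<noteq> 0" for z using Re_regularize[OF d, of "f z"] by auto
  moreover have "A \<subseteq> {z. 0 \<le> Re (regularize d (f z)) \<or> Im (regularize d (f z)) \<noteq> 0}"
    using Re_regularize[OF d] less_imp_le by blast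
  moreover have "regularize d (f z) \<noteq> 0" for z using Re_regularize[OF d, of "f z"] by auto
  ultimately show ?thesis
    unfolding reg_powr_d2_def regularize_d1_def regularize_d2_def Complex_eq
    using assms by (intro continuous_intros continuous_on_regularize) auto
qed

text \<open>
  Tying the regularization to the size of the rectangle, \<open>d = 1 / Y\<close>, makes all boundary terms scale
  in the same way, and they vanish as \<open>Y \<rightarrow> \<infinity>\<close> because \<open>p > 1\<close>.
\<close>

lemma reg_powr_integral_lower_bound:
  fixes F F1 F2 :: "complex \<Rightarrow> complex"
  assumes p: "1 < p" "p \<le> 2" and e: "0 < e"
    and F: "\<And>z. 0 < Im z \<Longrightarrow> (F has_field_derivative F1 z) (at z)"
    and F1: "\<And>z. 0 < Im z \<Longrightarrow> (F1 has_field_derivative F2 z) (at z)"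
    and F2: "continuous_on {z. 0 < Im z} F2"
    and C: "0 \<le> C"
    and bF: "\<And>z. 0 < Im z \<Longrightarrow> r \<le> cmod z \<Longrightarrow> cmod (F z) \<le> C / cmod z"
    and bF1: "\<And>z. 0 < Im z \<Longrightarrow> r \<le> cmod z \<Longrightarrow> cmod (F1 z) \<le> C / (cmod z)\<^sup>2"
    and Y: "0 < Y" "r \<le> Y" "e \<le> Y"
  shows "- (10 * p * (C + 1) powr (p + 1) * Y powr (1 - p)) \<le>
    integral {-Y..Y} (\<lambda>x. reg_powr p (1 / Y) (F (Complex x e)))"
proof -
  define d where "d = 1 / Y"
  have d: "0 < d" using Y by (simp add: d_def)
  \<comment> \<open>At distance at least Y from 0 the sum |F| + d is at most (C + 1) / Y and |F1| at
    most (C + 1) / Y^2. So \<open>m\<close> bounds the function and \<open>M\<close> its first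
    derivatives there; together with the lengths and weights, of order Y, both give Y powr (1 -
    p).\<close>
  define m where "m = (C + 1) powr p * Y powr (- p)"
  define M where "M = 2 * p * (C + 1) powr p * Y powr (- p - 1)"
  have hx: "((\<lambda>x. G (Complex x y)) has_vector_derivative G1 (Complex x y)) (at x)"
    if "0 < y" "\<And>z. 0 < Im z \<Longrightarrow> (G has_field_derivative G1 z) (at z)" for G G1 x y
  proof -
    have "((\<lambda>x. Complex x y) has_vector_derivative 1) (at x)"
      by (auto simp: has_vector_derivative_complex_iff)
    moreover have "(G has_field_derivative G1 (Complex x y)) (at (Complex x y))"
      using that by simp
    ultimately show ?thesis using field_vector_diff_chain_at[of "\<lambda>x. Complex x y" 1 x G] by (simp add: o_def)
  qed
  have hy: "((\<lambda>y. G (Complex x y)) has_vector_derivative \<i> * G1 (Complex x y)) (at y)"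
    if "0 < y" "\<And>z. 0 < Im z \<Longrightarrow> (G has_field_derivative G1 z) (at z)" for G G1 x y
  proof -
    have "((\<lambda>y. Complex x y) has_vector_derivative \<i>) (at y)"
      by (auto simp: has_vector_derivative_complex_iff)
    moreover have "(G has_field_derivative G1 (Complex x y)) (at (Complex x y))"
      using that by simp
    ultimately show ?thesis using field_vector_diff_chain_at[of "\<lambda>y. Complex x y" \<i> y G] by (simp add: o_def)
  qed
  have iF1: "((\<lambda>z. \<i> * F1 z) has_field_derivative \<i> * F2 z) (at z)" if "0 < Im z" for z
    using F1[OF that] by (rule DERIV_cmult)
  have far: "cmod (F z) + d \<le> (C + 1) / Y \<and> cmod (F1 z) \<le> (C + 1) / Y\<^sup>2" if "0 < Im z" "Y \<le> cmod z" for z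
  proof -
    have "cmod (F z) \<le> C / cmod z" using bF that Y by simp
    also have "\<dots> \<le> C / Y" using that Y C by (intro divide_left_mono mult_pos_pos) auto
    finally have 1: "cmod (F z) + d \<le> (C + 1) / Y" by (simp add: d_def add_divide_distrib)
    have "cmod (F1 z) \<le> C / (cmod z)\<^sup>2" using bF1 that Y by simp
    also have "\<dots> \<le> (C + 1) / Y\<^sup>2" using that Y C by (intro frac_le power_mono) auto
    finally show ?thesis using 1 by simp
  qed
  have far1: "\<bar>reg_powr_d1 p d (F z) a\<bar> \<le> M"
    if z: "0 < Im z" "Y \<le> cmod z" and a: "cmod a = cmod (F1 z)" for z a
  proof -
    have "\<bar>reg_powr_d1 p d (F z) a\<bar> \<le> 2 * p * (cmod (F z) + d) powr (p - 1) * cmod a"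
      using p by (intro abs_reg_powr_d1_le d) auto
    also have "\<dots> \<le> 2 * p * ((C + 1) / Y) powr (p - 1) * ((C + 1) / Y\<^sup>2)"
      using far[OF z] p d C Y unfolding a by (intro mult_mono powr_mono2) auto
    also have "\<dots> = M"
    proof -
      have "(c / Y) powr (p - 1) * (c / Y\<^sup>2) = c powr p * Y powr (- p - 1)" if "0 < c" for c
        using that Y by (simp add: powr_divide powr_diff powr_minus power2_eq_square field_simps)
      moreover have "0 < C + 1" using C by simp
      ultimately show ?thesis unfolding M_def by (simp only: mult.assoc)
    qed
    finally show ?thesis .
  qed
  have nX: "Y \<le> cmod (Complex x y)" if "\<bar>x\<bar> = Y" for x y
    using abs_Re_le_cmod[of "Complex x y"] that by simp
  have nY: "Y \<le> cmod (Complex x Y)" for x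
    using abs_Im_le_cmod[of "Complex x Y"] Y by simp
  let ?vx = "\<lambda>x y. reg_powr_d1 p d (F (Complex x y)) (F1 (Complex x y))"
  let ?vy = "\<lambda>x y. reg_powr_d1 p d (F (Complex x y)) (\<i> * F1 (Complex x y))"
  let ?vxx = "\<lambda>x y. reg_powr_d2 p d (F (Complex x y)) (F1 (Complex x y)) (F2 (Complex x y))"
  let ?vyy = "\<lambda>x y. reg_powr_d2 p d (F (Complex x y)) (\<i> * F1 (Complex x y)) (- F2 (Complex x y))"
  have "- (2 * Y * (m + Y * M) + 2 * M * Y\<^sup>2) \<le> integral {-Y..Y} (\<lambda>x. reg_powr p d (F (Complex x e)))"
  proof (rule subharmonic_rectangle_bound[where
      vx = ?vx and vy = ?vy and vxx = ?vxx and vyy = ?vyy])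
    show "((\<lambda>y. reg_powr p d (F (Complex x y))) has_real_derivative ?vy x y) (at y)" if "0 < y" for x y
      by (rule reg_powr_derivative[OF d hy[OF that F]])
    show "((\<lambda>x. reg_powr p d (F (Complex x y))) has_real_derivative ?vx x y) (at x)" if "0 < y" for x y
      by (rule reg_powr_derivative[OF d hx[OF that F]])
    show "((\<lambda>y. ?vy x y) has_real_derivative ?vyy x y) (at y)" if "0 < y" for x y
      using reg_powr_d1_derivative[OF d hy[OF that F] hy[OF that iF1]] by simp
    show "((\<lambda>x. ?vx x y) has_real_derivative ?vxx x y) (at x)" if "0 < y" for x y
      by (rule reg_powr_d1_derivative[OF d hx[OF that F] hx[OF that F1]])
    have cF: "continuous_on {z. 0 < Im z} F" "continuous_on {z. 0 < Im z} F1"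
      using F F1 by (auto intro!: continuous_at_imp_continuous_on DERIV_isCont)
    have cC: "continuous_on A (\<lambda>z. Complex (fst z) (snd z))" for A :: "(real \<times> real) set"
      unfolding Complex_eq by (intro continuous_intros)
    have sub: "(\<lambda>z. Complex (fst z) (snd z)) ` cbox (- Y, e) (Y, Y) \<subseteq> {z. 0 < Im z}"
      using e by (auto simp: cbox_Pair_eq)
    show "continuous_on (cbox (- Y, e) (Y, Y)) (\<lambda>(x, y). ?vyy x y)"
      unfolding split_def
      by (intro continuous_on_reg_powr_d2 d continuous_intros continuous_on_compose2[OF _ cC sub] cF F2)
    show "0 \<le> ?vxx x y + ?vyy x y" for x y
      by (rule reg_powr_laplacian_nonneg[OF p d])
    show "\<bar>reg_powr p d (F (Complex x Y))\<bar> \<le> m" for x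
    proof -
      have "\<bar>reg_powr p d (F (Complex x Y))\<bar> \<le> (cmod (F (Complex x Y)) + d) powr p"
        using p by (intro abs_reg_powr_le d) auto
      also have "\<dots> \<le> ((C + 1) / Y) powr p"
        using far[of "Complex x Y"] nY Y p d by (intro powr_mono2) auto
      also have "\<dots> = m" using C Y by (simp add: m_def powr_divide powr_minus field_simps)
      finally show ?thesis .
    qed
    show "\<bar>reg_powr_d1 p d (F (Complex x Y)) (\<i> * F1 (Complex x Y))\<bar> \<le> M" for x
      using nY Y by (intro far1) (auto simp: norm_mult)
    show "\<bar>?vx x y\<bar> \<le> M" if "\<bar>x\<bar> = Y" "e \<le> y" for x y
      using nX that e by (intro far1) auto
  qed (use e Y in auto)
  moreover have "2 * Y * (m + Y * M) + 2 * M * Y\<^sup>2 \<le> 10 * p * (C + 1) powr (p + 1) * Y powr (1 - p)"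
  proof -
    have 1: "Y * m = (C + 1) powr p * Y powr (1 - p)"
      using Y by (simp add: m_def powr_diff powr_minus field_simps)
    have 2: "Y\<^sup>2 * M = 2 * p * (C + 1) powr p * Y powr (1 - p)"
      using Y by (simp add: M_def powr_diff powr_minus power2_eq_square field_simps)
    have "2 * Y * (m + Y * M) + 2 * M * Y\<^sup>2 = 2 * (Y * m) + 4 * (Y\<^sup>2 * M)"
      by (simp add: algebra_simps power2_eq_square)
    also have "\<dots> = (2 + 8 * p) * ((C + 1) powr p * Y powr (1 - p))"
      unfolding 1 2 by (simp add: algebra_simps)
    also have "\<dots> \<le> (10 * p) * ((C + 1) powr (p + 1) * Y powr (1 - p))"
      using p C by (intro mult_mono mult_right_mono powr_mono) auto
    finally show ?thesis by (simp add: mult_ac)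
  qed
  ultimately show ?thesis unfolding d_def by linarith
qed

subsection \<open>Derivatives and decay of the Cauchy integral\<close>

text \<open>The derivatives of the Cauchy integral up to constant factors. The family is closed
  under differentiation, so one lemma supplies \<open>F1\<close>, \<open>F2\<close> and the
  continuity of \<open>F2\<close>.\<close>

definition cauchy_power :: "nat \<Rightarrow> (real \<Rightarrow> complex) \<Rightarrow> complex \<Rightarrow> complex" where
  "cauchy_power k u z = (LINT t|lborel. u t / (z - of_real t) ^ k)"

lemma norm_inverse_power_le:
  assumes "0 < d" "d \<le> Im z"
  shows "cmod (1 / (z - of_real t) ^ k) \<le> 1 / d ^ k"
proof -
  have "d \<le> cmod (z - of_real t)"
    using abs_Im_le_cmod[of "z - of_real t"] assms by simp
  then show ?thesis using assms by (simp add: norm_divide norm_power frac_le power_mono)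
qed

lemma integrable_cauchy_power_kernel:
  assumes u: "integrable lborel u" and z: "0 < Im z"
  shows "integrable lborel (\<lambda>t. u t / (z - of_real t) ^ k)"
proof (rule Bochner_Integration.integrable_bound)
  show "integrable lborel (\<lambda>t. u t * of_real (1 / Im z ^ k))"
    using u by simp
  have [measurable]: "u \<in> borel_measurable borel" using u by auto
  show "(\<lambda>t. u t / (z - of_real t) ^ k) \<in> borel_measurable lborel" by measurable
  show "AE t in lborel. norm (u t / (z - of_real t) ^ k) \<le> norm (u t * of_real (1 / Im z ^ k))"
  proof (rule AE_I2)
    fix t
    have "cmod (u t) * cmod (1 / (z - of_real t) ^ k) \<le> cmod (u t) * (1 / Im z ^ k)"
      using z by (intro mult_left_mono norm_inverse_power_le) auto
    then show "norm (u t / (z - of_real t) ^ k) \<le> norm (u t * of_real (1 / Im z ^ k))"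
      using z by (simp add: norm_divide norm_mult norm_power)
  qed
qed

text \<open>The ball of radius \<open>d\<close> about \<open>z\<close> stays at height at least
  \<open>d\<close>, so the second derivative, and with it the Taylor remainder, is bounded uniformly
  in \<open>t\<close>; hence the estimate can be integrated against \<open>u\<close>.\<close>

lemma inverse_power_taylor:
  assumes d: "0 < d" "Im z = 2 * d" and w: "cmod (w - z) < d"
  shows "cmod (1 / (w - of_real t) ^ k - 1 / (z - of_real t) ^ k + of_nat k * (w - z) / (z - of_real t) ^ Suc k)
     \<le> real (k * Suc k) / d ^ (k + 2) * (cmod (w - z))\<^sup>2"
proof -
  \<comment> \<open>\<open>c i\<close> is the coefficient of the i-th derivative for i <= 2; the
    last branch is meant for i = 2, the highest index that the first-order Taylor formula
    uses.\<close>
  define c :: "nat \<Rightarrow> complex" where "c = (\<lambda>i. if i = 0 then 1 else if i = 1 then - of_nat k else of_nat (k * Suc k))"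
  define f where "f = (\<lambda>i \<zeta>. c i * (1 / (\<zeta> - complex_of_real t) ^ (k + i)))"
  have Im: "d \<le> Im x" if "x \<in> ball z d" for x
  proof -
    have "\<bar>Im (z - x)\<bar> < d" using that abs_Im_le_cmod[of "z - x"] by (simp add: dist_norm)
    then show ?thesis using d by auto
  qed
  have "cmod (f 0 w - (\<Sum>i\<le>1. f i z * (w - z) ^ i / (fact i))) \<le> (real (k * Suc k) / d ^ (k + 2)) * cmod (w - z) ^ (Suc 1) / fact 1"
  proof (rule complex_Taylor[where S = "ball z d"])
    show "convex (ball z d)" by simp
    show "z \<in> ball z d" "w \<in> ball z d" using d w by (auto simp: dist_norm norm_minus_commute)
    fix x assume x: "x \<in> ball z d"
    have x0: "x - of_real t \<noteq> 0" using Im[OF x] d by (auto simp: complex_eq_iff)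
    show "cmod (f (Suc 1) x) \<le> real (k * Suc k) / d ^ (k + 2)"
    proof -
      have "cmod (f (Suc 1) x) = real (k * Suc k) * cmod (1 / (x - of_real t) ^ (k + 2))"
      proof -
        have "f (Suc 1) x = of_nat (k * Suc k) * (1 / (x - of_real t) ^ (k + 2))"
          by (simp add: f_def c_def)
        then show ?thesis by (simp only: norm_mult norm_of_nat)
      qed
      also have "\<dots> \<le> real (k * Suc k) * (1 / d ^ (k + 2))"
        using d Im[OF x] by (intro mult_left_mono norm_inverse_power_le) auto
      finally show ?thesis by simp
    qed
    fix i :: nat assume "i \<le> 1"
    have D: "((\<lambda>\<zeta>. 1 / (\<zeta> - complex_of_real t) ^ m) has_field_derivative - of_nat m / (x - of_real t) ^ Suc m) (at x within ball z d)" for m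
    proof (cases m)
      case (Suc n)
      define q where "q = x - complex_of_real t"
      have q: "q \<noteq> 0" using x0 by (simp add: q_def)
      have "((\<lambda>\<zeta>. \<zeta> - complex_of_real t) has_field_derivative 1) (at x within ball z d)"
        by (auto intro!: derivative_eq_intros)
      from DERIV_inverse'[OF DERIV_power[OF this, of m]] q
      have "((\<lambda>\<zeta>. inverse ((\<zeta> - complex_of_real t) ^ m)) has_field_derivative
        - (inverse (q ^ m) * (of_nat m * (1 * q ^ (m - Suc 0))) * inverse (q ^ m))) (at x within ball z d)"
        by (simp add: q_def)
      moreover have "- (inverse (q ^ m) * (of_nat m * (1 * q ^ (m - Suc 0))) * inverse (q ^ m)) = - of_nat m / q ^ Suc m"
        using q by (simp add: Suc field_simps)
      ultimately have "((\<lambda>\<zeta>. inverse ((\<zeta> - complex_of_real t) ^ m)) has_field_derivative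
        - of_nat m / q ^ Suc m) (at x within ball z d)" by (simp only:)
      then show ?thesis unfolding q_def inverse_eq_divide .
    qed simp
    have "c (Suc i) = c i * (- of_nat (k + i))" using \<open>i \<le> 1\<close> by (cases i) (auto simp: c_def algebra_simps)
    then show "(f i has_field_derivative f (Suc i) x) (at x within ball z d)"
      unfolding f_def using DERIV_cmult[OF D[of "k + i"], of "c i"] by simp
  qed
  moreover have "(\<Sum>i\<le>1. f i z * (w - z) ^ i / (fact i)) = 1 / (z - of_real t) ^ k - of_nat k * (w - z) / (z - of_real t) ^ Suc k"
    by (simp add: f_def c_def)
  moreover have "f 0 w = 1 / (w - of_real t) ^ k" by (simp add: f_def c_def)
  ultimately have "cmod (1 / (w - of_real t) ^ k - (1 / (z - of_real t) ^ k - of_nat k * (w - z) / (z - of_real t) ^ Suc k))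
      \<le> (real (k * Suc k) / d ^ (k + 2)) * cmod (w - z) ^ (Suc 1) / fact 1" by (simp only:)
  then show ?thesis by (simp only: diff_diff_eq2 add_diff_eq diff_add_eq[symmetric] power2_eq_square) simp
qed

text \<open>Integrating the uniform Taylor estimate shows that the difference quotient misses the
  claimed derivative by at most a constant times |w - z|.\<close>

lemma cauchy_power_derivative:
  assumes u: "integrable lborel u" and z: "0 < Im z"
  shows "(cauchy_power k u has_field_derivative - of_nat k * cauchy_power (Suc k) u z) (at z)"
proof -
  let ?F = "cauchy_power k u"
  let ?F' = "cauchy_power (Suc k) u z"
  define d where "d = Im z / 2"
  have d: "0 < d" "Im z = 2 * d" using z by (auto simp: d_def)
  define K where "K = real (k * Suc k) / d ^ (k + 2)"
  define N where "N = (LINT t|lborel. cmod (u t))"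
  have N0: "0 \<le> N" "0 \<le> K" using d by (auto simp: N_def K_def)
  have main: "cmod ((?F w - ?F z) / (w - z) - (- of_nat k * ?F'))
      \<le> K * N * cmod (w - z)" if w: "cmod (w - z) < d" "w \<noteq> z" for w
  proof -
    let ?h = "\<lambda>t. u t / (w - of_real t) ^ k - u t / (z - of_real t) ^ k + of_nat k * (w - z) * (u t / (z - of_real t) ^ Suc k)"
    have "\<bar>Im (w - z)\<bar> < d" using w abs_Im_le_cmod[of "w - z"] by linarith
    then have Imw: "0 < Im w" using d by auto
    note I = integrable_cauchy_power_kernel[OF u]
    have "?F w - ?F z + of_nat k * (w - z) * ?F' = (LINT t|lborel. ?h t)"
    proof -
      define A B G where "A = (\<lambda>t. u t / (w - of_real t) ^ k)" and "B = (\<lambda>t. u t / (z - of_real t) ^ k)"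
        and "G = (\<lambda>t. u t / (z - of_real t) ^ Suc k)"
      have "integrable lborel A" "integrable lborel B" "integrable lborel G"
        unfolding A_def B_def G_def by (intro I Imw z)+
      then have "(LINT t|lborel. A t) - (LINT t|lborel. B t) + of_nat k * (w - z) * (LINT t|lborel. G t)
        = (LINT t|lborel. A t - B t + of_nat k * (w - z) * G t)" by simp
      then show ?thesis unfolding cauchy_power_def A_def B_def G_def .
    qed
    also have "cmod \<dots> \<le> (LINT t|lborel. K * (cmod (w - z))\<^sup>2 * cmod (u t))"
    proof (rule Bochner_Integration.integral_norm_bound_integral)
      show "integrable lborel ?h"
        using I[OF Imw] I[OF z] by (intro Bochner_Integration.integrable_add Bochner_Integration.integrable_diff integrable_mult_right)
      show "integrable lborel (\<lambda>t. K * (cmod (w - z))\<^sup>2 * cmod (u t))" using u by simp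
      fix t
      have "?h t
        = u t * (1 / (w - of_real t) ^ k - 1 / (z - of_real t) ^ k + of_nat k * (w - z) / (z - of_real t) ^ Suc k)"
        by (simp add: algebra_simps)
      also have "cmod \<dots> \<le> cmod (u t) * (K * (cmod (w - z))\<^sup>2)"
        unfolding norm_mult K_def using inverse_power_taylor[OF d w(1)] by (intro mult_left_mono) auto
      finally show "cmod (?h t) \<le> K * (cmod (w - z))\<^sup>2 * cmod (u t)" by (simp add: mult_ac)
    qed
    also have "\<dots> = K * N * (cmod (w - z))\<^sup>2" by (simp add: N_def)
    finally have A: "cmod (?F w - ?F z + of_nat k * (w - z) * ?F') \<le> K * N * (cmod (w - z))\<^sup>2" .
    have "(?F w - ?F z) / (w - z) - (- of_nat k * ?F') = (?F w - ?F z + of_nat k * (w - z) * ?F') / (w - z)"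
      using w by (simp add: field_simps)
    also have "cmod \<dots> \<le> K * N * (cmod (w - z))\<^sup>2 / cmod (w - z)"
      unfolding norm_divide by (intro divide_right_mono A) auto
    also have "\<dots> = K * N * cmod (w - z)" using w by (simp add: power2_eq_square)
    finally show ?thesis .
  qed
  have "((\<lambda>w. (?F w - ?F z) / (w - z)) \<longlongrightarrow> - of_nat k * ?F') (at z)"
  proof (rule LIM_zero_cancel, rule Lim_null_comparison)
    show "\<forall>\<^sub>F w in at z. cmod ((?F w - ?F z) / (w - z) - (- of_nat k * ?F')) \<le> K * N * cmod (w - z)"
      unfolding eventually_at using d main by (intro exI[of _ d]) (auto simp: dist_norm)
    show "((\<lambda>w. K * N * cmod (w - z)) \<longlongrightarrow> 0) (at z)"
      by (rule tendsto_eq_rhs, (rule tendsto_intros)+) simp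
  qed
  then show ?thesis by (simp add: has_field_derivative_iff)
qed

text \<open>On the support |t| <= R <= |z| / 2, hence |z - t| >= |z| / 2. This is how bounded
  support enters the subharmonic argument.\<close>

lemma cauchy_power_decay:
  assumes u: "integrable lborel u" and supp: "\<And>t. R < \<bar>t\<bar> \<Longrightarrow> u t = 0"
    and z: "0 < Im z" "2 * R \<le> cmod z"
  shows "cmod (cauchy_power k u z) \<le> 2 ^ k * (LINT t|lborel. cmod (u t)) / cmod z ^ k"
proof -
  have z0: "0 < cmod z" using z by auto
  have "cmod (cauchy_power k u z) \<le> (LINT t|lborel. 2 ^ k / cmod z ^ k * cmod (u t))"
    unfolding cauchy_power_def
  proof (rule Bochner_Integration.integral_norm_bound_integral)
    show "integrable lborel (\<lambda>t. u t / (z - of_real t) ^ k)" by (rule integrable_cauchy_power_kernel[OF u z(1)])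
    show "integrable lborel (\<lambda>t. 2 ^ k / cmod z ^ k * cmod (u t))" using u by simp
    fix t
    show "cmod (u t / (z - of_real t) ^ k) \<le> 2 ^ k / cmod z ^ k * cmod (u t)"
    proof (cases "R < \<bar>t\<bar>")
      case True
      then show ?thesis using supp by simp
    next
      case False
      have "cmod z - cmod (of_real t) \<le> cmod (z - of_real t)" by (rule norm_triangle_ineq2)
      then have "cmod z / 2 \<le> cmod (z - of_real t)" using False z by simp
      then have "(cmod z / 2) ^ k \<le> cmod (z - of_real t) ^ k" by (intro power_mono) auto
      then have "cmod (u t) / cmod (z - of_real t) ^ k \<le> cmod (u t) / (cmod z / 2) ^ k"
        using z0 by (intro divide_left_mono mult_pos_pos) (auto intro: order_less_le_trans[rotated])
      then show ?thesis by (simp add: norm_divide norm_power power_divide mult_ac)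
    qed
  qed
  then show ?thesis by simp
qed

lemma Complex_minus_of_real: "Complex (Re z - t) (Im z) = z - of_real t"
  by (simp add: complex_eq_iff)

lemma cauchy_integral_eq_cauchy_power:
  "cauchy_integral u z = \<i> / of_real pi * cauchy_power 1 u z"
  unfolding cauchy_integral_def cauchy_power_def cauchy_kernel_def Complex_minus_of_real
  by (simp flip: integral_mult_right_zero)

section \<open>From the subharmonic estimate to the bound on horizontal lines for p <= 2\<close>

lemma powr_add_le_add_powr:
  fixes a b q :: real
  assumes "0 \<le> a" "0 \<le> b" "0 \<le> q" "q \<le> 1"
  shows "(a + b) powr q \<le> a powr q + b powr q"
proof (cases "a + b = 0")
  case True
  then show ?thesis using assms by simp
next
  case False
  then have ab: "0 < a + b" using assms by simp
  have *: "x / (a + b) \<le> (x / (a + b)) powr q" if "0 \<le> x" "x \<le> a + b" for x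
  proof (cases "x = 0")
    case False
    then have "(x / (a + b)) powr 1 \<le> (x / (a + b)) powr q"
      using that ab assms by (intro powr_mono') auto
    then show ?thesis using that ab by simp
  qed simp
  have "1 = a / (a + b) + b / (a + b)" using ab by (simp add: add_divide_distrib[symmetric])
  also have "\<dots> \<le> (a / (a + b)) powr q + (b / (a + b)) powr q"
    using assms by (intro add_mono *) auto
  also have "\<dots> = (a powr q + b powr q) / (a + b) powr q"
    using assms ab by (simp add: powr_divide add_divide_distrib)
  finally show ?thesis using ab by (simp add: field_simps)
qed

lemma nn_integral_truncation_tendsto:
  fixes g :: "real \<Rightarrow> ennreal"
  assumes [measurable]: "g \<in> borel_measurable borel"
  shows "(\<lambda>n. \<integral>\<^sup>+x. indicator {- real n..real n} x * g x \<partial>lborel) \<longlonglongrightarrow> (\<integral>\<^sup>+x. g x \<partial>lborel)"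
proof (rule nn_integral_LIMSEQ)
  show "incseq (\<lambda>n x. indicator {- real n..real n} x * g x)"
    by (auto simp: incseq_def le_fun_def indicator_def)
  show "(\<lambda>n. indicator {- real n..real n} x * g x) \<longlonglongrightarrow> g x" for x
  proof (rule tendsto_eventually)
    obtain m :: nat where m: "\<bar>x\<bar> \<le> real m" using real_arch_simple by blast
    show "\<forall>\<^sub>F n in sequentially. indicator {- real n..real n} x * g x = g x"
      using eventually_ge_at_top[of m] by eventually_elim (use m in \<open>auto simp: indicator_def\<close>)
  qed
qed auto

text \<open>Integrated over {-Y..Y}, the pointwise inequality for the regularized values loses only
  a multiple of Y powr (1 - p), which vanishes as Y grows. The right-hand side may be infinite, so
  the limit is taken in \<open>ennreal\<close>.\<close>

lemma conjugate_bound_power_le_2: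
  fixes f :: "real \<Rightarrow> real"
  assumes p: "1 < p" "p \<le> 2" and e: "0 < e"
    and f: "integrable lborel f" and supp: "\<And>t. R < \<bar>t\<bar> \<Longrightarrow> f t = 0"
  defines "F \<equiv> cauchy_integral (\<lambda>t. of_real (f t))"
  shows "real_pow_int p lborel (\<lambda>x. Im (F (Complex x e))) \<le>
    ennreal (tan (pi / (2 * p)) powr p) * real_pow_int p lborel (\<lambda>x. Re (F (Complex x e)))"
proof -
  let ?VI = "\<lambda>x. \<bar>Im (F (Complex x e))\<bar> powr p"
  let ?VR = "\<lambda>x. \<bar>Re (F (Complex x e))\<bar> powr p"
  define u where "u = (\<lambda>t. complex_of_real (f t))"
  have u: "integrable lborel u" unfolding u_def using f by simp
  have us: "u t = 0" if "R < \<bar>t\<bar>" for t using supp[OF that] by (simp add: u_def)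
  define N where "N = (LINT t|lborel. cmod (u t))"
  have N: "0 \<le> N" by (simp add: N_def)
  define s where "s = pi / (2 * p)"
  have s: "0 < s" "s < pi / 2" using p by (simp_all add: s_def field_simps)
  have cs: "0 < cos s" "0 < sin s" "0 < tan s" using s by (auto intro: cos_gt_zero sin_gt_zero tan_gt_zero)
  define D where "D = sin s powr (p - 1) / cos s"
  have D: "0 < D" using cs by (simp add: D_def)
  define F1 where "F1 = (\<lambda>z. - (\<i> / of_real pi) * cauchy_power 2 u z)"
  define F2 where "F2 = (\<lambda>z. 2 * (\<i> / of_real pi) * cauchy_power 3 u z)"
  have F': "F = (\<lambda>z. \<i> / of_real pi * cauchy_power 1 u z)"
    unfolding F_def u_def cauchy_integral_eq_cauchy_power ..
  have dF: "(F has_field_derivative F1 z) (at z)" if "0 < Im z" for z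
    using DERIV_cmult[OF cauchy_power_derivative[OF u that, of 1], of "\<i> / of_real pi"]
    unfolding F' F1_def by (simp add: numeral_2_eq_2)
  have dF1: "(F1 has_field_derivative F2 z) (at z)" if "0 < Im z" for z
    using DERIV_cmult[OF cauchy_power_derivative[OF u that, of 2], of "- (\<i> / of_real pi)"]
    unfolding F1_def F2_def by (simp add: numeral_2_eq_2 numeral_3_eq_3 mult_ac)
  have cF2: "continuous_on {z. 0 < Im z} F2"
    using cauchy_power_derivative[OF u, of _ 3] unfolding F2_def
    by (intro continuous_intros) (auto intro!: continuous_at_imp_continuous_on DERIV_isCont)
  \<comment> \<open>The square in the kernel of \<open>F1\<close> requires the factor 2^2 = 4, while
    \<open>F\<close> needs 2; the prefactor 1 / pi is estimated by 1.\<close>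
  define C where "C = 4 * N"
  have C: "0 \<le> C" using N by (simp add: C_def)
  have bF: "cmod (F z) \<le> C / cmod z" if "0 < Im z" "2 * R \<le> cmod z" for z
  proof -
    have "cmod (F z) = cmod (cauchy_power 1 u z) / pi"
      unfolding F' by (simp add: norm_mult norm_divide)
    also have "\<dots> \<le> cmod (cauchy_power 1 u z) / 1"
      using pi_ge_two by (intro divide_left_mono) auto
    also have "\<dots> \<le> 2 * N / cmod z"
      using cauchy_power_decay[OF u us that, of 1] by (simp add: N_def)
    also have "\<dots> \<le> C / cmod z" using N by (intro divide_right_mono) (auto simp: C_def)
    finally show ?thesis .
  qed
  have bF1: "cmod (F1 z) \<le> C / (cmod z)\<^sup>2" if "0 < Im z" "2 * R \<le> cmod z" for z
  proof -
    have "cmod (F1 z) = cmod (cauchy_power 2 u z) / pi"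
      unfolding F1_def by (simp add: norm_mult norm_divide)
    also have "\<dots> \<le> cmod (cauchy_power 2 u z) / 1"
      using pi_ge_two by (intro divide_left_mono) auto
    also have "\<dots> \<le> C / (cmod z)\<^sup>2"
      using cauchy_power_decay[OF u us that, of 2] by (simp add: N_def C_def)
    finally show ?thesis .
  qed
  define K where "K = 10 * p * (C + 1) powr (p + 1)"
  have K: "0 \<le> K" using p by (simp add: K_def)
  have cFl: "continuous_on A (\<lambda>x. F (Complex x e))" for A
  proof -
    have "continuous_on {z. 0 < Im z} F"
      using dF by (auto intro!: continuous_at_imp_continuous_on DERIV_isCont)
    then show ?thesis
      by (rule continuous_on_compose2) (use e in \<open>auto simp: Complex_eq intro!: continuous_intros\<close>)
  qed
  \<comment> \<open>The regularization adds at most Y powr (- p) at each point of an interval of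
    length 2 Y; the lower bound for the integral of \<open>reg_powr\<close> accounts for the summand
    D K.\<close>
  define \<kappa> where "\<kappa> = (\<lambda>Y. (2 * tan s powr p + D * K) * Y powr (1 - p))"
  have step: "integral {-Y..Y} ?VI \<le> tan s powr p * integral {-Y..Y} ?VR + \<kappa> Y"
    if Y: "0 < Y" "2 * R \<le> Y" "e \<le> Y" for Y
  proof -
    let ?G = "\<lambda>x. reg_powr p (1 / Y) (F (Complex x e))"
    let ?B = "\<lambda>x. tan s powr p * (?VR x + Y powr (- p)) - D * ?G x"
    have d: "0 < 1 / Y" using Y by simp
    have ci: "?VI integrable_on {-Y..Y}"
      "?VR integrable_on {-Y..Y}"
      using p by (auto intro!: integrable_continuous_real continuous_intros cFl continuous_on_powr')
    have cp: "?G integrable_on {-Y..Y}"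
    proof (rule integrable_continuous_real)
      have "{-Y..Y} \<subseteq> {x. 0 \<le> Re (regularize (1 / Y) (F (Complex x e))) \<or> Im (regularize (1 / Y) (F (Complex x e))) \<noteq> 0}"
        using Re_regularize[OF d] less_imp_le by blast
      moreover have "regularize (1 / Y) w \<noteq> 0" for w using Re_regularize[OF d, of w] by auto
      ultimately show "continuous_on {-Y..Y} ?G"
        unfolding reg_powr_def by (intro continuous_intros continuous_on_regularize cFl) auto
    qed
    have "integral {-Y..Y} ?VI \<le> integral {-Y..Y} ?B"
    proof (rule integral_le)
      show "?B integrable_on {-Y..Y}"
        using ci cp by (intro integrable_diff integrable_on_mult_right integrable_add) auto
      fix x assume "x \<in> {-Y..Y}"
      define w where "w = F (Complex x e)"
      have "\<bar>Im w\<bar> powr p = \<bar>Im (regularize (1 / Y) w)\<bar> powr p" by (simp add: regularize_def)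
      also have "\<dots> \<le> tan s powr p * Re (regularize (1 / Y) w) powr p - D * Re (regularize (1 / Y) w powr of_real p)"
        unfolding D_def s_def by (rule pichorides_pointwise[OF p Re_regularize[OF d]])
      also have "Re (regularize (1 / Y) w powr of_real p) = reg_powr p (1 / Y) w" by (simp add: reg_powr_def)
      also have "tan s powr p * Re (regularize (1 / Y) w) powr p \<le> tan s powr p * (\<bar>Re w\<bar> powr p + Y powr (- p))"
      proof (rule mult_left_mono)
        have "Re (regularize (1 / Y) w) powr p = ((Re w)\<^sup>2 + (1 / Y)\<^sup>2) powr (p / 2)"
          by (simp add: regularize_def powr_half_sqrt[symmetric] powr_powr)
        \<comment> \<open>Subadditivity of the concave power p / 2 <= 1 splits off the
          regularization; here p <= 2 is used once more.\<close>
        also have "\<dots> \<le> ((Re w)\<^sup>2) powr (p / 2) + ((1 / Y)\<^sup>2) powr (p / 2)"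
          using p by (intro powr_add_le_add_powr) auto
        also have "((Re w)\<^sup>2) powr (p / 2) = \<bar>Re w\<bar> powr p"
        proof -
          have "(Re w)\<^sup>2 = \<bar>Re w\<bar> powr 2" by simp
          then show ?thesis by (simp only: powr_powr) simp
        qed
        also have "((1 / Y)\<^sup>2) powr (p / 2) = Y powr (- p)"
        proof -
          have "(1 / Y)\<^sup>2 = (1 / Y) powr 2" using Y by simp
          then have "((1 / Y)\<^sup>2) powr (p / 2) = (1 / Y) powr p" by (simp only: powr_powr) simp
          then show ?thesis using Y by (simp add: powr_divide powr_minus_divide)
        qed
        finally show "Re (regularize (1 / Y) w) powr p \<le> \<bar>Re w\<bar> powr p + Y powr (- p)" by simp
      qed simp
      finally show "?VI x \<le> tan s powr p * (?VR x + Y powr (- p)) - D * reg_powr p (1 / Y) (F (Complex x e))"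
        by (simp add: w_def)
    qed (use ci in simp)
    also have "\<dots> = tan s powr p * (integral {-Y..Y} ?VR + 2 * Y * Y powr (- p)) - D * integral {-Y..Y} ?G"
    proof (rule integral_unique)
      have "((\<lambda>x. Y powr (- p)) has_integral 2 * Y * Y powr (- p)) {-Y..Y}"
        using has_integral_const_real[of "Y powr (- p)" "-Y" Y] Y by simp
      then show "(?B has_integral tan s powr p * (integral {-Y..Y} ?VR + 2 * Y * Y powr (- p))
        - D * integral {-Y..Y} ?G) {-Y..Y}"
        by (intro has_integral_diff has_integral_mult_right has_integral_add integrable_integral ci cp)
    qed
    also have "\<dots> \<le> tan s powr p * (integral {-Y..Y} ?VR + 2 * Y * Y powr (- p)) - D * (- (K * Y powr (1 - p)))"
    proof -
      have "- (K * Y powr (1 - p)) \<le> integral {-Y..Y} ?G"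
        unfolding K_def by (rule reg_powr_integral_lower_bound[where ?F1.0 = F1 and ?F2.0 = F2 and r = "2 * R", OF p e dF dF1 cF2 C bF bF1 Y])
      then show ?thesis using D by (intro diff_left_mono mult_left_mono) auto
    qed
    finally have A: "integral {-Y..Y} ?VI \<le> tan s powr p * (integral {-Y..Y} ?VR + 2 * Y * Y powr (- p))
        - D * (- (K * Y powr (1 - p)))" .
    have "Y powr (1 - p) = Y * Y powr (- p)" using Y by (simp add: powr_diff powr_minus field_simps)
    then show ?thesis using A unfolding \<kappa>_def by (simp only:) (simp add: algebra_simps)
  qed
  define gI where "gI = (\<lambda>x. ennreal (?VI x))"
  define gR where "gR = (\<lambda>x. ennreal (?VR x))"
  let ?IR = "\<integral>\<^sup>+x. gR x \<partial>lborel"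
  let ?II = "\<lambda>n. \<integral>\<^sup>+x. indicator {- real n..real n} x * gI x \<partial>lborel"
  have mF: "(\<lambda>x. F (Complex x e)) \<in> borel_measurable borel"
    by (rule borel_measurable_continuous_onI[OF cFl])
  have [measurable]: "gI \<in> borel_measurable borel" "gR \<in> borel_measurable borel"
    unfolding gI_def gR_def using mF by measurable
  have conv: "(\<integral>\<^sup>+x. indicator {-Y..Y} x * ennreal (h x) \<partial>lborel) = ennreal (integral {-Y..Y} h)"
    if "continuous_on {-Y..Y} h" "\<And>x. 0 \<le> h x" for h and Y :: real
  proof -
    have "(h has_integral integral {-Y..Y} h) {-Y..Y}"
      using that by (intro integrable_integral integrable_continuous_real)
    from nn_integral_has_integral_lebesgue[OF _ this] that(2) show ?thesis
      by (simp add: ennreal_mult' ennreal_indicator)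
  qed
  have stepn: "?II n \<le> ennreal (tan s powr p) * ?IR + ennreal (\<kappa> (real n))"
    if n: "0 < real n" "2 * R \<le> real n" "e \<le> real n" for n
  proof -
    have k0: "0 \<le> \<kappa> (real n)" using D K by (simp add: \<kappa>_def)
    have "?II n = ennreal (integral {- real n..real n} ?VI)"
      unfolding gI_def using p by (intro conv) (auto intro!: continuous_intros cFl continuous_on_powr')
    also have "\<dots> \<le> ennreal (tan s powr p * integral {- real n..real n} ?VR + \<kappa> (real n))"
      by (intro ennreal_leI step n)
    also have "\<dots> = ennreal (tan s powr p) * ennreal (integral {- real n..real n} ?VR) + ennreal (\<kappa> (real n))"
    proof -
      have "?VR integrable_on {- real n..real n}"
        using p by (auto intro!: integrable_continuous_real continuous_intros cFl continuous_on_powr')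
      from integral_nonneg[OF this] k0 show ?thesis
        by (subst ennreal_plus) (auto simp: ennreal_mult')
    qed
    also have "ennreal (integral {- real n..real n} ?VR) = (\<integral>\<^sup>+x. indicator {- real n..real n} x * gR x \<partial>lborel)"
      unfolding gR_def using p by (intro conv[symmetric]) (auto intro!: continuous_intros cFl continuous_on_powr')
    also have "\<dots> \<le> ?IR"
      by (intro nn_integral_mono) (auto simp: indicator_def)
    finally show ?thesis by (simp add: add_right_mono mult_left_mono)
  qed
  have "?II \<longlonglongrightarrow> (\<integral>\<^sup>+x. gI x \<partial>lborel)"
    by (rule nn_integral_truncation_tendsto) measurable
  moreover have "(\<lambda>n. ennreal (tan s powr p) * ?IR + ennreal (\<kappa> (real n))) \<longlonglongrightarrow> ennreal (tan s powr p) * ?IR + ennreal 0"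
  proof (intro tendsto_add tendsto_const tendsto_ennrealI)
    have "(\<lambda>n. real n powr (1 - p)) \<longlonglongrightarrow> 0"
      using p by (intro tendsto_neg_powr filterlim_real_sequentially) auto
    then show "(\<lambda>n. \<kappa> (real n)) \<longlonglongrightarrow> 0"
      unfolding \<kappa>_def by (rule tendsto_mult_right_zero)
  qed
  moreover have "\<forall>\<^sub>F n in sequentially. ?II n \<le> ennreal (tan s powr p) * ?IR + ennreal (\<kappa> (real n))"
  proof -
    obtain m :: nat where m: "max 1 (max (2 * R) e) \<le> real m" using real_arch_simple by blast
    show ?thesis using eventually_ge_at_top[of m]
      by eventually_elim (use m in \<open>intro stepn, auto\<close>)
  qed
  ultimately have "(\<integral>\<^sup>+x. gI x \<partial>lborel) \<le> ennreal (tan s powr p) * ?IR + ennreal 0"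
    by (intro tendsto_le[OF sequentially_bot]) auto
  then show ?thesis by (simp add: gI_def gR_def s_def)
qed

subsection \<open>The Poisson integral\<close>

lemma poisson_kernel_measurable [measurable]:
  assumes [measurable]: "f \<in> borel_measurable M" "g \<in> borel_measurable M"
  shows "(\<lambda>x. poisson_kernel (f x) (g x)) \<in> borel_measurable M"
  unfolding poisson_kernel_def by measurable

lemma cauchy_kernel_measurable [measurable]:
  assumes [measurable]: "f \<in> borel_measurable M" "g \<in> borel_measurable M"
  shows "(\<lambda>x. cauchy_kernel (f x) (g x)) \<in> borel_measurable M"
  unfolding cauchy_kernel_def Complex_eq by measurable

lemma poisson_kernel_nonneg: "0 \<le> y \<Longrightarrow> 0 \<le> poisson_kernel x y"
  by (simp add: poisson_kernel_def)

lemma poisson_kernel_minus: "poisson_kernel (- x) y = poisson_kernel x y"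
  by (simp add: poisson_kernel_def)

lemma poisson_kernel_le: "0 < y \<Longrightarrow> poisson_kernel x y \<le> 1 / (pi * y)"
proof -
  assume y: "0 < y"
  have "y * (y * pi) \<le> (x\<^sup>2 + y\<^sup>2) * pi" using y by (simp add: power2_eq_square algebra_simps)
  then show ?thesis using y by (simp add: poisson_kernel_def field_simps add_pos_pos add_nonneg_pos)
qed

text \<open>
  This is \<open>- \<partial>/\<partial>r\<close> of \<open>poisson_kernel r y\<close>; it writes the Poisson kernel as a superposition of
  indicators of balls.
\<close>

definition poisson_layer :: "real \<Rightarrow> real \<Rightarrow> real" where
  "poisson_layer r y = 2 * r * y / (pi * (r\<^sup>2 + y\<^sup>2)\<^sup>2)"

lemma poisson_layer_measurable [measurable]:
  assumes [measurable]: "f \<in> borel_measurable M" "g \<in> borel_measurable M"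
  shows "(\<lambda>x. poisson_layer (f x) (g x)) \<in> borel_measurable M"
  unfolding poisson_layer_def by measurable

lemma poisson_layer_nonneg: "0 \<le> r \<Longrightarrow> 0 \<le> y \<Longrightarrow> 0 \<le> poisson_layer r y"
  by (simp add: poisson_layer_def)

lemma nn_integral_poisson_layer_tail:
  assumes y: "0 < y" and r: "0 \<le> \<rho>"
  shows "(\<integral>\<^sup>+r. ennreal (poisson_layer r y) * indicator {\<rho>..} r \<partial>lborel) = ennreal (poisson_kernel \<rho> y)"
proof -
  have pos: "0 < r\<^sup>2 + y\<^sup>2" for r using y by (simp add: add_nonneg_pos)
  have "(\<integral>\<^sup>+r. ennreal (poisson_layer r y) * indicator {\<rho>..} r \<partial>lborel) = ennreal (0 - (- poisson_kernel \<rho> y))"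
  proof (rule nn_integral_FTC_atLeast)
    show "((\<lambda>r. - poisson_kernel r y) has_real_derivative poisson_layer r y) (at r)" for r
    proof -
      have "((\<lambda>r. - (1 / pi * (y / (r\<^sup>2 + y\<^sup>2)))) has_real_derivative
          - (1 / pi * ((0 * (r\<^sup>2 + y\<^sup>2) - y * (2 * r)) / ((r\<^sup>2 + y\<^sup>2) * (r\<^sup>2 + y\<^sup>2))))) (at r)"
        using y by (auto intro!: derivative_eq_intros)
      moreover have "- (1 / pi * ((0 * q - y * (2 * r)) / (q * q))) = 2 * r * y / (pi * q\<^sup>2)" for q
        by (simp add: power2_eq_square)
      ultimately show ?thesis unfolding poisson_kernel_def poisson_layer_def by simp
    qed
    show "((\<lambda>r. - poisson_kernel r y) \<longlongrightarrow> 0) at_top"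
      unfolding poisson_kernel_def using y by real_asymp
  qed (use y r poisson_layer_nonneg in auto)
  then show ?thesis by simp
qed

text \<open>The factor 2 r is the length of a ball of radius r, so the Poisson integral becomes an
  average, of total mass one, of ball averages. This yields both the mass of the kernel and the
  domination by the maximal function.\<close>

lemma nn_integral_poisson_layer:
  assumes y: "0 < y"
  shows "(\<integral>\<^sup>+r. ennreal (2 * r * poisson_layer r y) * indicator {0..} r \<partial>lborel) = 1"
proof -
  have pos: "0 < r\<^sup>2 + y\<^sup>2" for r using y by (simp add: add_nonneg_pos)
  \<comment> \<open>Integration by parts: - 2 r times the kernel plus twice its primitive arctan (r
    / y) / pi.\<close>
  define F where "F = (\<lambda>r. 2 / pi * (arctan (r / y) - r * y / (r\<^sup>2 + y\<^sup>2)))"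
  have "(\<integral>\<^sup>+r. ennreal (2 * r * poisson_layer r y) * indicator {0..} r \<partial>lborel) = ennreal (1 - F 0)"
  proof (rule nn_integral_FTC_atLeast)
    fix r :: real
    have d1: "((\<lambda>r. arctan (r / y)) has_real_derivative y / (r\<^sup>2 + y\<^sup>2)) (at r)"
      using y pos[of r] by (auto intro!: derivative_eq_intros simp: field_simps power2_eq_square)
    have "((\<lambda>r. r * y / (r\<^sup>2 + y\<^sup>2)) has_real_derivative (y * (r\<^sup>2 + y\<^sup>2) - r * y * (2 * r)) / ((r\<^sup>2 + y\<^sup>2) * (r\<^sup>2 + y\<^sup>2))) (at r)"
      using y by (auto intro!: derivative_eq_intros)
    from DERIV_cmult[OF DERIV_diff[OF d1 this], of "2 / pi"]
    have "(F has_real_derivative 2 / pi * (y / (r\<^sup>2 + y\<^sup>2) - (y * (r\<^sup>2 + y\<^sup>2) - r * y * (2 * r)) / ((r\<^sup>2 + y\<^sup>2) * (r\<^sup>2 + y\<^sup>2)))) (at r)"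
      unfolding F_def by simp
    moreover have "2 / pi * (y / (r\<^sup>2 + y\<^sup>2) - (y * (r\<^sup>2 + y\<^sup>2) - r * y * (2 * r)) / ((r\<^sup>2 + y\<^sup>2) * (r\<^sup>2 + y\<^sup>2))) = 2 * r * poisson_layer r y"
    proof -
      define q where "q = r\<^sup>2 + y\<^sup>2"
      have q: "q \<noteq> 0" unfolding q_def using pos[of r] by linarith
      have "y / q - (y * q - r * y * (2 * r)) / (q * q) = 2 * r * r * y / q\<^sup>2"
        using q by (simp add: field_simps power2_eq_square)
      then show ?thesis unfolding poisson_layer_def q_def[symmetric] by simp
    qed
    ultimately show "(F has_real_derivative 2 * r * poisson_layer r y) (at r)" by simp
  next
    have "((\<lambda>r. arctan (r / y)) \<longlongrightarrow> pi / 2) at_top" using y by real_asymp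
    moreover have "((\<lambda>r. r * y / (r\<^sup>2 + y\<^sup>2)) \<longlongrightarrow> 0) at_top" using y by real_asymp
    ultimately have "(F \<longlongrightarrow> 2 / pi * (pi / 2 - 0)) at_top" unfolding F_def by (intro tendsto_intros)
    then show "(F \<longlongrightarrow> 1) at_top" by simp
  qed (use y poisson_layer_nonneg in auto)
  then show ?thesis by (simp add: F_def)
qed

text \<open>The kernel at distance |x - t| is the integral of its layers over r >= |x - t|, that is,
  over the radii for which the ball about x contains t; Tonelli does the rest.\<close>

lemma poisson_layer_cake:
  assumes y: "0 < y" and [measurable]: "g \<in> borel_measurable borel"
  shows "(\<integral>\<^sup>+t. ennreal (poisson_kernel (x - t) y) * g t \<partial>lborel) =
    (\<integral>\<^sup>+r. ennreal (poisson_layer r y) * indicator {0..} r * ball_integral g x r \<partial>lborel)"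
proof -
  let ?w = "\<lambda>r. ennreal (poisson_layer r y) * indicator {0..} r"
  let ?I = "\<lambda>t. \<integral>\<^sup>+r. ?w r * (indicator (cball x r) t * g t) \<partial>lborel"
  have [measurable]: "(\<lambda>z. indicator (cball x (fst z)) (snd z) :: ennreal) \<in> borel_measurable (borel \<Otimes>\<^sub>M borel)"
    "(\<lambda>z. indicator (cball x (snd z)) (fst z) :: ennreal) \<in> borel_measurable (borel \<Otimes>\<^sub>M borel)"
    unfolding indicator_def mem_cball dist_real_def by measurable
  have "(\<integral>\<^sup>+t. ennreal (poisson_kernel (x - t) y) * g t \<partial>lborel) = (\<integral>\<^sup>+t. ?I t \<partial>lborel)"
  proof (rule nn_integral_cong)
    fix t
    have "poisson_kernel (x - t) y = poisson_kernel \<bar>x - t\<bar> y" by (simp add: poisson_kernel_def)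
    then have "ennreal (poisson_kernel (x - t) y) * g t =
        (\<integral>\<^sup>+r. ennreal (poisson_layer r y) * indicator {\<bar>x - t\<bar>..} r \<partial>lborel) * g t"
      using nn_integral_poisson_layer_tail[OF y, of "\<bar>x - t\<bar>"] by simp
    also have "\<dots> = (\<integral>\<^sup>+r. ennreal (poisson_layer r y) * indicator {\<bar>x - t\<bar>..} r * g t \<partial>lborel)"
      by (simp add: nn_integral_multc)
    also have "\<dots> = (?I t)"
      by (intro nn_integral_cong) (auto simp: indicator_def dist_real_def)
    finally show "ennreal (poisson_kernel (x - t) y) * g t = (?I t)" .
  qed
  also have "\<dots> = (\<integral>\<^sup>+r. (\<integral>\<^sup>+t. ?w r * (indicator (cball x r) t * g t) \<partial>lborel) \<partial>lborel)"
    by (rule lborel_pair.Fubini') (simp add: split_def)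
  also have "\<dots> = (\<integral>\<^sup>+r. ?w r * ball_integral g x r \<partial>lborel)"
    by (intro nn_integral_cong nn_integral_cmult) (auto intro!: borel_measurable_times_ennreal borel_measurable_indicator)
  finally show ?thesis .
qed

lemma nn_integral_indicator_cball:
  fixes x r :: real
  assumes "0 \<le> r" shows "(\<integral>\<^sup>+t. indicator (cball x r) t \<partial>lborel) = ennreal (2 * r)"
  using assms by (simp add: cball_eq_atLeastAtMost)

lemma nn_integral_poisson_kernel:
  assumes y: "0 < y"
  shows "(\<integral>\<^sup>+t. ennreal (poisson_kernel (x - t) y) \<partial>lborel) = 1"
proof -
  have "(\<integral>\<^sup>+t. ennreal (poisson_kernel (x - t) y) * 1 \<partial>lborel) =
    (\<integral>\<^sup>+r. ennreal (poisson_layer r y) * indicator {0..} r * (\<integral>\<^sup>+t. indicator (cball x r) t * 1 \<partial>lborel) \<partial>lborel)"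
    by (rule poisson_layer_cake[OF y]) simp
  also have "\<dots> = (\<integral>\<^sup>+r. ennreal (2 * r * poisson_layer r y) * indicator {0..} r \<partial>lborel)"
  proof (rule nn_integral_cong)
    fix r :: real
    show "ennreal (poisson_layer r y) * indicator {0..} r * (\<integral>\<^sup>+t. indicator (cball x r) t * 1 \<partial>lborel) =
       ennreal (2 * r * poisson_layer r y) * indicator {0..} r"
    proof (cases "0 \<le> r")
      case True
      have "(\<integral>\<^sup>+t. indicator (cball x r) t * 1 \<partial>lborel) = ennreal (2 * r)"
        using nn_integral_indicator_cball[OF True] by simp
      moreover have "ennreal (poisson_layer r y) * ennreal (2 * r) = ennreal (2 * r * poisson_layer r y)"
        using True y by (subst ennreal_mult[symmetric]) (auto simp: mult_ac poisson_layer_nonneg)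
      ultimately show ?thesis using True by (simp only:) simp
    qed simp
  qed
  also have "\<dots> = 1" by (rule nn_integral_poisson_layer[OF y])
  finally show ?thesis by simp
qed

lemma nn_integral_poisson_kernel':
  assumes y: "0 < y"
  shows "(\<integral>\<^sup>+x. ennreal (poisson_kernel (x - t) y) \<partial>lborel) = 1"
proof -
  have "poisson_kernel (x - t) y = poisson_kernel (t - x) y" for x
    by (metis minus_diff_eq poisson_kernel_minus)
  then show ?thesis using nn_integral_poisson_kernel[OF y, of t] by simp
qed

text \<open>For a nonintegrable function the Bochner integral is 0 by default, so the bound holds
  for every function; this lets the Poisson estimates be stated for merely measurable
  functions.\<close>

lemma ennreal_norm_integral_le:
  fixes f :: "'a \<Rightarrow> 'b::{banach, second_countable_topology}"
  shows "ennreal (norm (integral\<^sup>L M f)) \<le> (\<integral>\<^sup>+x. ennreal (norm (f x)) \<partial>M)"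
  by (cases "integrable M f") (auto simp: not_integrable_integral_eq intro: integral_norm_bound_ennreal)

text \<open>The tangent line of the convex function s powr p at \<open>a\<close>, rearranged without
  subtraction so that it can be integrated in \<open>ennreal\<close>. It is Young's inequality for s
  and a powr (p - 1).\<close>

lemma powr_tangent:
  fixes a s p :: real
  assumes p: "1 < p" and a: "0 \<le> a" and s: "0 \<le> s"
  shows "p * a powr (p - 1) * s \<le> s powr p + (p - 1) * a powr p"
proof -
  define q where "q = p / (p - 1)"
  have q: "1 < q" "1 / p + 1 / q = 1" using p by (simp_all add: q_def field_simps)
  have "s * a powr (p - 1) \<le> s powr p / p + (a powr (p - 1)) powr q / q"
    using p q s by (intro Youngs_inequality) auto
  also have "(a powr (p - 1)) powr q = a powr p" using p by (simp add: powr_powr q_def)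
  finally have "p * (s * a powr (p - 1)) \<le> p * (s powr p / p + a powr p / q)" using p by simp
  also have "\<dots> = s powr p + (p - 1) * a powr p" using p by (simp add: q_def field_simps)
  finally show ?thesis by (simp add: mult_ac)
qed

text \<open>Jensen's inequality, obtained by integrating the tangent line of \<open>s \<mapsto> s powr p\<close> at \<open>a\<close>.\<close>

lemma norm_integral_powr_le:
  fixes u :: "'a \<Rightarrow> complex" and k :: "'a \<Rightarrow> real"
  assumes p: "1 < p" and k: "\<And>t. 0 \<le> k t" "(\<integral>\<^sup>+t. ennreal (k t) \<partial>M) = 1"
    and [measurable]: "k \<in> borel_measurable M" "u \<in> borel_measurable M"
  shows "ennreal (cmod (LINT t|M. of_real (k t) * u t) powr p) \<le> (\<integral>\<^sup>+t. ennreal (k t) * ennreal (cmod (u t) powr p) \<partial>M)"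
proof -
  let ?J = "\<integral>\<^sup>+t. ennreal (k t) * ennreal (cmod (u t) powr p) \<partial>M"
  define a where "a = cmod (LINT t|M. of_real (k t) * u t)"
  have a: "0 \<le> a" by (simp add: a_def)
  note tang = powr_tangent[OF p a]
  have "ennreal a \<le> (\<integral>\<^sup>+t. ennreal (cmod (of_real (k t) * u t)) \<partial>M)"
    unfolding a_def by (rule ennreal_norm_integral_le)
  then have "ennreal (p * a powr (p - 1)) * ennreal a \<le> ennreal (p * a powr (p - 1)) * (\<integral>\<^sup>+t. ennreal (cmod (of_real (k t) * u t)) \<partial>M)"
    by (rule mult_left_mono) simp
  also have "\<dots> = (\<integral>\<^sup>+t. ennreal (p * a powr (p - 1)) * ennreal (cmod (of_real (k t) * u t)) \<partial>M)"
    by (intro nn_integral_cmult[symmetric]) measurable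
  also have "\<dots> \<le> (\<integral>\<^sup>+t. ennreal (k t) * ennreal (cmod (u t) powr p) + ennreal (k t) * ennreal ((p - 1) * a powr p) \<partial>M)"
  proof (rule nn_integral_mono)
    fix t
    have "p * a powr (p - 1) * cmod (of_real (k t) * u t) = k t * (p * a powr (p - 1) * cmod (u t))"
      using k(1)[of t] by (simp add: norm_mult)
    also have "\<dots> \<le> k t * (cmod (u t) powr p + (p - 1) * a powr p)"
      using k(1)[of t] by (intro mult_left_mono tang) auto
    finally show "ennreal (p * a powr (p - 1)) * ennreal (cmod (of_real (k t) * u t)) \<le>
        ennreal (k t) * ennreal (cmod (u t) powr p) + ennreal (k t) * ennreal ((p - 1) * a powr p)"
      using k(1)[of t] p by (simp add: ennreal_mult[symmetric] ennreal_plus[symmetric] distrib_left del: ennreal_plus)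
  qed
  also have "\<dots> = ?J + ennreal ((p - 1) * a powr p)"
    by (simp add: nn_integral_add nn_integral_multc k(2))
  finally have A: "ennreal (p * a powr (p - 1)) * ennreal a \<le> ?J + ennreal ((p - 1) * a powr p)" .
  have "p * a powr (p - 1) * a = a powr p + (p - 1) * a powr p"
    using a p by (cases "a = 0") (simp_all add: powr_diff field_simps)
  then have "ennreal (p * a powr (p - 1)) * ennreal a = ennreal (a powr p) + ennreal ((p - 1) * a powr p)"
    using a p by (simp add: ennreal_mult'[symmetric] ennreal_plus[symmetric] mult.commute del: ennreal_plus)
  with A have "ennreal ((p - 1) * a powr p) + ennreal (a powr p) \<le>
      ennreal ((p - 1) * a powr p) + ?J" by (simp add: add.commute)
  then show ?thesis unfolding a_def[symmetric] by (simp add: ennreal_add_left_cancel_le)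
qed

text \<open>Jensen's inequality for the kernel as a probability density in t, then Tonelli and the
  symmetry of the kernel, which has mass one in x as well.\<close>

lemma poisson_integral_contraction:
  assumes p: "1 < p" and e: "0 < e" and [measurable]: "u \<in> borel_measurable borel"
  shows "pow_int p lborel (\<lambda>x. poisson_integral u (Complex x e)) \<le> pow_int p lborel u"
proof -
  have "pow_int p lborel (\<lambda>x. poisson_integral u (Complex x e)) \<le>
     (\<integral>\<^sup>+x. (\<integral>\<^sup>+t. ennreal (poisson_kernel (x - t) e) * ennreal (cmod (u t) powr p) \<partial>lborel) \<partial>lborel)"
    unfolding poisson_integral_def complex.sel
    using e by (intro nn_integral_mono norm_integral_powr_le p poisson_kernel_nonneg nn_integral_poisson_kernel) auto
  also have "\<dots> = (\<integral>\<^sup>+t. (\<integral>\<^sup>+x. ennreal (poisson_kernel (x - t) e) * ennreal (cmod (u t) powr p) \<partial>lborel) \<partial>lborel)"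
    by (rule lborel_pair.Fubini') (simp add: split_def)
  also have "\<dots> = pow_int p lborel u"
    by (simp add: nn_integral_multc nn_integral_poisson_kernel'[OF e])
  finally show ?thesis .
qed

text \<open>Common skeleton of the inequalities of Hoelder and Minkowski: a pointwise convexity
  bound, with weights tuned to the given norms, is integrated.\<close>

lemma nn_integral_le_linear_combination:
  fixes F G H :: "'a \<Rightarrow> real"
  assumes c: "0 \<le> \<alpha>" "0 \<le> \<beta>" and AB: "0 \<le> A" "0 \<le> B"
    and [measurable]: "F \<in> borel_measurable M" "G \<in> borel_measurable M"
    and FG: "\<And>x. 0 \<le> F x" "\<And>x. 0 \<le> G x" and H: "\<And>x. H x \<le> \<alpha> * F x + \<beta> * G x"
    and F: "(\<integral>\<^sup>+x. ennreal (F x) \<partial>M) \<le> ennreal A" and G: "(\<integral>\<^sup>+x. ennreal (G x) \<partial>M) \<le> ennreal B"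
  shows "(\<integral>\<^sup>+x. ennreal (H x) \<partial>M) \<le> ennreal (\<alpha> * A + \<beta> * B)"
proof -
  have "(\<integral>\<^sup>+x. ennreal (H x) \<partial>M) \<le> (\<integral>\<^sup>+x. ennreal \<alpha> * ennreal (F x) + ennreal \<beta> * ennreal (G x) \<partial>M)"
    using H c FG by (intro nn_integral_mono)
      (simp add: ennreal_mult[symmetric] ennreal_plus[symmetric] ennreal_leI del: ennreal_plus)
  also have "\<dots> = ennreal \<alpha> * (\<integral>\<^sup>+x. ennreal (F x) \<partial>M) + ennreal \<beta> * (\<integral>\<^sup>+x. ennreal (G x) \<partial>M)"
    by (simp add: nn_integral_add nn_integral_cmult)
  also have "\<dots> \<le> ennreal \<alpha> * ennreal A + ennreal \<beta> * ennreal B"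
    by (intro add_mono mult_left_mono F G) auto
  finally show ?thesis
    using c AB by (simp add: ennreal_mult[symmetric] ennreal_plus[symmetric] del: ennreal_plus)
qed

lemma holder_nn_integral:
  fixes f g :: "'a \<Rightarrow> real"
  assumes p: "1 < p" and q: "1 < q" "1 / p + 1 / q = 1"
    and A: "0 < A" and B: "0 < B"
    and [measurable]: "f \<in> borel_measurable M" "g \<in> borel_measurable M"
    and f: "real_pow_int p M f \<le> ennreal (A powr p)"
    and g: "real_pow_int q M g \<le> ennreal (B powr q)"
  shows "(\<integral>\<^sup>+x. ennreal (\<bar>f x\<bar> * \<bar>g x\<bar>) \<partial>M) \<le> ennreal (A * B)"
proof -
  \<comment> \<open>Young's inequality for |f| / A and |g| / B, multiplied by A B; integrated, the
    two terms are at most A B / p and A B / q.\<close>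
  define \<alpha> \<beta> where "\<alpha> = A * B / (p * A powr p)" and "\<beta> = A * B / (q * B powr q)"
  have pt: "\<bar>f x\<bar> * \<bar>g x\<bar> \<le> \<alpha> * \<bar>f x\<bar> powr p + \<beta> * \<bar>g x\<bar> powr q" for x
  proof -
    have "(\<bar>f x\<bar> / A) * (\<bar>g x\<bar> / B) \<le> (\<bar>f x\<bar> / A) powr p / p + (\<bar>g x\<bar> / B) powr q / q"
      using p q A B by (intro Youngs_inequality) auto
    then have "A * B * ((\<bar>f x\<bar> / A) * (\<bar>g x\<bar> / B)) \<le> A * B * ((\<bar>f x\<bar> / A) powr p / p + (\<bar>g x\<bar> / B) powr q / q)"
      using A B by (intro mult_left_mono) auto
    then show ?thesis using A B by (simp add: \<alpha>_def \<beta>_def powr_divide distrib_left mult_ac)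
  qed
  have c: "0 \<le> \<alpha>" "0 \<le> \<beta>" using p q A B by (auto simp: \<alpha>_def \<beta>_def)
  have "(\<integral>\<^sup>+x. ennreal (\<bar>f x\<bar> * \<bar>g x\<bar>) \<partial>M) \<le> ennreal (\<alpha> * A powr p + \<beta> * B powr q)"
    by (rule nn_integral_le_linear_combination[OF c _ _ _ _ _ _ pt f g]) auto
  also have "\<alpha> * A powr p + \<beta> * B powr q = A * B * (1 / p + 1 / q)"
    using A B by (simp add: \<alpha>_def \<beta>_def distrib_left)
  finally show ?thesis by (simp add: q)
qed

subsection \<open>The conjugate Poisson integral\<close>

definition conj_kernel :: "real \<Rightarrow> real \<Rightarrow> real" where
  "conj_kernel x y = (1 / pi) * (x / (x\<^sup>2 + y\<^sup>2))"

definition conj_integral :: "(real \<Rightarrow> complex) \<Rightarrow> complex \<Rightarrow> complex" where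
  "conj_integral u z = (LINT t|lborel. of_real (conj_kernel (Re z - t) (Im z)) * u t)"

lemma conj_kernel_measurable [measurable]:
  assumes [measurable]: "f \<in> borel_measurable M" "g \<in> borel_measurable M"
  shows "(\<lambda>x. conj_kernel (f x) (g x)) \<in> borel_measurable M"
  unfolding conj_kernel_def by measurable

lemma cauchy_kernel_eq:
  assumes "0 < y" shows "cauchy_kernel x y = of_real (poisson_kernel x y) + \<i> * of_real (conj_kernel x y)"
proof -
  have "0 < x\<^sup>2 + y\<^sup>2" using assms by (simp add: add_nonneg_pos)
  then have A: "1 / Complex x y = Complex (x / (x\<^sup>2 + y\<^sup>2)) (- y / (x\<^sup>2 + y\<^sup>2))"
    by (simp add: complex_eq_iff Re_divide Im_divide)
  have B: "\<i> / of_real pi = Complex 0 (1 / pi)"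
    by (simp add: complex_eq_iff)
  show ?thesis
    unfolding cauchy_kernel_def poisson_kernel_def conj_kernel_def A B
    by (simp add: complex_eq_iff)
qed

lemma conj_kernel_minus: "conj_kernel (- x) y = - conj_kernel x y"
  by (simp add: conj_kernel_def)

lemma norm_cauchy_kernel: "cmod (cauchy_kernel x y) = 1 / (pi * cmod (Complex x y))"
  by (simp add: cauchy_kernel_def norm_mult norm_divide)

lemma norm_cauchy_kernel_le:
  assumes "0 < y" shows "cmod (cauchy_kernel x y) \<le> 1 / (pi * y)"
proof -
  have "y \<le> cmod (Complex x y)" using abs_Im_le_cmod[of "Complex x y"] assms by simp
  then show ?thesis using assms unfolding norm_cauchy_kernel by (intro divide_left_mono mult_pos_pos mult_left_mono) auto
qed

lemma kernel_le_norm_cauchy_kernel: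
  assumes "0 < y"
  shows "\<bar>poisson_kernel x y\<bar> \<le> cmod (cauchy_kernel x y)" "\<bar>conj_kernel x y\<bar> \<le> cmod (cauchy_kernel x y)"
  using abs_Re_le_cmod[of "cauchy_kernel x y"] abs_Im_le_cmod[of "cauchy_kernel x y"]
  by (simp_all add: cauchy_kernel_eq[OF assms])

lemma abs_conj_kernel_le: "0 < y \<Longrightarrow> \<bar>conj_kernel x y\<bar> \<le> 1 / (pi * y)"
  using kernel_le_norm_cauchy_kernel(2) norm_cauchy_kernel_le order_trans by blast

lemma integrable_bounded_mult:
  fixes k u :: "real \<Rightarrow> complex"
  assumes u: "integrable lborel u" and [measurable]: "k \<in> borel_measurable borel" and k: "\<And>t. cmod (k t) \<le> K"
  shows "integrable lborel (\<lambda>t. k t * u t)"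
proof (rule Bochner_Integration.integrable_bound)
  have [measurable]: "u \<in> borel_measurable borel" using u by auto
  show "integrable lborel (\<lambda>t. of_real K * u t)" using u by simp
  show "(\<lambda>t. k t * u t) \<in> borel_measurable lborel" by measurable
  show "AE t in lborel. norm (k t * u t) \<le> norm (of_real K * u t)"
    using k by (intro AE_I2) (auto simp: norm_mult intro!: mult_right_mono intro: order_trans[OF _ abs_ge_self])
qed

lemma cauchy_integral_eq:
  assumes u: "integrable lborel u" and z: "0 < Im z"
  shows "cauchy_integral u z = poisson_integral u z + \<i> * conj_integral u z"
proof -
  have 1: "integrable lborel (\<lambda>t. of_real (poisson_kernel (Re z - t) (Im z)) * u t)"
    using z poisson_kernel_le[OF z] poisson_kernel_nonneg[of "Im z"]
    by (intro integrable_bounded_mult[OF u, where K = "1 / (pi * Im z)"]) auto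
  have 2: "integrable lborel (\<lambda>t. of_real (conj_kernel (Re z - t) (Im z)) * u t)"
    using abs_conj_kernel_le[OF z]
    by (intro integrable_bounded_mult[OF u, where K = "1 / (pi * Im z)"]) auto
  have "cauchy_integral u z = (LINT t|lborel. of_real (poisson_kernel (Re z - t) (Im z)) * u t +
       \<i> * (of_real (conj_kernel (Re z - t) (Im z)) * u t))"
    unfolding cauchy_integral_def cauchy_kernel_eq[OF z] by (simp add: distrib_right mult.assoc)
  also have "\<dots> = poisson_integral u z + \<i> * conj_integral u z"
    unfolding poisson_integral_def conj_integral_def using 1 2 by simp
  finally show ?thesis .
qed

lemma poisson_integral_of_real:
  "poisson_integral (\<lambda>t. of_real (f t)) z = of_real (LINT t|lborel. poisson_kernel (Re z - t) (Im z) * f t)"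
  unfolding poisson_integral_def by (simp flip: integral_complex_of_real)

lemma conj_integral_of_real:
  "conj_integral (\<lambda>t. of_real (f t)) z = of_real (LINT t|lborel. conj_kernel (Re z - t) (Im z) * f t)"
  unfolding conj_integral_def by (simp flip: integral_complex_of_real)

lemma conj_integral_bound_le_2:
  fixes f :: "real \<Rightarrow> real"
  assumes p: "1 < p" "p \<le> 2" and e: "0 < e"
    and f: "integrable lborel f" and supp: "\<And>t. R < \<bar>t\<bar> \<Longrightarrow> f t = 0"
  shows "pow_int p lborel (\<lambda>x. conj_integral (\<lambda>t. of_real (f t)) (Complex x e)) \<le>
    ennreal (tan (pi / (2 * p)) powr p) * real_pow_int p lborel f"
proof -
  let ?P = "\<lambda>x. poisson_integral (\<lambda>t. of_real (f t)) (Complex x e)"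
  let ?Q = "\<lambda>x. conj_integral (\<lambda>t. of_real (f t)) (Complex x e)"
  let ?S = "\<lambda>x. cauchy_integral (\<lambda>t. of_real (f t)) (Complex x e)"
  have [measurable]: "f \<in> borel_measurable borel" using f by auto
  have eq: "?S x = ?P x + \<i> * ?Q x" for x
    using f e by (intro cauchy_integral_eq) auto
  have im: "\<bar>Im (?S x)\<bar> = cmod (?Q x)" for x
    unfolding eq poisson_integral_of_real conj_integral_of_real by simp
  have re: "\<bar>Re (?S x)\<bar> = cmod (?P x)" for x
    unfolding eq poisson_integral_of_real conj_integral_of_real by simp
  have "pow_int p lborel ?Q \<le> ennreal (tan (pi / (2 * p)) powr p) * pow_int p lborel ?P"
    using conjugate_bound_power_le_2[OF p e f supp] unfolding im re by simp
  also have "\<dots> \<le> ennreal (tan (pi / (2 * p)) powr p) * real_pow_int p lborel f"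
  proof (rule mult_left_mono)
    have "pow_int p lborel ?P \<le> pow_int p lborel (\<lambda>x. complex_of_real (f x))"
      using p e by (intro poisson_integral_contraction) auto
    then show "pow_int p lborel ?P \<le> real_pow_int p lborel f" by simp
  qed simp
  finally show ?thesis .
qed

lemma integrable_bounded_support:
  fixes f :: "real \<Rightarrow> 'b::{banach, second_countable_topology}"
  assumes [measurable]: "f \<in> borel_measurable borel" and B: "\<And>t. norm (f t) \<le> B" and supp: "\<And>t. R < \<bar>t\<bar> \<Longrightarrow> f t = 0"
  shows "integrable lborel f"
proof (rule Bochner_Integration.integrable_bound)
  show "integrable lborel (\<lambda>t. B * indicator {-R..R} t :: real)"
    by (intro integrable_mult_right integrable_real_indicator) (auto simp: emeasure_lborel_Icc_eq)
  show "AE t in lborel. norm (f t) \<le> norm (B * indicator {-R..R} t :: real)"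
  proof (rule AE_I2)
    fix t show "norm (f t) \<le> norm (B * indicator {-R..R} t :: real)"
    proof (cases "R < \<bar>t\<bar>")
      case False
      then have "t \<in> {-R..R}" by auto
      then show ?thesis using B[of t] by simp
    qed (simp add: supp)
  qed
qed simp

section \<open>Duality for real functions on a horizontal line\<close>

definition conj_line :: "real \<Rightarrow> (real \<Rightarrow> real) \<Rightarrow> real \<Rightarrow> real" where
  "conj_line e f x = (LINT t|lborel. conj_kernel (x - t) e * f t)"

lemma conj_integral_eq_conj_line:
  "conj_integral (\<lambda>t. of_real (f t)) (Complex x e) = of_real (conj_line e f x)"
  unfolding conj_line_def conj_integral_of_real by simp

lemma conj_line_measurable [measurable]:
  assumes [measurable]: "f \<in> borel_measurable borel"
  shows "conj_line e f \<in> borel_measurable borel"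
proof -
  have "(\<lambda>x. LINT t|lborel. conj_kernel (x - t) e * f t) \<in> borel_measurable borel" by measurable
  then show ?thesis unfolding conj_line_def[abs_def] .
qed

text \<open>A crude bound that degenerates as \<open>e\<close> tends to 0; it makes the truncated
  test function of the duality argument integrable and the truncated integral finite.\<close>

lemma abs_conj_line_le:
  assumes f: "integrable lborel f" and e: "0 < e"
  shows "\<bar>conj_line e f x\<bar> \<le> 1 / (pi * e) * (LINT t|lborel. \<bar>f t\<bar>)"
proof -
  have [measurable]: "f \<in> borel_measurable borel" using f by auto
  have le: "\<bar>conj_kernel (x - t) e * f t\<bar> \<le> 1 / (pi * e) * \<bar>f t\<bar>" for t
    using abs_conj_kernel_le[OF e, of "x - t"] by (simp only: abs_mult) (intro mult_right_mono, auto)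
  have i: "integrable lborel (\<lambda>t. 1 / (pi * e) * \<bar>f t\<bar>)" using f by (intro integrable_mult_right integrable_abs)
  have "integrable lborel (\<lambda>t. conj_kernel (x - t) e * f t)"
    by (rule Bochner_Integration.integrable_bound[OF i]) (auto intro!: AE_I2 order_trans[OF le abs_ge_self] simp only: real_norm_def, simp)
  then have "norm (LINT t|lborel. conj_kernel (x - t) e * f t) \<le> (LINT t|lborel. 1 / (pi * e) * \<bar>f t\<bar>)"
    by (rule Bochner_Integration.integral_norm_bound_integral[OF _ i]) (use le in auto)
  then show ?thesis by (simp add: conj_line_def)
qed

text \<open>At positive height the kernels are bounded, which provides the Fubini hypothesis both
  for the adjoint and for the semigroup identity.\<close>

lemma integrable_kernel_product:
  fixes k :: "real \<Rightarrow> real \<Rightarrow> 'b::{real_normed_field, banach, second_countable_topology}"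
  assumes k[measurable]: "(\<lambda>(x, t). k x t) \<in> borel_measurable (borel \<Otimes>\<^sub>M borel)"
    and K: "\<And>x t. norm (k x t) \<le> K"
    and f: "integrable lborel f" and g: "integrable lborel g"
  shows "integrable (lborel \<Otimes>\<^sub>M lborel) (\<lambda>(x, t). k x t * (f x * g t))"
proof (rule integrableI_bounded)
  have [measurable]: "f \<in> borel_measurable borel" "g \<in> borel_measurable borel" using f g by auto
  have "(\<lambda>z. (\<lambda>(x, t). k x t) z * (f (fst z) * g (snd z))) \<in> borel_measurable (borel \<Otimes>\<^sub>M borel)" by measurable
  then show m: "(\<lambda>(x, t). k x t * (f x * g t)) \<in> borel_measurable (lborel \<Otimes>\<^sub>M lborel)"
    by (simp add: split_def)
  have "(\<integral>\<^sup>+z. ennreal (norm (case z of (x, t) \<Rightarrow> k x t * (f x * g t))) \<partial>(lborel \<Otimes>\<^sub>M lborel)) =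
     (\<integral>\<^sup>+x. \<integral>\<^sup>+t. ennreal (norm (k x t * (f x * g t))) \<partial>lborel \<partial>lborel)"
    using m by (subst lborel.nn_integral_fst[symmetric]) (simp_all add: split_def)
  also have "\<dots> \<le> (\<integral>\<^sup>+x. \<integral>\<^sup>+t. ennreal K * ennreal (norm (f x)) * ennreal (norm (g t)) \<partial>lborel \<partial>lborel)"
  proof (intro nn_integral_mono)
    fix x t
    have "norm (k x t * (f x * g t)) \<le> K * (norm (f x) * norm (g t))"
      unfolding norm_mult by (intro mult_right_mono K) auto
    then show "ennreal (norm (k x t * (f x * g t))) \<le> ennreal K * ennreal (norm (f x)) * ennreal (norm (g t))"
      using order_trans[OF norm_ge_zero K] by (simp add: ennreal_mult[symmetric] mult.assoc ennreal_leI)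
  qed
  also have "\<dots> = ennreal K * (\<integral>\<^sup>+x. ennreal (norm (f x)) \<partial>lborel) * (\<integral>\<^sup>+t. ennreal (norm (g t)) \<partial>lborel)"
    by (simp add: nn_integral_cmult nn_integral_multc)
  also have "\<dots> < \<infinity>" using f g by (simp add: ennreal_mult_less_top integrable_iff_bounded)
  finally show "(\<integral>\<^sup>+z. ennreal (norm (case z of (x, t) \<Rightarrow> k x t * (f x * g t))) \<partial>(lborel \<Otimes>\<^sub>M lborel)) < \<infinity>" .
qed

text \<open>The kernel is odd in x, so exchanging the order of integration makes the operator
  skew-adjoint, and bounds pass to the conjugate exponent with the same constant.\<close>

lemma conj_line_adjoint:
  assumes f: "integrable lborel f" and g: "integrable lborel g" and e: "0 < e"
  shows "(LINT x|lborel. conj_line e f x * g x) = - (LINT t|lborel. f t * conj_line e g t)"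
proof -
  have [measurable]: "f \<in> borel_measurable borel" "g \<in> borel_measurable borel" using f g by auto
  have "integrable (lborel \<Otimes>\<^sub>M lborel) (\<lambda>(x, t). conj_kernel (x - t) e * (g x * f t))"
    using abs_conj_kernel_le[OF e] by (intro integrable_kernel_product[OF _ _ g f]) auto
  from lborel_pair.Fubini_integral[OF this]
  have "(LINT x|lborel. LINT t|lborel. conj_kernel (x - t) e * (g x * f t)) = (LINT t|lborel. LINT x|lborel. conj_kernel (x - t) e * (g x * f t))"
    by simp
  also have "\<dots> = (LINT t|lborel. - (f t * conj_line e g t))"
  proof (rule Bochner_Integration.integral_cong[OF refl])
    fix t
    have k: "conj_kernel (x - t) e = - conj_kernel (t - x) e" for x
      by (metis minus_diff_eq conj_kernel_minus)
    have "(LINT x|lborel. conj_kernel (x - t) e * (g x * f t)) = (LINT x|lborel. (- f t) * (conj_kernel (t - x) e * g x))"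
      unfolding k by (simp add: mult_ac)
    also have "\<dots> = - (f t * conj_line e g t)" unfolding conj_line_def by simp
    finally show "(LINT x|lborel. conj_kernel (x - t) e * (g x * f t)) = - (f t * conj_line e g t)" .
  qed
  finally have "(LINT x|lborel. LINT t|lborel. conj_kernel (x - t) e * (g x * f t)) = - (LINT t|lborel. f t * conj_line e g t)"
    by simp
  moreover have "conj_line e f x * g x = (LINT t|lborel. conj_kernel (x - t) e * (g x * f t))" for x
    unfolding conj_line_def by (subst integral_mult_left_zero[symmetric]) (simp add: mult_ac)
  ultimately show ?thesis by simp
qed

text \<open>
  Duality against \<open>sgn F * \<bar>F\<bar> powr (p - 1)\<close> for \<open>F = conj_line e f\<close>, truncated to make it integrable
  and the integral of \<open>\<bar>F\<bar> powr p\<close> finite.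
\<close>

lemma conj_line_bound_dual:
  fixes f :: "real \<Rightarrow> real"
  assumes p: "2 < p" and r: "1 / p + 1 / r = 1" and e: "0 < e" and A: "0 < A"
    and f: "integrable lborel f"
    and fA: "real_pow_int p lborel f \<le> ennreal (A powr p)"
  shows "real_pow_int p lborel (conj_line e f) \<le> ennreal ((tan (pi / (2 * r)) * A) powr p)"
proof -
  have [measurable]: "f \<in> borel_measurable borel" using f by auto
  have r1: "1 / r = 1 - 1 / p" using r by simp
  have "r = 1 / (1 / r)" by simp
  also have "\<dots> = p / (p - 1)" unfolding r1 using p by (simp add: field_simps)
  finally have r': "r = p / (p - 1)" .
  \<comment> \<open>The conjugate exponent lies in (1, 2], where the bound with tan (pi / (2 r)) is
    already available.\<close>
  have r2: "1 < r" "r \<le> 2" using p unfolding r' by (simp_all add: field_simps)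
  define T where "T = tan (pi / (2 * r))"
  have T: "0 < T" unfolding T_def using r2 by (intro tan_gt_zero) (auto simp: field_simps)
  define F where "F = conj_line e f"
  define K where "K = 1 / (pi * e) * (LINT t|lborel. \<bar>f t\<bar>)"
  have K: "\<bar>F x\<bar> \<le> K" for x unfolding F_def K_def by (rule abs_conj_line_le[OF f e])
  have K0: "0 \<le> K" using K[of 0] by linarith
  have [measurable]: "F \<in> borel_measurable borel" unfolding F_def by measurable
  have step: "(\<integral>\<^sup>+x. indicator {- real n..real n} x * ennreal (\<bar>F x\<bar> powr p) \<partial>lborel) \<le> ennreal ((T * A) powr p)" for n
  proof -
    define I where "I = (\<integral>\<^sup>+x. indicator {- real n..real n} x * ennreal (\<bar>F x\<bar> powr p) \<partial>lborel)"
    have "I \<le> (\<integral>\<^sup>+x. indicator {- real n..real n} x * ennreal (K powr p) \<partial>lborel)"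
      unfolding I_def using K p by (intro nn_integral_mono mult_left_mono ennreal_leI powr_mono2) auto
    also have "\<dots> = ennreal (2 * real n) * ennreal (K powr p)" by (simp add: nn_integral_multc)
    also have "\<dots> < \<infinity>" by (simp add: ennreal_mult_less_top)
    finally have Ifin: "I < \<infinity>" .
    define J where "J = enn2real I"
    have IJ: "I = ennreal J" using Ifin by (simp add: J_def)
    have J0: "0 \<le> J" by (simp add: J_def)
    \<comment> \<open>Since (p - 1) r = p, the r-th power of |g| and the product F g both equal |F|
      powr p on the truncation interval.\<close>
    define g where "g = (\<lambda>x. indicator {- real n..real n} x * (sgn (F x) * \<bar>F x\<bar> powr (p - 1)))"
    have [measurable]: "g \<in> borel_measurable borel" unfolding g_def by measurable
    have gp: "\<bar>g x\<bar> powr r = indicator {- real n..real n} x * \<bar>F x\<bar> powr p" for x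
    proof -
      have "\<bar>g x\<bar> = indicator {- real n..real n} x * \<bar>F x\<bar> powr (p - 1)"
        by (cases "F x = 0") (auto simp: g_def abs_mult abs_sgn_eq indicator_def)
      moreover have "(p - 1) * r = p" using p by (simp add: r')
      ultimately show ?thesis by (simp add: indicator_def powr_powr)
    qed
    have gs: "g t = 0" if "real n < \<bar>t\<bar>" for t using that by (auto simp: g_def indicator_def)
    have gi: "integrable lborel g"
    proof (rule integrable_bounded_support[where R = "real n" and B = "K powr (p - 1)"])
      show "norm (g t) \<le> K powr (p - 1)" for t
        using K p by (auto simp: g_def abs_mult abs_sgn_eq indicator_def intro!: powr_mono2)
      show "real n < \<bar>t\<bar> \<Longrightarrow> g t = 0" for t by (rule gs)
    qed simp
    have gr: "real_pow_int r lborel g = ennreal J"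
      unfolding gp IJ[symmetric] I_def by (intro nn_integral_cong) (auto simp: indicator_def)
    show ?thesis
    proof (cases "J = 0")
      case True
      then show ?thesis using IJ by (simp add: I_def)
    next
      case False
      then have J: "0 < J" using J0 by simp
      have Cg: "real_pow_int r lborel (conj_line e g) \<le> ennreal ((T * J powr (1 / r)) powr r)"
      proof -
        have "real_pow_int r lborel (conj_line e g) \<le> ennreal (T powr r) * ennreal J"
          using conj_integral_bound_le_2[OF r2 e gi gs]
          unfolding gr T_def conj_integral_eq_conj_line norm_of_real .
        also have "\<dots> = ennreal ((T * J powr (1 / r)) powr r)"
          using r2 J T by (simp add: powr_mult powr_powr ennreal_mult[symmetric])
        finally show ?thesis .
      qed
      have Fg: "F x * g x = indicator {- real n..real n} x * \<bar>F x\<bar> powr p" for x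
      proof (cases "F x = 0")
        case False
        then have "F x * sgn (F x) * \<bar>F x\<bar> powr (p - 1) = \<bar>F x\<bar> powr 1 * \<bar>F x\<bar> powr (p - 1)"
          by (simp add: sgn_if)
        also have "\<dots> = \<bar>F x\<bar> powr p" by (subst powr_add[symmetric]) simp
        finally show ?thesis by (simp add: g_def indicator_def)
      qed (simp add: g_def)
      have "J = (LINT x|lborel. F x * g x)"
      proof -
        have "(LINT x|lborel. F x * g x) = enn2real (\<integral>\<^sup>+x. ennreal (F x * g x) \<partial>lborel)"
          unfolding Fg by (rule integral_eq_nn_integral) auto
        also have "(\<integral>\<^sup>+x. ennreal (F x * g x) \<partial>lborel) = I"
          unfolding I_def Fg by (intro nn_integral_cong) (auto simp: indicator_def)
        finally show ?thesis by (simp add: J_def)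
      qed
      also have "\<dots> = - (LINT t|lborel. f t * conj_line e g t)"
        unfolding F_def by (rule conj_line_adjoint[OF f gi e])
      finally have "ennreal J \<le> ennreal (norm (LINT t|lborel. f t * conj_line e g t))"
        by (intro ennreal_leI) auto
      also have "\<dots> \<le> (\<integral>\<^sup>+t. ennreal (\<bar>f t\<bar> * \<bar>conj_line e g t\<bar>) \<partial>lborel)"
        using ennreal_norm_integral_le[of lborel "\<lambda>t. f t * conj_line e g t"] by (simp add: abs_mult)
      also have "\<dots> \<le> ennreal (A * (T * J powr (1 / r)))"
        using p r r2 A T J by (intro holder_nn_integral[OF _ _ _ _ _ _ _ fA Cg]) auto
      finally have "J \<le> (A * T) * J powr (1 / r)" using A T by (simp add: ennreal_le_iff mult.assoc)
      \<comment> \<open>Division by J powr (1 / r) is possible because the truncation made J finite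
        and J = 0 was treated apart; what remains is J powr (1 - 1 / r) = J powr (1 / p).\<close>
      then have "J * J powr (- 1 / r) \<le> (A * T) * J powr (1 / r) * J powr (- 1 / r)"
        by (rule mult_right_mono) simp
      also have "\<dots> = A * T" using J by (simp add: mult.assoc powr_add[symmetric])
      also have "J * J powr (- 1 / r) = J powr (1 / p)"
      proof -
        have "J * J powr (- 1 / r) = J powr (1 + (- 1 / r))" unfolding powr_add using J by simp
        also have "1 + (- 1 / r) = 1 / p" using r1 by simp
        finally show ?thesis .
      qed
      finally have "(J powr (1 / p)) powr p \<le> (A * T) powr p" using p by (intro powr_mono2) auto
      then have "J \<le> (T * A) powr p" using p J by (simp add: powr_powr mult.commute)
      then show ?thesis using IJ by (simp add: I_def ennreal_leI)
    qed
  qed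
  have "real_pow_int p lborel F \<le> ennreal ((T * A) powr p)"
    using step by (intro LIMSEQ_le_const2[OF nn_integral_truncation_tendsto]) auto
  then show ?thesis by (simp add: F_def T_def)
qed

lemma pichorides_constant_pos:
  fixes p p' :: real
  assumes p: "1 < p" and p': "1 / p + 1 / p' = 1"
  shows "0 < tan (pi / 2 * max (1 / p) (1 / p'))"
proof -
  have "0 < 1 / p" "1 / p < 1" using p by auto
  then have "0 < max (1 / p) (1 / p')" "max (1 / p) (1 / p') < 1"
    using p' unfolding less_max_iff_disj max_less_iff_conj by linarith+
  then show ?thesis
    using mult_strict_left_mono[of "max (1 / p) (1 / p')" 1 "pi / 2"] by (intro tan_gt_zero) simp_all
qed

lemma conj_line_bound:
  fixes f :: "real \<Rightarrow> real"
  assumes p: "1 < p" and p': "1 / p + 1 / p' = 1" and e: "0 < e"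
    and f: "integrable lborel f" and supp: "\<And>t. R < \<bar>t\<bar> \<Longrightarrow> f t = 0"
    and fin: "real_pow_int p lborel f < \<infinity>"
  shows "real_pow_int p lborel (conj_line e f) \<le>
    ennreal (tan (pi / 2 * max (1 / p) (1 / p')) powr p) * real_pow_int p lborel f"
proof (cases "p \<le> 2")
  case True
  then have "1 / p' \<le> 1 / p" using p p' by (simp add: field_simps)
  then have m: "pi / 2 * max (1 / p) (1 / p') = pi / (2 * p)" by simp
  show ?thesis
    unfolding m using conj_integral_bound_le_2[OF p True e f, of R] supp
    by (simp only: conj_integral_eq_conj_line norm_of_real)
next
  case False
  then have p2: "2 < p" by simp
  have [measurable]: "f \<in> borel_measurable borel" using f by auto
  have "1 / p < 1 / 2" using p2 by (simp add: field_simps)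
  then have "1 / p \<le> 1 / p'" using p' by linarith
  then have m: "pi / 2 * max (1 / p) (1 / p') = pi / (2 * p')" by simp
  define X where "X = enn2real (real_pow_int p lborel f)"
  have X: "real_pow_int p lborel f = ennreal X" "0 \<le> X" using fin by (simp_all add: X_def)
  show ?thesis
  \<comment> \<open>The duality bound asks for a positive norm. If the norm is 0, then f vanishes
    almost everywhere and its conjugate integral vanishes identically.\<close>
  proof (cases "X = 0")
    case True
    then have "real_pow_int p lborel f = 0" using X by simp
    then have "AE x in lborel. ennreal (\<bar>f x\<bar> powr p) = 0" by (subst (asm) nn_integral_0_iff_AE) auto
    then have "AE x in lborel. f x = 0" by eventually_elim auto
    then have "AE t in lborel. conj_kernel (x - t) e * f t = 0" for x by eventually_elim simp
    then have "conj_line e f x = 0" for x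
      unfolding conj_line_def by (rule integral_eq_zero_AE)
    then show ?thesis by simp
  next
    case False
    define A where "A = X powr (1 / p)"
    have A: "0 < A" "A powr p = X" using False X p by (simp_all add: A_def powr_powr)
    have T: "0 \<le> tan (pi / (2 * p'))" using pichorides_constant_pos[OF p p'] unfolding m by simp
    have "real_pow_int p lborel (conj_line e f) \<le> ennreal ((tan (pi / (2 * p')) * A) powr p)"
      using X A by (intro conj_line_bound_dual p2 p' e f) auto
    also have "\<dots> = ennreal (tan (pi / (2 * p')) powr p) * ennreal X"
      using A T X by (simp add: powr_mult ennreal_mult)
    finally show ?thesis unfolding m X .
  qed
qed

section \<open>Rotation averages and complex-valued functions\<close>

lemma nn_integral_translate:
  fixes f :: "real \<Rightarrow> ennreal"
  assumes "f \<in> borel_measurable borel"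
  shows "(\<integral>\<^sup>+x. f (a + x) \<partial>lborel) = (\<integral>\<^sup>+x. f x \<partial>lborel)"
  using nn_integral_real_affine[OF assms, of 1 a] by simp

text \<open>The translated period is cut at \<open>L\<close>, and the part beyond it is moved back
  by one period.\<close>

lemma nn_integral_periodic_shift:
  fixes h :: "real \<Rightarrow> ennreal"
  assumes [measurable]: "h \<in> borel_measurable borel" and per: "\<And>x. h (x + L) = h x"
    and a: "0 \<le> a" "a \<le> L"
  shows "(\<integral>\<^sup>+x. indicator {0..<L} x * h (x + a) \<partial>lborel) = (\<integral>\<^sup>+x. indicator {0..<L} x * h x \<partial>lborel)"
proof -
  have "(\<integral>\<^sup>+x. indicator {0..<L} x * h (x + a) \<partial>lborel) = (\<integral>\<^sup>+x. indicator {a..<L + a} (a + x) * h (a + x) \<partial>lborel)"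
    by (intro nn_integral_cong) (auto simp: indicator_def add.commute)
  also have "\<dots> = (\<integral>\<^sup>+x. indicator {a..<L + a} x * h x \<partial>lborel)"
    by (rule nn_integral_translate[of "\<lambda>x. indicator {a..<L + a} x * h x"]) measurable
  also have "\<dots> = (\<integral>\<^sup>+x. indicator {a..<L} x * h x + indicator {L..<L + a} x * h x \<partial>lborel)"
    using a by (intro nn_integral_cong) (auto simp: indicator_def)
  also have "\<dots> = (\<integral>\<^sup>+x. indicator {a..<L} x * h x \<partial>lborel) + (\<integral>\<^sup>+x. indicator {L..<L + a} x * h x \<partial>lborel)"
    by (rule nn_integral_add) auto
  also have "(\<integral>\<^sup>+x. indicator {L..<L + a} x * h x \<partial>lborel) = (\<integral>\<^sup>+x. indicator {L..<L + a} (L + x) * h (L + x) \<partial>lborel)"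
    by (rule nn_integral_translate[symmetric]) measurable
  also have "\<dots> = (\<integral>\<^sup>+x. indicator {0..<a} x * h x \<partial>lborel)"
    using per by (intro nn_integral_cong) (auto simp: indicator_def add.commute)
  also have "(\<integral>\<^sup>+x. indicator {a..<L} x * h x \<partial>lborel) + \<dots> = (\<integral>\<^sup>+x. indicator {a..<L} x * h x + indicator {0..<a} x * h x \<partial>lborel)"
    by (rule nn_integral_add[symmetric]) auto
  also have "\<dots> = (\<integral>\<^sup>+x. indicator {0..<L} x * h x \<partial>lborel)"
    using a by (intro nn_integral_cong) (auto simp: indicator_def)
  finally show ?thesis .
qed

text \<open>The rotation average of a unit vector. It is a factor on both sides of the averaged
  inequality and is cancelled there, so what matters is that it is positive and finite.\<close>

definition cos_moment :: "real \<Rightarrow> ennreal" where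
  "cos_moment p = (\<integral>\<^sup>+t. indicator {0..<2 * pi} t * ennreal (\<bar>cos t\<bar> powr p) \<partial>lborel)"

lemma cos_moment_bounds:
  assumes "0 < p" shows "cos_moment p \<noteq> 0" "cos_moment p \<noteq> \<infinity>"
proof -
  have "cos_moment p \<le> (\<integral>\<^sup>+t. indicator {0..<2 * pi} t \<partial>lborel)"
    unfolding cos_moment_def using assms
    by (intro nn_integral_mono) (auto simp: indicator_def intro!: powr_le1)
  also have "\<dots> < \<infinity>" by simp
  finally show "cos_moment p \<noteq> \<infinity>" by simp
  have "(\<integral>\<^sup>+t. indicator {0..pi / 3} t * ennreal ((1 / 2) powr p) \<partial>lborel) \<le> cos_moment p"
    unfolding cos_moment_def
  proof (intro nn_integral_mono)
    fix t :: real
    show "indicator {0..pi / 3} t * ennreal ((1 / 2) powr p) \<le> indicator {0..<2 * pi} t * ennreal (\<bar>cos t\<bar> powr p)"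
    proof (cases "t \<in> {0..pi / 3}")
      case True
      then have "cos (pi / 3) \<le> cos t" by (intro cos_monotone_0_pi_le) auto
      then have "1 / 2 \<le> \<bar>cos t\<bar>" by (simp add: cos_60)
      moreover have "t \<le> pi / 3" using True by simp
      then have "t < 2 * pi" using pi_gt_zero by linarith
      ultimately show ?thesis using True assms by (auto simp: indicator_def intro!: powr_mono2 ennreal_leI)
    qed simp
  qed
  moreover have "(\<integral>\<^sup>+t. indicator {0..pi / 3} t * ennreal ((1 / 2) powr p) \<partial>lborel) = ennreal (pi / 3) * ennreal ((1 / 2) powr p)"
    by (simp add: nn_integral_multc)
  moreover have "0 < ennreal (pi / 3) * ennreal ((1 / 2) powr p)" by (simp add: ennreal_zero_less_mult_iff)
  ultimately show "cos_moment p \<noteq> 0" by auto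
qed

text \<open>Since |Re (cis t w)| = |w| |cos (t + a)| with \<open>a\<close> an argument of w,
  periodicity makes the average independent of \<open>a\<close>.\<close>

lemma nn_integral_rotation_average:
  assumes p: "0 < p"
  shows "(\<integral>\<^sup>+t. indicator {0..<2 * pi} t * ennreal (\<bar>Re (cis t * w)\<bar> powr p) \<partial>lborel) = cos_moment p * ennreal (cmod w powr p)"
proof -
  \<comment> \<open>\<open>Arg\<close> takes values in (-pi, pi], whereas the periodic shift asks
    for one in [0, 2 pi].\<close>
  define a where "a = (if Arg w < 0 then Arg w + 2 * pi else Arg w)"
  have a: "0 \<le> a" "a \<le> 2 * pi" using Arg_le_pi[of w] mpi_less_Arg[of w] by (auto simp: a_def)
  have "cis a = cis (Arg w)" by (simp add: a_def cis.code flip: cis_mult)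
  then have w: "w = of_real (cmod w) * cis a" by (metis cis_Arg complex_sgn_def mult_zero_left norm_zero of_real_0 rcis_cmod_Arg rcis_def)
  have re: "\<bar>Re (cis t * w)\<bar> powr p = \<bar>cos (t + a)\<bar> powr p * cmod w powr p" for t
  proof -
    have "cis t * w = of_real (cmod w) * cis (t + a)" by (subst w) (simp add: cis_mult mult.left_commute)
    then show ?thesis by (simp add: abs_mult powr_mult mult.commute)
  qed
  have "(\<integral>\<^sup>+t. indicator {0..<2 * pi} t * ennreal (\<bar>Re (cis t * w)\<bar> powr p) \<partial>lborel) =
     (\<integral>\<^sup>+t. indicator {0..<2 * pi} t * ennreal (\<bar>cos (t + a)\<bar> powr p) \<partial>lborel) * ennreal (cmod w powr p)"
    unfolding re by (subst nn_integral_multc[symmetric]) (auto simp: ennreal_mult mult.assoc intro!: nn_integral_cong)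
  also have "(\<integral>\<^sup>+t. indicator {0..<2 * pi} t * ennreal (\<bar>cos (t + a)\<bar> powr p) \<partial>lborel) = cos_moment p"
    unfolding cos_moment_def by (rule nn_integral_periodic_shift) (use a in auto)
  finally show ?thesis .
qed

text \<open>The bound for real functions passes to complex ones with the same constant, by averaging it
  over the rotations \<open>Re (cis t * u)\<close>.\<close>

lemma conj_integral_bound:
  fixes u :: "real \<Rightarrow> complex"
  assumes p: "1 < p" and p': "1 / p + 1 / p' = 1" and e: "0 < e"
    and u: "integrable lborel u" and supp: "\<And>t. R < \<bar>t\<bar> \<Longrightarrow> u t = 0"
    and fin: "pow_int p lborel u < \<infinity>"
  shows "pow_int p lborel (\<lambda>x. conj_integral u (Complex x e)) \<le>
    ennreal (tan (pi / 2 * max (1 / p) (1 / p')) powr p) * pow_int p lborel u"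
proof -
  define T where "T = tan (pi / 2 * max (1 / p) (1 / p'))"
  have [measurable]: "u \<in> borel_measurable borel" using u by auto
  have p0: "0 < p" using p by simp
  define v where "v = (\<lambda>x. conj_integral u (Complex x e))"
  have [measurable]: "v \<in> borel_measurable borel" unfolding v_def conj_integral_def complex.sel by measurable
  have [measurable]: "(\<lambda>z. cis (fst z)) \<in> borel_measurable (borel \<Otimes>\<^sub>M borel)" "(\<lambda>z. cis (snd z)) \<in> borel_measurable (borel \<Otimes>\<^sub>M borel)"
    unfolding cis.code Complex_eq by measurable
  \<comment> \<open>The kernel is real, so the conjugate integral commutes with real parts; with the
    rotation it commutes by linearity.\<close>
  have line: "conj_line e (\<lambda>t. Re (cis \<theta> * u t)) x = Re (cis \<theta> * v x)" for \<theta> x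
  proof -
    have k: "integrable lborel (\<lambda>t. of_real (conj_kernel (x - t) e) * u t)"
      using abs_conj_kernel_le[OF e] by (intro integrable_bounded_mult[OF u, where K = "1 / (pi * e)"]) auto
    have "Re (cis \<theta> * v x) = Re (LINT t|lborel. cis \<theta> * (of_real (conj_kernel (x - t) e) * u t))"
      unfolding v_def conj_integral_def by simp
    also have "\<dots> = (LINT t|lborel. Re (cis \<theta> * (of_real (conj_kernel (x - t) e) * u t)))"
      using k by (intro integral_Re[symmetric] integrable_mult_right)
    also have "\<dots> = (LINT t|lborel. conj_kernel (x - t) e * Re (cis \<theta> * u t))"
      by (intro Bochner_Integration.integral_cong) (auto simp: algebra_simps)
    finally show ?thesis by (simp add: conj_line_def)
  qed
  have real_bound: "real_pow_int p lborel (\<lambda>x. Re (cis \<theta> * v x)) \<le>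
     ennreal (T powr p) * real_pow_int p lborel (\<lambda>x. Re (cis \<theta> * u x))" for \<theta>
    unfolding line[symmetric] T_def
  proof (rule conj_line_bound[OF p p' e])
    show "integrable lborel (\<lambda>t. Re (cis \<theta> * u t))" using u by simp
    show "R < \<bar>t\<bar> \<Longrightarrow> Re (cis \<theta> * u t) = 0" for t using supp by simp
    have "real_pow_int p lborel (\<lambda>x. Re (cis \<theta> * u x)) \<le> pow_int p lborel u"
    proof (intro nn_integral_mono ennreal_leI powr_mono2)
      show "\<bar>Re (cis \<theta> * u x)\<bar> \<le> cmod (u x)" for x
        using abs_Re_le_cmod[of "cis \<theta> * u x"] by (simp add: norm_mult)
    qed (use p in auto)
    then show "real_pow_int p lborel (\<lambda>x. Re (cis \<theta> * u x)) < \<infinity>" using fin by (rule le_less_trans)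
  qed
  have avg: "cos_moment p * pow_int p lborel w =
     (\<integral>\<^sup>+t. indicator {0..<2 * pi} t * real_pow_int p lborel (\<lambda>x. Re (cis t * w x)) \<partial>lborel)"
    if [measurable]: "w \<in> borel_measurable borel" for w
  proof -
  let ?R = "\<lambda>t x. ennreal (\<bar>Re (cis t * w x)\<bar> powr p)"
    have "cos_moment p * pow_int p lborel w = (\<integral>\<^sup>+x. (\<integral>\<^sup>+t. indicator {0..<2 * pi} t * ?R t x \<partial>lborel) \<partial>lborel)"
      unfolding nn_integral_rotation_average[OF p0] by (simp add: nn_integral_cmult)
    also have "\<dots> = (\<integral>\<^sup>+t. (\<integral>\<^sup>+x. indicator {0..<2 * pi} t * ?R t x \<partial>lborel) \<partial>lborel)"
      by (rule lborel_pair.Fubini') (simp add: split_def)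
    also have "\<dots> = (\<integral>\<^sup>+t. indicator {0..<2 * pi} t * real_pow_int p lborel (\<lambda>x. Re (cis t * w x)) \<partial>lborel)"
      by (intro nn_integral_cong nn_integral_cmult) simp
    finally show ?thesis .
  qed
  have "cos_moment p * pow_int p lborel v \<le>
     (\<integral>\<^sup>+t. indicator {0..<2 * pi} t * (ennreal (T powr p) * real_pow_int p lborel (\<lambda>x. Re (cis t * u x))) \<partial>lborel)"
    unfolding avg[OF \<open>v \<in> borel_measurable borel\<close>] by (intro nn_integral_mono mult_left_mono real_bound) simp
  also have "\<dots> = ennreal (T powr p) * (cos_moment p * pow_int p lborel u)"
    unfolding avg[OF \<open>u \<in> borel_measurable borel\<close>]
    by (subst nn_integral_cmult[symmetric]) (auto simp: split_def mult_ac intro!: nn_integral_cong)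
  also have "\<dots> = cos_moment p * (ennreal (T powr p) * pow_int p lborel u)"
    by (simp add: mult_ac)
  finally show ?thesis
    using cos_moment_bounds[OF p0] unfolding v_def T_def
    by (subst (asm) ennreal_mult_le_mult_iff) auto
qed

text \<open>The sum |f| + |g| is the convex combination, with weights a / (a + b) and b / (a + b),
  of |f| (a + b) / a and |g| (a + b) / b. Convexity of s powr p, taken from its tangent at the mean
  \<open>m\<close>, then integrates to (a + b) powr p.\<close>

lemma minkowski_nn_integral:
  fixes f g :: "'a \<Rightarrow> complex"
  assumes p: "1 < p" and a: "0 < a" and b: "0 < b"
    and [measurable]: "f \<in> borel_measurable M" "g \<in> borel_measurable M"
    and f: "pow_int p M f \<le> ennreal (a powr p)"
    and g: "pow_int p M g \<le> ennreal (b powr p)"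
  shows "pow_int p M (\<lambda>x. f x + g x) \<le> ennreal ((a + b) powr p)"
proof -
  define \<alpha> \<beta> where "\<alpha> = a / (a + b) * ((a + b) / a) powr p" and "\<beta> = b / (a + b) * ((a + b) / b) powr p"
  have c: "0 \<le> \<alpha>" "0 \<le> \<beta>" using a b by (simp_all add: \<alpha>_def \<beta>_def)
  have pt: "cmod (f x + g x) powr p \<le> \<alpha> * cmod (f x) powr p + \<beta> * cmod (g x) powr p" for x
  proof -
    define s t where "s = (a + b) / a * cmod (f x)" and "t = (a + b) / b * cmod (g x)"
    define m where "m = a / (a + b) * s + b / (a + b) * t"
    have m: "m = cmod (f x) + cmod (g x)" using a b by (simp add: m_def s_def t_def)
    have st: "0 \<le> s" "0 \<le> t" "0 \<le> m" using a b m by (simp_all add: s_def t_def)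
    have w: "a / (a + b) + b / (a + b) = 1" using a b by (simp add: add_divide_distrib[symmetric])
    have "p * m powr (p - 1) * m = a / (a + b) * (p * m powr (p - 1) * s) + b / (a + b) * (p * m powr (p - 1) * t)"
      unfolding m_def by (simp add: algebra_simps)
    also have "\<dots> \<le> a / (a + b) * (s powr p + (p - 1) * m powr p) + b / (a + b) * (t powr p + (p - 1) * m powr p)"
      using a b st by (intro add_mono mult_left_mono powr_tangent p) auto
    also have "\<dots> = a / (a + b) * s powr p + b / (a + b) * t powr p + (a / (a + b) + b / (a + b)) * ((p - 1) * m powr p)"
      by (simp add: algebra_simps)
    also have "\<dots> = a / (a + b) * s powr p + b / (a + b) * t powr p + (p - 1) * m powr p" unfolding w by simp
    finally have "p * m powr (p - 1) * m \<le> a / (a + b) * s powr p + b / (a + b) * t powr p + (p - 1) * m powr p" .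
    moreover have "p * m powr (p - 1) * m = m powr p + (p - 1) * m powr p"
      using st p by (cases "m = 0") (simp_all add: powr_diff field_simps)
    ultimately have "m powr p \<le> a / (a + b) * s powr p + b / (a + b) * t powr p" by simp
    also have "\<dots> = \<alpha> * cmod (f x) powr p + \<beta> * cmod (g x) powr p"
    proof -
      have "s powr p = ((a + b) / a) powr p * cmod (f x) powr p" "t powr p = ((a + b) / b) powr p * cmod (g x) powr p"
        unfolding s_def t_def using a b by (subst powr_mult; simp)+
      then show ?thesis by (simp add: \<alpha>_def \<beta>_def)
    qed
    finally have "m powr p \<le> \<alpha> * cmod (f x) powr p + \<beta> * cmod (g x) powr p" .
    moreover have "cmod (f x + g x) powr p \<le> m powr p"
      unfolding m using p by (intro powr_mono2 norm_triangle_ineq) auto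
    ultimately show ?thesis by simp
  qed
  have "pow_int p M (\<lambda>x. f x + g x) \<le> ennreal (\<alpha> * a powr p + \<beta> * b powr p)"
    by (rule nn_integral_le_linear_combination[OF c _ _ _ _ _ _ pt f g]) auto
  also have "\<alpha> * a powr p + \<beta> * b powr p = (a / (a + b) + b / (a + b)) * (a + b) powr p"
  proof -
    have "\<alpha> * a powr p = a / (a + b) * (a + b) powr p" "\<beta> * b powr p = b / (a + b) * (a + b) powr p"
      using a b by (simp_all add: \<alpha>_def \<beta>_def powr_divide)
    then show ?thesis by (simp only: distrib_right)
  qed
  also have "a / (a + b) + b / (a + b) = 1" using a b by (simp add: add_divide_distrib[symmetric])
  finally show ?thesis by simp
qed

text \<open>The final constant arises here: 1 from the contractivity of the Poisson part and the
  tangent from the conjugate part.\<close>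

lemma cauchy_integral_line_bound:
  fixes u :: "real \<Rightarrow> complex"
  assumes p: "1 < p" and p': "1 / p + 1 / p' = 1" and e: "0 < e" and N: "0 < N"
    and u: "integrable lborel u" and supp: "\<And>t. R < \<bar>t\<bar> \<Longrightarrow> u t = 0"
    and uN: "pow_int p lborel u \<le> ennreal (N powr p)"
  shows "pow_int p lborel (\<lambda>x. cauchy_integral u (Complex x e)) \<le>
    ennreal (((1 + tan (pi / 2 * max (1 / p) (1 / p'))) * N) powr p)"
proof -
  define T where "T = tan (pi / 2 * max (1 / p) (1 / p'))"
  have T: "0 < T" unfolding T_def by (rule pichorides_constant_pos[OF p p'])
  have [measurable]: "u \<in> borel_measurable borel" using u by auto
  have [measurable]: "(\<lambda>x. conj_integral u (Complex x e)) \<in> borel_measurable borel"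
    "(\<lambda>x. poisson_integral u (Complex x e)) \<in> borel_measurable borel"
    unfolding conj_integral_def poisson_integral_def complex.sel by measurable
  have 1: "pow_int p lborel (\<lambda>x. poisson_integral u (Complex x e)) \<le> ennreal (N powr p)"
    using poisson_integral_contraction[OF p e, of u] uN by (simp add: order_trans)
  have "pow_int p lborel (\<lambda>x. conj_integral u (Complex x e)) \<le> ennreal (T powr p) * pow_int p lborel u"
    unfolding T_def using uN by (intro conj_integral_bound p p' e u supp) (auto intro: le_less_trans)
  also have "\<dots> \<le> ennreal (T powr p) * ennreal (N powr p)" by (intro mult_left_mono uN) simp
  also have "\<dots> = ennreal ((T * N) powr p)" using T N by (simp add: powr_mult ennreal_mult)
  finally have 2: "pow_int p lborel (\<lambda>x. \<i> * conj_integral u (Complex x e)) \<le> ennreal ((T * N) powr p)"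
    by (simp add: norm_mult)
  have "pow_int p lborel (\<lambda>x. poisson_integral u (Complex x e) + \<i> * conj_integral u (Complex x e)) \<le>
     ennreal ((N + T * N) powr p)"
    using T N by (intro minkowski_nn_integral p 1 2) auto
  then show ?thesis
    using u e by (subst cauchy_integral_eq) (auto simp: T_def distrib_right)
qed

subsection \<open>The semigroup property\<close>

text \<open>An antiderivative of \<open>s \<mapsto> 1 / (s + \<i> * a)\<close> on the whole line, for \<open>a\<close> of either sign.\<close>

definition shifted_log :: "real \<Rightarrow> real \<Rightarrow> complex" where
  "shifted_log a s = Complex (ln (s\<^sup>2 + a\<^sup>2) / 2) (- arctan (s / a))"

lemma shifted_log_derivative:
  assumes a: "a \<noteq> 0"
  shows "((\<lambda>s. shifted_log a (s - b)) has_vector_derivative 1 / (of_real (s - b) + \<i> * of_real a)) (at s)"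
proof -
  define q where "q = (s - b)\<^sup>2 + a\<^sup>2"
  have q: "0 < q" using a by (simp add: q_def add_nonneg_pos)
  have c: "1 / (of_real (s - b) + \<i> * of_real a) = Complex ((s - b) / q) (- a / q)"
    using q by (simp add: complex_eq_iff Re_divide Im_divide q_def)
  have 1: "((\<lambda>s. ln ((s - b)\<^sup>2 + a\<^sup>2) / 2) has_real_derivative (s - b) / q) (at s)"
  proof -
    have "((\<lambda>s. (s - b)\<^sup>2 + a\<^sup>2) has_real_derivative 2 * (s - b)) (at s)"
      by (auto intro!: derivative_eq_intros)
    from DERIV_cdivide[OF DERIV_chain2[OF DERIV_ln_divide[OF q[unfolded q_def]] this], of 2]
    have "((\<lambda>s. ln ((s - b)\<^sup>2 + a\<^sup>2) / 2) has_real_derivative 1 / q * (2 * (s - b)) / 2) (at s)"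
      unfolding q_def .
    moreover have "1 / q * (2 * (s - b)) / 2 = (s - b) / q" using q by (simp add: field_simps)
    ultimately show ?thesis by (simp only:)
  qed
  have "((\<lambda>s. - arctan ((s - b) / a)) has_real_derivative - (inverse (1 + ((s - b) / a)\<^sup>2) * (1 / a))) (at s)"
    using a by (auto intro!: derivative_eq_intros)
  moreover have "- (inverse (1 + ((s - b) / a)\<^sup>2) * (1 / a)) = - a / q"
  proof -
    have "1 + ((s - b) / a)\<^sup>2 = q / a\<^sup>2" using a by (simp add: q_def power_divide field_simps)
    then show ?thesis using a q by (simp add: power2_eq_square)
  qed
  ultimately show ?thesis using 1 unfolding c has_vector_derivative_complex_iff shifted_log_def by simp
qed

lemma integrable_poisson_kernel:
  assumes "0 < y" shows "integrable lborel (\<lambda>s. poisson_kernel (x - s) y)"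
proof (rule integrableI_nonneg)
  show "(\<integral>\<^sup>+s. ennreal (poisson_kernel (x - s) y) \<partial>lborel) < \<infinity>"
    by (simp add: nn_integral_poisson_kernel[OF assms])
qed (use assms poisson_kernel_nonneg in auto)

text \<open>
  The partial fraction decomposition degenerates for \<open>X = 0\<close>, \<open>y = e\<close>; as \<open>X\<close> will be the integration
  variable up to translation, the point \<open>X = 0\<close> is negligible.
\<close>

lemma poisson_cauchy_kernel:
  assumes y: "0 < y" and e: "0 < e" and X: "X \<noteq> 0"
  shows "(LINT s|lborel. of_real (poisson_kernel (X - s) y) * cauchy_kernel s e) = cauchy_kernel X (y + e)"
proof -
  define K where "K = (\<lambda>s. of_real (poisson_kernel (X - s) y) * cauchy_kernel s e)"
  \<comment> \<open>In the partial fraction decomposition these are the reciprocals of the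
    differences of the linear factors; the resulting pairs of simple fractions are integrated by
    \<open>shifted_log\<close>.\<close>
  define c1 c2 where "c1 = 1 / Complex X (y + e)" and "c2 = 1 / Complex X (e - y)"
  let ?c = "complex_of_real (1 / (2 * pi\<^sup>2))"
  define H where "H = (\<lambda>s. ?c * (c1 * (shifted_log (- y) (s - X) - shifted_log e (s - 0))
      - c2 * (shifted_log y (s - X) - shifted_log e (s - 0))))"
  have K_int: "integrable lborel K"
    unfolding K_def by (subst mult.commute, rule integrable_bounded_mult[where K = "1 / (pi * e)"])
      (use integrable_poisson_kernel[OF y] norm_cauchy_kernel_le[OF e] in auto)
  have der: "(H has_vector_derivative K s) (at s)" for s
  proof -
    define \<alpha> \<beta> \<gamma> where "\<alpha> = complex_of_real (s - X) + \<i> * of_real (- y)" and "\<beta> = complex_of_real (s - X) + \<i> * of_real y"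
      and "\<gamma> = complex_of_real (s - 0) + \<i> * of_real e"
    have nz: "\<alpha> \<noteq> 0" "\<beta> \<noteq> 0" "\<gamma> \<noteq> 0" "Complex X (y + e) \<noteq> 0" "Complex X (e - y) \<noteq> 0"
      using y e X by (auto simp: \<alpha>_def \<beta>_def \<gamma>_def complex_eq_iff)
    have "(H has_vector_derivative ?c * (c1 * (1 / \<alpha> - 1 / \<gamma>) - c2 * (1 / \<beta> - 1 / \<gamma>))) (at s)"
      unfolding H_def \<alpha>_def \<beta>_def \<gamma>_def using y e
      by (intro has_vector_derivative_mult_right has_vector_derivative_diff shifted_log_derivative) auto
    moreover have "?c * (c1 * (1 / \<alpha> - 1 / \<gamma>) - c2 * (1 / \<beta> - 1 / \<gamma>)) = K s"
    proof -
      have "c1 * (1 / \<alpha> - 1 / \<gamma>) = 1 / (\<alpha> * \<gamma>)"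
      proof -
        have "\<gamma> - \<alpha> = Complex X (y + e)" by (simp add: \<alpha>_def \<gamma>_def complex_eq_iff)
        then show ?thesis using nz by (simp add: c1_def diff_frac_eq)
      qed
      moreover have "c2 * (1 / \<beta> - 1 / \<gamma>) = 1 / (\<beta> * \<gamma>)"
      proof -
        have "\<gamma> - \<beta> = Complex X (e - y)" by (simp add: \<beta>_def \<gamma>_def complex_eq_iff)
        then show ?thesis using nz by (simp add: c2_def diff_frac_eq)
      qed
      moreover have "1 / (\<alpha> * \<gamma>) - 1 / (\<beta> * \<gamma>) = 2 * \<i> * of_real y / (\<alpha> * \<beta> * \<gamma>)"
      proof -
        have "\<beta> - \<alpha> = 2 * \<i> * of_real y" by (simp add: \<alpha>_def \<beta>_def complex_eq_iff)
        moreover have "1 / (\<alpha> * \<gamma>) - 1 / (\<beta> * \<gamma>) = (\<beta> - \<alpha>) / (\<alpha> * \<beta> * \<gamma>)"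
          using nz by (simp add: field_simps)
        ultimately show ?thesis by simp
      qed
      moreover have "\<alpha> * \<beta> = of_real ((X - s)\<^sup>2 + y\<^sup>2)"
        by (simp add: \<alpha>_def \<beta>_def complex_eq_iff power2_eq_square algebra_simps)
      moreover have "Complex s e = \<gamma>" by (simp add: \<gamma>_def complex_eq_iff)
      ultimately show ?thesis
        unfolding K_def poisson_kernel_def cauchy_kernel_def by (simp add: power2_eq_square mult_ac)
    qed
    ultimately show ?thesis by simp
  qed
  have cK: "isCont K s" for s
  proof -
    have "(X - t)\<^sup>2 + y\<^sup>2 \<noteq> 0" "Complex t e \<noteq> 0" for t using y e by (auto simp: complex_eq_iff)
    then have "continuous_on UNIV K"
      unfolding K_def poisson_kernel_def cauchy_kernel_def Complex_eq
      by (intro continuous_intros) (auto simp: Complex_eq)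
    then show ?thesis by (simp add: continuous_on_eq_continuous_at)
  qed
  \<comment> \<open>The logarithms cancel at both ends and only arctangents contribute. The two
    poles belonging to \<open>c1\<close> lie on opposite sides of the real line, so their
    arctangents add up; the two belonging to \<open>c2\<close> lie on the same side and
    cancel.\<close>
  let ?l = "\<lambda>s. (ln ((s - X)\<^sup>2 + y\<^sup>2) - ln (s\<^sup>2 + e\<^sup>2)) / 2"
  have ln0: "(?l \<longlongrightarrow> 0) at_top" "(?l \<longlongrightarrow> 0) at_bot"
    using y e by real_asymp+
  have at: "((\<lambda>s. arctan ((s - X) / y)) \<longlongrightarrow> pi / 2) at_top" "((\<lambda>s. arctan (s / e)) \<longlongrightarrow> pi / 2) at_top"
    "((\<lambda>s. arctan ((s - X) / y)) \<longlongrightarrow> - pi / 2) at_bot" "((\<lambda>s. arctan (s / e)) \<longlongrightarrow> - pi / 2) at_bot"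
    using y e by real_asymp+
  have eq1: "shifted_log (- y) (s - X) - shifted_log e (s - 0) =
      Complex (?l s) (arctan ((s - X) / y) + arctan (s / e))" for s
  proof -
    have "arctan ((s - X) / - y) = - arctan ((s - X) / y)"
      unfolding minus_divide_right[symmetric] arctan_minus ..
    then show ?thesis by (simp only: shifted_log_def) (simp add: complex_eq_iff diff_divide_distrib)
  qed
  have eq2: "shifted_log y (s - X) - shifted_log e (s - 0) =
      Complex (?l s) (- arctan ((s - X) / y) + arctan (s / e))" for s
    by (simp add: shifted_log_def complex_eq_iff diff_divide_distrib)
  have top: "(H \<longlongrightarrow> ?c * (c1 * Complex 0 (pi / 2 + pi / 2) - c2 * Complex 0 (- (pi / 2) + pi / 2))) at_top"
    unfolding H_def eq1 eq2 by (intro tendsto_intros tendsto_Complex ln0 at)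
  have bot: "(H \<longlongrightarrow> ?c * (c1 * Complex 0 (- pi / 2 + - pi / 2) - c2 * Complex 0 (- (- pi / 2) + - pi / 2))) at_bot"
    unfolding H_def eq1 eq2 by (intro tendsto_intros tendsto_Complex ln0 at)
  have "(LBINT s=-\<infinity>..\<infinity>. K s) = ?c * (c1 * Complex 0 (pi / 2 + pi / 2) - c2 * Complex 0 (- (pi / 2) + pi / 2))
      - ?c * (c1 * Complex 0 (- pi / 2 + - pi / 2) - c2 * Complex 0 (- (- pi / 2) + - pi / 2))"
    by (rule interval_integral_FTC_integrable)
      (use der cK K_int top bot in \<open>auto simp: ereal_tendsto_simps set_integrable_def\<close>)
  moreover have "(LBINT s=-\<infinity>..\<infinity>. K s) = (LINT s|lborel. K s)"
    by (simp add: interval_lebesgue_integral_def set_lebesgue_integral_def)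
  moreover have "Complex 0 (pi / 2 + pi / 2) = \<i> * of_real pi" "Complex 0 (- pi / 2 + - pi / 2) = - \<i> * of_real pi"
    "Complex 0 (- (pi / 2) + pi / 2) = 0" "Complex 0 (- (- pi / 2) + - pi / 2) = 0"
    by (simp_all add: complex_eq_iff)
  ultimately have "(LINT s|lborel. K s) = ?c * (c1 * (\<i> * of_real pi)) - ?c * (c1 * (- \<i> * of_real pi))"
    by simp
  also have "\<dots> = cauchy_kernel X (y + e)"
    by (simp add: c1_def cauchy_kernel_def power2_eq_square field_simps)
  finally show ?thesis unfolding K_def .
qed

text \<open>Fubini and a translation by \<open>t\<close> reduce it to the kernel identity; the
  Cauchy kernel is bounded at height \<open>e\<close>, while the Poisson kernel and \<open>u\<close>
  are integrable.\<close>

lemma poisson_integral_cauchy_integral: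
  assumes u: "integrable lborel u" and z: "0 < Im z" and e: "0 < e"
  shows "poisson_integral (\<lambda>s. cauchy_integral u (Complex s e)) z = cauchy_integral u (Complex (Re z) (Im z + e))"
proof -
  define x y where "x = Re z" and "y = Im z"
  have y: "0 < y" using z by (simp add: y_def)
  have [measurable]: "u \<in> borel_measurable borel" using u by auto
  define h where "h = (\<lambda>s t. cauchy_kernel (s - t) e * (of_real (poisson_kernel (x - s) y) * u t))"
  have "integrable (lborel \<Otimes>\<^sub>M lborel) (\<lambda>(s, t). h s t)"
    unfolding h_def using norm_cauchy_kernel_le[OF e] integrable_poisson_kernel[OF y]
    by (intro integrable_kernel_product[OF _ _ _ u]) auto
  from lborel_pair.Fubini_integral[OF this]
  have "(LINT s|lborel. LINT t|lborel. h s t) = (LINT t|lborel. LINT s|lborel. h s t)" by simp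
  also have "\<dots> = (LINT t|lborel. cauchy_kernel (x - t) (y + e) * u t)"
  proof (rule integral_cong_AE)
    show "AE t in lborel. (LINT s|lborel. h s t) = cauchy_kernel (x - t) (y + e) * u t"
    proof (rule AE_mp[OF AE_lborel_singleton[of x]], rule AE_I2, rule impI)
      fix t assume "t \<noteq> x"
      then have tx: "x - t \<noteq> 0" by simp
      have "(LINT s|lborel. h s t) = (LINT s|lborel. (of_real (poisson_kernel (x - s) y) * cauchy_kernel (s - t) e) * u t)"
        by (simp add: h_def mult_ac)
      also have "\<dots> = (LINT s|lborel. of_real (poisson_kernel (x - s) y) * cauchy_kernel (s - t) e) * u t" by simp
      also have "(LINT s|lborel. of_real (poisson_kernel (x - s) y) * cauchy_kernel (s - t) e) =
         (LINT s|lborel. of_real (poisson_kernel (x - (t + 1 * s)) y) * cauchy_kernel ((t + 1 * s) - t) e)"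
        using lborel_integral_real_affine[of 1 "\<lambda>s. of_real (poisson_kernel (x - s) y) * cauchy_kernel (s - t) e" t] by simp
      also have "\<dots> = (LINT s|lborel. of_real (poisson_kernel ((x - t) - s) y) * cauchy_kernel s e)"
        by (simp add: diff_diff_eq)
      also have "\<dots> = cauchy_kernel (x - t) (y + e)" by (rule poisson_cauchy_kernel[OF y e tx])
      finally show "(LINT s|lborel. h s t) = cauchy_kernel (x - t) (y + e) * u t" .
    qed
  qed (simp_all add: h_def)
  finally have "(LINT s|lborel. LINT t|lborel. h s t) = (LINT t|lborel. cauchy_kernel (x - t) (y + e) * u t)" .
  moreover have "of_real (poisson_kernel (x - s) y) * cauchy_integral u (Complex s e) = (LINT t|lborel. h s t)" for s
    unfolding cauchy_integral_def h_def
    by (subst integral_mult_right_zero[symmetric]) (simp add: mult.left_commute)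
  ultimately show ?thesis
    unfolding poisson_integral_def cauchy_integral_def[of u "Complex (Re z) (Im z + e)"]
    by (simp flip: x_def y_def)
qed

subsection \<open>Finiteness of the Poisson operator norm\<close>

definition poisson_ext :: "(real \<Rightarrow> ennreal) \<Rightarrow> complex \<Rightarrow> ennreal" where
  "poisson_ext f z = (\<integral>\<^sup>+t. ennreal (poisson_kernel (Re z - t) (Im z)) * f t \<partial>lborel)"

lemma poisson_ext_measurable [measurable]:
  assumes [measurable]: "f \<in> borel_measurable borel"
  shows "poisson_ext f \<in> borel_measurable borel"
proof -
  have "(\<lambda>z. \<integral>\<^sup>+t. ennreal (poisson_kernel (Re z - t) (Im z)) * f t \<partial>lborel) \<in> borel_measurable borel" by measurable
  then show ?thesis unfolding poisson_ext_def[abs_def] .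
qed

text \<open>The superlevel set of the centered maximal function: ball averages are compared with
  \<open>l\<close> after multiplication by the length 2 r, which avoids division in
  \<open>ennreal\<close>.\<close>

definition large_average_set :: "(real \<Rightarrow> ennreal) \<Rightarrow> real \<Rightarrow> real set" where
  "large_average_set f l = {x. \<exists>r>0. ennreal (2 * r * l) < ball_integral f x r}"

text \<open>At whatever height, the Poisson integral is an average of ball averages about Re z: if
  none of these exceeds \<open>l\<close>, neither does the Poisson integral.\<close>

lemma Re_mem_large_average_set:
  assumes [measurable]: "f \<in> borel_measurable borel" and z: "0 < Im z" and l: "0 \<le> l" "ennreal l < poisson_ext f z"
  shows "Re z \<in> large_average_set f l"
proof (rule ccontr)
  assume "Re z \<notin> large_average_set f l"
  then have avg: "ball_integral f (Re z) r \<le> ennreal (2 * r * l)" if "0 < r" for r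
    using that unfolding large_average_set_def mem_Collect_eq by (meson not_le)
  have "poisson_ext f z = (\<integral>\<^sup>+r. ennreal (poisson_layer r (Im z)) * indicator {0..} r *
      ball_integral f (Re z) r \<partial>lborel)"
    unfolding poisson_ext_def by (rule poisson_layer_cake[OF z]) simp
  also have "\<dots> \<le> (\<integral>\<^sup>+r. ennreal (2 * r * poisson_layer r (Im z)) * indicator {0..} r * ennreal l \<partial>lborel)"
  proof (rule nn_integral_mono)
    fix r :: real
    show "ennreal (poisson_layer r (Im z)) * indicator {0..} r * ball_integral f (Re z) r
      \<le> ennreal (2 * r * poisson_layer r (Im z)) * indicator {0..} r * ennreal l"
    proof (cases "0 < r")
      case True
      have "ennreal (poisson_layer r (Im z)) * ball_integral f (Re z) r
        \<le> ennreal (poisson_layer r (Im z)) * ennreal (2 * r * l)"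
        by (intro mult_left_mono avg True) simp
      also have "\<dots> = ennreal (2 * r * poisson_layer r (Im z)) * ennreal l"
        using True z l poisson_layer_nonneg[of r "Im z"] by (simp add: ennreal_mult[symmetric] mult_ac)
      finally show ?thesis using True by simp
    next
      case False
      then show ?thesis by (cases "r = 0") (auto simp: poisson_layer_def)
    qed
  qed
  also have "\<dots> = ennreal l"
    by (subst nn_integral_multc, measurable) (simp only: nn_integral_poisson_layer[OF z] mult_1)
  finally have "poisson_ext f z \<le> ennreal l" .
  then show False using l(2) leD by blast
qed

text \<open>The Hardy--Littlewood weak type inequality, with the constant \<open>5\<close> of the Vitali covering lemma.\<close>

lemma large_average_set_cover:
  assumes [measurable]: "f \<in> borel_measurable borel" and l: "0 < l"
    and N: "(\<integral>\<^sup>+t. f t \<partial>lborel) = ennreal N" "0 \<le> N"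
  obtains V where "V \<in> sets borel" "large_average_set f l \<subseteq> V" "emeasure lborel V \<le> ennreal (5 * N / l)"
proof -
  define W where "W = large_average_set f l"
  define Q where "Q = (\<lambda>x r. 0 < r \<and> ennreal (2 * r * l) < ball_integral f x r)"
  have "\<forall>x\<in>W. \<exists>r. Q x r" unfolding W_def large_average_set_def Q_def by blast
  then obtain r where "\<forall>x\<in>W. Q x (r x)" using bchoice by metis
  then have r: "0 < r x" "ennreal (2 * r x * l) < ball_integral f x (r x)" if "x \<in> W" for x
    using that unfolding Q_def by blast+
  \<comment> \<open>The Vitali lemma asks for bounded radii; the total mass of \<open>f\<close>
    bounds them.\<close>
  have rB: "r x \<le> N / (2 * l)" if "x \<in> W" for x
  proof -
    have "ennreal (2 * r x * l) \<le> ball_integral f x (r x)" using r(2)[OF that] by simp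
    also have "\<dots> \<le> (\<integral>\<^sup>+t. f t \<partial>lborel)" by (intro nn_integral_mono) (auto simp: indicator_def)
    finally have "2 * r x * l \<le> N" using N by (simp add: ennreal_le_iff)
    then show ?thesis using l by (simp add: field_simps)
  qed
  have W_cover: "W \<subseteq> (\<Union>i\<in>W. cball i (r i))"
  proof
    fix x assume "x \<in> W"
    then show "x \<in> (\<Union>i\<in>W. cball i (r i))" using r(1)[of x] by (intro UN_I[of x]) auto
  qed
  have r_bounds: "0 < r i \<and> r i \<le> N / (2 * l)" if "i \<in> W" for i using r(1) rB that by blast
  obtain C where C: "countable C" "C \<subseteq> W" "pairwise (\<lambda>i j. disjnt (cball i (r i)) (cball j (r j))) C"
    "W \<subseteq> (\<Union>i\<in>C. cball i (5 * r i))"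
    by (rule Vitali_covering_lemma_cballs[OF W_cover r_bounds]) (assumption, rule that)
  \<comment> \<open>The countable subfamily is reindexed by natural numbers, with empty sets outside
    \<open>D\<close>, so that finite and infinite families are treated alike.\<close>
  define h where "h = inv_into C (to_nat_on C)"
  define D where "D = to_nat_on C ` C"
  have hD: "h n \<in> C" if "n \<in> D" for n using that unfolding D_def h_def by (auto intro: inv_into_into)
  have hinj: "m = n" if "m \<in> D" "n \<in> D" "h m = h n" for m n
    using that unfolding D_def h_def by (metis f_inv_into_f)
  have hC: "\<exists>n\<in>D. h n = x" if "x \<in> C" for x
    using that inj_on_to_nat_on[OF C(1)] unfolding D_def h_def by (auto intro!: bexI[of _ "to_nat_on C x"])
  define X where "X = (\<lambda>n. if n \<in> D then cball (h n) (5 * r (h n)) else {})"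
  define Y where "Y = (\<lambda>n. if n \<in> D then cball (h n) (r (h n)) else {})"
  define V where "V = (\<Union>n. X n)"
  have X_sets: "range X \<subseteq> sets lborel" by (auto simp: X_def)
  have Y_sets: "range Y \<subseteq> sets (density lborel f)" by (auto simp: Y_def)
  have dY: "disjoint_family Y"
    unfolding disjoint_family_on_def
  proof (intro ballI impI)
    fix m n :: nat assume mn: "m \<noteq> n"
    show "Y m \<inter> Y n = {}"
    proof (cases "m \<in> D \<and> n \<in> D")
      case True
      then have "h m \<noteq> h n" using hinj mn by auto
      then show ?thesis using C(3) hD True by (auto simp: Y_def pairwise_def disjnt_def)
    qed (auto simp: Y_def)
  qed
  \<comment> \<open>Each dilated ball is charged to the mass of \<open>f\<close> in the undilated
    one; as the latter are disjoint, the charges add up to at most the total mass.\<close>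
  have XY: "emeasure lborel (X n) \<le> ennreal (5 / l) * emeasure (density lborel f) (Y n)" for n
  proof (cases "n \<in> D")
    case True
    define x where "x = h n"
    have x: "x \<in> W" using hD[OF True] C(2) by (auto simp: x_def)
    have "emeasure lborel (X n) = ennreal (2 * (5 * r x))"
      using nn_integral_indicator_cball[of "5 * r x" x] r(1)[OF x] True by (simp add: X_def x_def)
    also have "\<dots> = ennreal (5 / l) * ennreal (2 * r x * l)"
      using l r(1)[OF x] by (simp add: ennreal_mult[symmetric])
    also have "\<dots> \<le> ennreal (5 / l) * ball_integral f x (r x)"
      using r(2)[OF x] by (intro mult_left_mono) auto
    also have "ball_integral f x (r x) = emeasure (density lborel f) (Y n)"
      using True by (simp add: Y_def x_def emeasure_density mult.commute)
    finally show ?thesis .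
  qed (simp add: X_def)
  have "emeasure lborel V \<le> (\<Sum>n. emeasure lborel (X n))"
    unfolding V_def by (rule emeasure_subadditive_countably[OF X_sets])
  also have "\<dots> \<le> (\<Sum>n. ennreal (5 / l) * emeasure (density lborel f) (Y n))" by (intro suminf_le XY) auto
  also have "\<dots> = ennreal (5 / l) * (\<Sum>n. emeasure (density lborel f) (Y n))" by simp
  also have "(\<Sum>n. emeasure (density lborel f) (Y n)) = emeasure (density lborel f) (\<Union>n. Y n)"
    by (rule suminf_emeasure[OF Y_sets dY])
  also have "\<dots> \<le> emeasure (density lborel f) (space lborel)"
    by (rule emeasure_mono) auto
  also have "\<dots> = ennreal N" by (simp add: emeasure_density N)
  finally have "emeasure lborel V \<le> ennreal (5 / l) * ennreal N" by (simp add: mult_left_mono)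
  then have "emeasure lborel V \<le> ennreal (5 * N / l)" using l N by (simp add: ennreal_mult[symmetric])
  moreover have "W \<subseteq> V"
  proof
    fix x assume "x \<in> W"
    then obtain i where "i \<in> C" "x \<in> cball i (5 * r i)" using C(4) by auto
    moreover from this obtain n where "n \<in> D" "h n = i" using hC by auto
    ultimately show "x \<in> V" by (auto simp: V_def X_def)
  qed
  moreover have "V \<in> sets borel" using X_sets by (auto simp: V_def)
  ultimately show ?thesis using that by (auto simp: W_def)
qed

lemma poisson_ext_le:
  assumes [measurable]: "f \<in> borel_measurable borel" and z: "0 < Im z"
  shows "poisson_ext f z \<le> ennreal (1 / (pi * Im z)) * (\<integral>\<^sup>+t. f t \<partial>lborel)"
proof -
  have "poisson_ext f z \<le> (\<integral>\<^sup>+t. ennreal (1 / (pi * Im z)) * f t \<partial>lborel)"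
    unfolding poisson_ext_def using poisson_kernel_le[OF z] by (intro nn_integral_mono mult_right_mono ennreal_leI) auto
  then show ?thesis by (simp add: nn_integral_cmult)
qed

lemma well_projected_measurable:
  assumes \<mu>: "\<mu> \<in> well_projected D kx ky" and f: "f \<in> borel_measurable borel"
  shows "f \<in> borel_measurable \<mu>"
proof -
  have "sets \<mu> = sets (restrict_space borel D)" using \<mu> by (simp add: well_projected_def)
  then have "borel_measurable \<mu> = borel_measurable (restrict_space borel D)" by (intro measurable_cong_sets) auto
  then show ?thesis using measurable_restrict_space1[OF f] by auto
qed

lemma space_well_projected:
  assumes "\<mu> \<in> well_projected D kx ky" shows "space \<mu> = D"
proof -
  have "sets \<mu> = sets (restrict_space borel D)" using assms by (simp add: well_projected_def)
  then have "space \<mu> = space (restrict_space borel D)" by (rule sets_eq_imp_space_eq)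
  then show ?thesis by (simp add: space_restrict_space)
qed

text \<open>
  Measurability of the projections is not an issue here: \<open>emeasure\<close> is \<open>0\<close> on nonmeasurable sets, so
  a bound for a Borel superset suffices in any case.
\<close>

lemma well_projected_emeasure_le:
  assumes \<mu>: "\<mu> \<in> well_projected D kx ky" and A: "A \<in> sets \<mu>"
    and V: "Re ` A \<subseteq> V" "V \<in> sets borel" "emeasure lborel V \<le> ennreal a"
    and U: "Im ` A \<subseteq> U" "U \<in> sets borel" "emeasure lborel U \<le> ennreal b"
  shows "emeasure \<mu> A \<le> ennreal kx * ennreal a + ennreal ky * ennreal b"
proof -
  have "emeasure lebesgue (Re ` A) \<le> emeasure lebesgue V" using V by (intro emeasure_mono) auto
  also have "\<dots> \<le> ennreal a" using V by simp
  finally have 1: "emeasure lebesgue (Re ` A) \<le> ennreal a" .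
  have "emeasure lebesgue (Im ` A) \<le> emeasure lebesgue U" using U by (intro emeasure_mono) auto
  also have "\<dots> \<le> ennreal b" using U by simp
  finally have 2: "emeasure lebesgue (Im ` A) \<le> ennreal b" .
  have le: "ennreal kx * emeasure lebesgue (Re ` A) + ennreal ky * emeasure lebesgue (Im ` A)
     \<le> ennreal kx * ennreal a + ennreal ky * ennreal b"
    by (intro add_mono mult_left_mono 1 2) auto
  also have "\<dots> < \<infinity>" by (simp add: ennreal_mult_less_top)
  finally have "emeasure \<mu> A \<le> ennreal kx * emeasure lebesgue (Re ` A) + ennreal ky * emeasure lebesgue (Im ` A)"
    using \<mu> A by (auto simp: well_projected_def)
  then show ?thesis using le by (rule order_trans)
qed

text \<open>The 5 comes from covering the projection on the x-axis. On the y-axis the kernel bound 1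
  / (pi y) makes the Poisson integral at most \<open>l\<close> as soon as y >= N / (pi l), whence
  the term ky / pi.\<close>

lemma poisson_weak_type:
  assumes \<mu>: "\<mu> \<in> well_projected upper_half_plane kx ky" and k: "0 \<le> kx" "0 \<le> ky"
    and f[measurable]: "f \<in> borel_measurable borel" and l: "0 < l"
    and N: "(\<integral>\<^sup>+t. f t \<partial>lborel) = ennreal N" "0 \<le> N"
  shows "emeasure \<mu> {z \<in> space \<mu>. ennreal l < poisson_ext f z} \<le> ennreal ((5 * kx + ky / pi) * N / l)"
proof -
  define A where "A = {z \<in> space \<mu>. ennreal l < poisson_ext f z}"
  have [measurable]: "poisson_ext f \<in> borel_measurable \<mu>" by (rule well_projected_measurable[OF \<mu>]) simp
  have As: "A \<in> sets \<mu>" unfolding A_def by measurable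
  have A_Im: "0 < Im z" if "z \<in> A" for z
    using that space_well_projected[OF \<mu>] by (auto simp: A_def upper_half_plane_def)
  obtain V where V: "V \<in> sets borel" "large_average_set f l \<subseteq> V" "emeasure lborel V \<le> ennreal (5 * N / l)"
    using large_average_set_cover[OF f l N] by blast
  have "Re ` A \<subseteq> large_average_set f l"
    using A_Im l by (auto simp: A_def intro!: Re_mem_large_average_set)
  then have RA: "Re ` A \<subseteq> V" using V by auto
  have IA: "Im ` A \<subseteq> {0..N / (pi * l)}"
  proof
    fix y assume "y \<in> Im ` A"
    then obtain z where z: "z \<in> A" "y = Im z" by auto
    have y: "0 < Im z" by (rule A_Im[OF z(1)])
    have "ennreal l < poisson_ext f z" using z by (simp add: A_def)
    also have "\<dots> \<le> ennreal (1 / (pi * Im z)) * ennreal N" using poisson_ext_le[OF f y] N by simp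
    also have "\<dots> = ennreal (N / (pi * Im z))" using y N by (simp add: ennreal_mult[symmetric])
    finally have "l < N / (pi * Im z)" using l by (simp add: ennreal_less_iff)
    then show "y \<in> {0..N / (pi * l)}" using y l z by (simp add: field_simps)
  qed
  have "emeasure \<mu> A \<le> ennreal kx * ennreal (5 * N / l) + ennreal ky * ennreal (N / (pi * l))"
    using l N by (intro well_projected_emeasure_le[OF \<mu> As RA V(1,3) IA]) auto
  also have "\<dots> = ennreal (kx * (5 * N / l) + ky * (N / (pi * l)))"
    using k l N by (simp add: ennreal_mult[symmetric] ennreal_plus[symmetric] del: ennreal_plus)
  also have "kx * (5 * N / l) + ky * (N / (pi * l)) = (5 * kx + ky / pi) * N / l"
    using l by (simp add: field_simps)
  finally show ?thesis by (simp add: A_def)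
qed

section \<open>Interpolation between the weak type bound and the trivial bound\<close>

lemma nn_integral_powr_Icc:
  assumes q: "0 < q" and S: "0 \<le> S"
  shows "(\<integral>\<^sup>+l. ennreal (l powr (q - 1)) * indicator {0..S} l \<partial>lborel) = ennreal (S powr q / q)"
proof (rule nn_integral_has_integral_lebesgue')
  have "((\<lambda>l. l powr (q - 1)) has_integral (S powr q / q - 0 powr q / q)) {0..S}"
  proof (rule fundamental_theorem_of_calculus_interior[OF S])
    show "continuous_on {0..S} (\<lambda>l. l powr q / q)"
      using q by (intro continuous_intros continuous_on_powr') auto
    fix x assume "x \<in> {0<..<S}"
    then have "((\<lambda>l. l powr q / q) has_real_derivative x powr (q - 1)) (at x)"
      using q by (auto intro!: derivative_eq_intros simp: powr_diff)
    then show "((\<lambda>l. l powr q / q) has_vector_derivative x powr (q - 1)) (at x)"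
      by (simp add: has_real_derivative_iff_has_vector_derivative)
  qed
  then show "((\<lambda>l. l powr (q - 1)) has_integral S powr q / q) {0..S}" by simp
qed simp

text \<open>Boxes have projections of finite length, so their measure is finite. The exchange of
  integrals over the measure in the interpolation argument depends on this.\<close>

lemma sigma_finite_well_projected:
  assumes \<mu>: "\<mu> \<in> well_projected upper_half_plane kx ky"
  shows "sigma_finite_measure \<mu>"
proof
  define A where "A = (\<lambda>n. {z \<in> space \<mu>. \<bar>Re z\<bar> \<le> real n \<and> Im z \<le> real n})"
  have [measurable]: "Re \<in> borel_measurable \<mu>" "Im \<in> borel_measurable \<mu>"
    by (rule well_projected_measurable[OF \<mu>], simp)+
  have As: "A n \<in> sets \<mu>" for n unfolding A_def by measurable
  have fin: "emeasure \<mu> (A n) \<noteq> \<infinity>" for n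
  proof -
    have "emeasure \<mu> (A n) \<le> ennreal kx * ennreal (2 * real n) + ennreal ky * ennreal (real n)"
    proof (rule well_projected_emeasure_le[OF \<mu> As])
      show "Re ` A n \<subseteq> {- real n..real n}" by (auto simp: A_def)
      show "Im ` A n \<subseteq> {0..real n}" using space_well_projected[OF \<mu>] by (auto simp: A_def upper_half_plane_def)
    qed auto
    also have "\<dots> < \<infinity>" by (simp add: ennreal_mult_less_top)
    finally show ?thesis by simp
  qed
  have "space \<mu> \<subseteq> (\<Union>n. A n)"
  proof
    fix z assume z: "z \<in> space \<mu>"
    obtain n where "max \<bar>Re z\<bar> (Im z) \<le> real n" using real_arch_simple by blast
    then show "z \<in> (\<Union>n. A n)" using z by (auto simp: A_def)
  qed
  then show "\<exists>B. countable B \<and> B \<subseteq> sets \<mu> \<and> \<Union> B = space \<mu> \<and> (\<forall>a\<in>B. emeasure \<mu> a \<noteq> \<infinity>)"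
    using As fin by (intro exI[of _ "range A"]) (auto simp: A_def)
qed

text \<open>Marcinkiewicz interpolation between the weak type bound at \<open>1\<close> and the trivial bound at
  infinity: at height \<open>l\<close> only the part of \<open>u\<close> above \<open>l / 4\<close> contributes.\<close>

lemma poisson_strong_type:
  assumes \<mu>: "\<mu> \<in> well_projected upper_half_plane kx ky" and k: "0 \<le> kx" "0 \<le> ky" and p: "1 < p"
    and u[measurable]: "u \<in> borel_measurable borel"
    and fin: "pow_int p lborel u < \<infinity>"
  shows "pow_int p \<mu> (poisson_integral u) \<le>
    ennreal (2 * (5 * kx + ky / pi) * p * (4 powr (p - 1) / (p - 1))) * pow_int p lborel u"
proof -
  define c where "c = 5 * kx + ky / pi"
  have c: "0 \<le> c" using k by (simp add: c_def)
  let ?H = "\<lambda>l t. ennreal (2 * c * p) * (ennreal (cmod (u t)) * (ennreal (l powr (p - 1 - 1)) * indicator {0..4 * cmod (u t)} l))"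
  let ?G = "\<lambda>l z. ennreal (p * l powr (p - 1)) * indicator {0..cmod (poisson_integral u z)} l"
  interpret \<mu>: sigma_finite_measure \<mu> by (rule sigma_finite_well_projected[OF \<mu>])
  interpret pair_sigma_finite \<mu> lborel ..
  have "poisson_integral u \<in> borel_measurable borel"
    unfolding poisson_integral_def[abs_def] by measurable
  then have [measurable]: "poisson_integral u \<in> borel_measurable \<mu>" by (rule well_projected_measurable[OF \<mu>])
  define f where "f = (\<lambda>l t. ennreal (cmod (u t)) * indicator {l / 4<..} (cmod (u t)))"
  have fm[measurable]: "f l \<in> borel_measurable borel" for l unfolding f_def by measurable
  let ?A = "\<lambda>l. {z \<in> space \<mu>. l \<le> cmod (poisson_integral u z)}"
  let ?I = "\<lambda>l. (\<integral>\<^sup>+t. f l t \<partial>lborel)"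
  have weak: "emeasure \<mu> (?A l) \<le> ennreal (2 * c / l) * ?I l"
    if l: "0 < l" for l
  proof -
    \<comment> \<open>Above l / 4 the first power of |u| is dominated by a multiple of its p-th
      power, so the truncated function is integrable and the weak type bound applies.\<close>
    have "?I l \<le> (\<integral>\<^sup>+t. ennreal ((l / 4) powr (1 - p)) * ennreal (cmod (u t) powr p) \<partial>lborel)"
    proof (rule nn_integral_mono)
      fix t
      show "f l t \<le> ennreal ((l / 4) powr (1 - p)) * ennreal (cmod (u t) powr p)"
      proof (cases "l / 4 < cmod (u t)")
        case True
        then have u0: "0 < cmod (u t)" using l by (meson less_trans zero_less_divide_iff zero_less_numeral)
        then have "cmod (u t) = cmod (u t) powr (1 - p) * cmod (u t) powr p" by (simp add: powr_add[symmetric])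
        also have "\<dots> \<le> (l / 4) powr (1 - p) * cmod (u t) powr p"
          using True l p by (intro mult_right_mono powr_mono2') auto
        finally show ?thesis by (simp add: f_def ennreal_mult[symmetric] ennreal_leI indicator_def)
      qed (simp add: f_def)
    qed
    also have "\<dots> < \<infinity>" using fin by (simp add: nn_integral_cmult ennreal_mult_less_top)
    finally obtain N where N: "?I l = ennreal N" "0 \<le> N"
      by (cases "\<integral>\<^sup>+t. f l t \<partial>lborel" rule: ennreal_cases) auto
    \<comment> \<open>The part of |u| up to l / 4 contributes at most l / 4, so \<open>f l\<close>
      contributes at least 3 l / 4. The gap to l / 2 produces the strict inequality in the weak type
      bound.\<close>
    have "?A l \<subseteq> {z \<in> space \<mu>. ennreal (l / 2) < poisson_ext (f l) z}"
    proof safe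
      fix z assume z: "z \<in> space \<mu>" and lz: "l \<le> cmod (poisson_integral u z)"
      let ?P = "\<lambda>t. poisson_kernel (Re z - t) (Im z)"
      have y: "0 < Im z" using z space_well_projected[OF \<mu>] by (simp add: upper_half_plane_def)
      have P: "0 \<le> ?P t" for t using y by (simp add: poisson_kernel_nonneg)
      have "ennreal l \<le> ennreal (cmod (poisson_integral u z))" using lz by (rule ennreal_leI)
      also have "\<dots> \<le> (\<integral>\<^sup>+t. ennreal (cmod (of_real (?P t) * u t)) \<partial>lborel)"
        unfolding poisson_integral_def by (rule ennreal_norm_integral_le)
      also have "\<dots> \<le> (\<integral>\<^sup>+t. ennreal (?P t) * f l t + ennreal (?P t) * ennreal (l / 4) \<partial>lborel)"
      proof (rule nn_integral_mono)
        fix t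
        have "ennreal (cmod (of_real (?P t) * u t)) = ennreal (?P t) * ennreal (cmod (u t))"
          using P[of t] by (simp add: norm_mult ennreal_mult)
        also have "\<dots> \<le> ennreal (?P t) * (f l t + ennreal (l / 4))"
          by (intro mult_left_mono) (auto simp: f_def indicator_def intro: ennreal_leI)
        finally show "ennreal (cmod (of_real (?P t) * u t)) \<le>
           ennreal (?P t) * f l t + ennreal (?P t) * ennreal (l / 4)"
          by (simp add: distrib_left)
      qed
      also have "\<dots> = poisson_ext (f l) z + ennreal (l / 4)"
        by (simp add: nn_integral_add nn_integral_multc nn_integral_poisson_kernel[OF y] poisson_ext_def)
      finally have A: "ennreal l \<le> poisson_ext (f l) z + ennreal (l / 4)" .
      show "ennreal (l / 2) < poisson_ext (f l) z"
      proof (rule ccontr)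
        assume "\<not> ennreal (l / 2) < poisson_ext (f l) z"
        then have "poisson_ext (f l) z + ennreal (l / 4) \<le> ennreal (l / 2) + ennreal (l / 4)"
          by (intro add_right_mono) auto
        also have "\<dots> = ennreal (3 * l / 4)" using l by (simp add: ennreal_plus[symmetric] del: ennreal_plus)
        finally have "ennreal l \<le> ennreal (3 * l / 4)" using A by (rule order_trans[rotated])
        then show False using l by (simp add: ennreal_le_iff)
      qed
    qed
    then have "emeasure \<mu> (?A l) \<le> emeasure \<mu> {z \<in> space \<mu>. ennreal (l / 2) < poisson_ext (f l) z}"
    proof (rule emeasure_mono)
      have [measurable]: "poisson_ext (f l) \<in> borel_measurable \<mu>" by (rule well_projected_measurable[OF \<mu>]) simp
      show "{z \<in> space \<mu>. ennreal (l / 2) < poisson_ext (f l) z} \<in> sets \<mu>" by measurable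
    qed
    also have "\<dots> \<le> ennreal (c * N / (l / 2))"
      unfolding c_def using l N by (intro poisson_weak_type[OF \<mu> k]) auto
    also have "\<dots> = ennreal (2 * c / l) * ennreal N" using l N c by (simp add: ennreal_mult[symmetric])
    finally show ?thesis using N by simp
  qed
  have "pow_int p \<mu> (poisson_integral u) = (\<integral>\<^sup>+z. (\<integral>\<^sup>+l. ?G l z \<partial>lborel) \<partial>\<mu>)"
  proof (rule nn_integral_cong)
    fix z
    have "(\<integral>\<^sup>+l. ?G l z \<partial>lborel) =
       ennreal p * (\<integral>\<^sup>+l. ennreal (l powr (p - 1)) * indicator {0..cmod (poisson_integral u z)} l \<partial>lborel)"
      using p by (subst nn_integral_cmult[symmetric]) (auto simp: ennreal_mult mult.assoc)
    also have "\<dots> = ennreal (cmod (poisson_integral u z) powr p)"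
      using p by (subst nn_integral_powr_Icc) (auto simp: ennreal_mult[symmetric])
    finally show "ennreal (cmod (poisson_integral u z) powr p) = (\<integral>\<^sup>+l. ?G l z \<partial>lborel)" ..
  qed
  also have "\<dots> = (\<integral>\<^sup>+l. (\<integral>\<^sup>+z. ?G l z \<partial>\<mu>) \<partial>lborel)"
    by (rule Fubini'[symmetric]) (simp add: split_def indicator_def)
  also have "\<dots> \<le> (\<integral>\<^sup>+l. (\<integral>\<^sup>+t. ?H l t \<partial>lborel) \<partial>lborel)"
  proof (rule nn_integral_mono)
    fix l :: real
    show "(\<integral>\<^sup>+z. ?G l z \<partial>\<mu>) \<le> (\<integral>\<^sup>+t. ?H l t \<partial>lborel)"
    proof (cases "0 < l")
      case True
      have "(\<integral>\<^sup>+z. ?G l z \<partial>\<mu>) = (\<integral>\<^sup>+z. ennreal (p * l powr (p - 1)) * indicator (?A l) z \<partial>\<mu>)"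
        using True by (intro nn_integral_cong) (auto simp: indicator_def)
      also have "\<dots> = ennreal (p * l powr (p - 1)) * emeasure \<mu> (?A l)"
        by (intro nn_integral_cmult_indicator) measurable
      also have "\<dots> \<le> ennreal (p * l powr (p - 1)) * (ennreal (2 * c / l) * ?I l)"
        by (intro mult_left_mono weak True) simp
      also have "\<dots> = ennreal (p * l powr (p - 1) * (2 * c / l)) * ?I l"
      proof -
        have "ennreal (p * l powr (p - 1) * (2 * c / l)) = ennreal (p * l powr (p - 1)) * ennreal (2 * c / l)"
          using p c True by (intro ennreal_mult) auto
        then show ?thesis by (simp only: mult.assoc)
      qed
      also have "p * l powr (p - 1) * (2 * c / l) = 2 * c * p * l powr (p - 1 - 1)"
        using True by (simp add: powr_diff power2_eq_square)
      also have "ennreal (2 * c * p * l powr (p - 1 - 1)) * ?I l =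
          (\<integral>\<^sup>+t. ennreal (2 * c * p * l powr (p - 1 - 1)) * f l t \<partial>lborel)"
        by (intro nn_integral_cmult[symmetric]) simp
      also have "\<dots> \<le> (\<integral>\<^sup>+t. ?H l t \<partial>lborel)"
      proof (rule nn_integral_mono)
        fix t
        have "ennreal (2 * c * p * l powr (p - 1 - 1)) = ennreal (2 * c * p) * ennreal (l powr (p - 1 - 1))"
          using p c by (intro ennreal_mult) auto
        then have "ennreal (2 * c * p * l powr (p - 1 - 1)) * f l t =
           ennreal (2 * c * p) * (ennreal (cmod (u t)) * (ennreal (l powr (p - 1 - 1)) * indicator {l / 4<..} (cmod (u t))))"
          unfolding f_def by (simp only: mult_ac)
        \<comment> \<open>The condition l < 4 |u t| becomes an interval of \<open>l\<close> for
          fixed \<open>t\<close>, so that after exchanging the integrals the inner one is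
          elementary.\<close>
        also have "\<dots> \<le> ?H l t"
          using True by (intro mult_left_mono) (auto simp: indicator_def)
        finally show "ennreal (2 * c * p * l powr (p - 1 - 1)) * f l t \<le> ?H l t" .
      qed
      finally show ?thesis .
    next
      case False
      then have "?G l z = 0" for z
        by (auto simp: indicator_def)
      then show ?thesis by (simp only: nn_integral_const mult_zero_left zero_le)
    qed
  qed
  also have "\<dots> = (\<integral>\<^sup>+t. (\<integral>\<^sup>+l. ?H l t \<partial>lborel) \<partial>lborel)"
    by (rule lborel_pair.Fubini') (simp add: split_def indicator_def)
  also have "\<dots> = (\<integral>\<^sup>+t. ennreal (2 * c * p * (4 powr (p - 1) / (p - 1))) * ennreal (cmod (u t) powr p) \<partial>lborel)"
  proof (rule nn_integral_cong)
    fix t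
    have "(\<integral>\<^sup>+l. ?H l t \<partial>lborel) =
      ennreal (2 * c * p) * (ennreal (cmod (u t)) * ennreal ((4 * cmod (u t)) powr (p - 1) / (p - 1)))"
    proof -
      have "(\<integral>\<^sup>+l. ennreal (l powr (p - 1 - 1)) * indicator {0..4 * cmod (u t)} l \<partial>lborel) = ennreal ((4 * cmod (u t)) powr (p - 1) / (p - 1))"
        using p by (intro nn_integral_powr_Icc) auto
      moreover have "(\<lambda>l. ennreal (l powr (p - 1 - 1)) * indicator {0..4 * cmod (u t)} l) \<in> borel_measurable lborel"
        by measurable
      ultimately show ?thesis by (subst nn_integral_cmult, measurable, subst nn_integral_cmult) simp_all
    qed
    also have "\<dots> = ennreal (2 * c * p * (cmod (u t) * ((4 * cmod (u t)) powr (p - 1) / (p - 1))))"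
      using p c by (simp add: ennreal_mult[symmetric])
    also have "cmod (u t) * ((4 * cmod (u t)) powr (p - 1) / (p - 1)) = 4 powr (p - 1) / (p - 1) * cmod (u t) powr p"
    proof -
      have "(4 * cmod (u t)) powr (p - 1) = 4 powr (p - 1) * cmod (u t) powr (p - 1)" by (simp add: powr_mult)
      moreover have "cmod (u t) * cmod (u t) powr (p - 1) = cmod (u t) powr p" by (simp add: powr_mult_base)
      ultimately show ?thesis by (simp add: mult.left_commute)
    qed
    also have "ennreal (2 * c * p * (4 powr (p - 1) / (p - 1) * cmod (u t) powr p)) =
       ennreal (2 * c * p * (4 powr (p - 1) / (p - 1))) * ennreal (cmod (u t) powr p)"
    proof -
      have "0 \<le> 2 * c * p * (4 powr (p - 1) / (p - 1))" using p c by simp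
      from ennreal_mult'[OF this, of "cmod (u t) powr p"] show ?thesis by (simp only: mult.assoc)
    qed
    finally show "(\<integral>\<^sup>+l. ?H l t \<partial>lborel) =
      ennreal (2 * c * p * (4 powr (p - 1) / (p - 1))) * ennreal (cmod (u t) powr p)" .
  qed
  also have "\<dots> = ennreal (2 * c * p * (4 powr (p - 1) / (p - 1))) * pow_int p lborel u"
    by (intro nn_integral_cmult) measurable
  finally show ?thesis unfolding c_def .
qed

subsection \<open>From the Poisson to the Cauchy integral\<close>

lemma nn_integral_one_plus_abs_powr:
  assumes q: "1 < q"
  shows "(\<integral>\<^sup>+s. ennreal ((1 + \<bar>s\<bar>) powr (- q)) \<partial>lborel) < \<infinity>"
proof -
  define h where "h = (\<lambda>s::real. ennreal ((1 + s) powr (- q)) * indicator {0..} s)"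
  have [measurable]: "h \<in> borel_measurable borel" unfolding h_def by measurable
  have "(\<integral>\<^sup>+s. h s \<partial>lborel) = ennreal (0 - (1 + 0) powr (1 - q) / (1 - q))"
    unfolding h_def
  proof (rule nn_integral_FTC_atLeast)
    show "((\<lambda>s. (1 + s) powr (1 - q) / (1 - q)) has_real_derivative (1 + s) powr (- q)) (at s)" if "0 \<le> s" for s
    proof -
      have "((\<lambda>s. 1 + s) has_real_derivative 1) (at s)" by (auto intro!: derivative_eq_intros)
      from DERIV_cdivide[OF DERIV_chain2[OF has_real_derivative_powr[of "1 + s" "1 - q"] this], of "1 - q"]
      show ?thesis using that q by simp
    qed
    have "((\<lambda>s::real. (1 + s) powr (1 - q)) \<longlongrightarrow> 0) at_top"
      using q by (intro tendsto_neg_powr filterlim_tendsto_add_at_top[OF tendsto_const] filterlim_ident) auto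
    then show "((\<lambda>s. (1 + s) powr (1 - q) / (1 - q)) \<longlongrightarrow> 0) at_top"
      using tendsto_divide[OF _ tendsto_const, of _ 0 at_top "1 - q"] q by simp
  qed auto
  then have fin: "(\<integral>\<^sup>+s. h s \<partial>lborel) < \<infinity>" by simp
  have "(\<integral>\<^sup>+s. ennreal ((1 + \<bar>s\<bar>) powr (- q)) \<partial>lborel) \<le> (\<integral>\<^sup>+s. h s + h (0 + (- 1) * s) \<partial>lborel)"
    by (intro nn_integral_mono) (auto simp: h_def indicator_def abs_if)
  also have "\<dots> = (\<integral>\<^sup>+s. h s \<partial>lborel) + (\<integral>\<^sup>+s. h (0 + (- 1) * s) \<partial>lborel)" by (rule nn_integral_add) auto
  also have "(\<integral>\<^sup>+s. h (0 + (- 1) * s) \<partial>lborel) = (\<integral>\<^sup>+s. h s \<partial>lborel)"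
    using nn_integral_real_affine[of h "- 1" 0] by simp
  finally show ?thesis using fin by (simp add: order_le_less_trans)
qed

lemma nn_integral_cauchy_kernel_powr:
  assumes q: "1 < q" and y: "0 < y"
  shows "(\<integral>\<^sup>+t. ennreal (cmod (cauchy_kernel (x - t) y) powr q) \<partial>lborel) < \<infinity>"
proof -
  \<comment> \<open>The modulus of s + i y dominates both |s| and y, hence half their sum, hence
    \<open>c\<close> (1 + |s|).\<close>
  define c where "c = min 1 y / 2"
  have c: "0 < c" using y by (simp add: c_def)
  have le: "cmod (cauchy_kernel s y) powr q \<le> c powr (- q) * (1 + \<bar>s\<bar>) powr (- q)" for s
  proof -
    have "\<bar>s\<bar> \<le> cmod (Complex s y)" "y \<le> cmod (Complex s y)"
      using abs_Re_le_cmod[of "Complex s y"] abs_Im_le_cmod[of "Complex s y"] by auto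
    moreover have "min 1 y * \<bar>s\<bar> \<le> 1 * \<bar>s\<bar>" by (intro mult_right_mono) auto
    ultimately have le: "c * (1 + \<bar>s\<bar>) \<le> cmod (Complex s y)" unfolding c_def by (simp add: field_simps)
    have pos: "0 < 1 + \<bar>s\<bar>" by simp
    then have "0 < c * (1 + \<bar>s\<bar>)" using c by simp
    then have "0 < cmod (Complex s y)" using le by (rule order_less_le_trans)
    note pos = pos this c pi_gt_zero
    note le
    also have "\<dots> \<le> pi * cmod (Complex s y)" using pi_ge_two by (intro mult_le_cancel_right1[THEN iffD2]) auto
    finally have "cmod (cauchy_kernel s y) \<le> 1 / (c * (1 + \<bar>s\<bar>))"
      unfolding norm_cauchy_kernel by (intro divide_left_mono mult_pos_pos pos) auto
    then have "cmod (cauchy_kernel s y) powr q \<le> (1 / (c * (1 + \<bar>s\<bar>))) powr q"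
      using q by (intro powr_mono2) auto
    also have "\<dots> = c powr (- q) * (1 + \<bar>s\<bar>) powr (- q)"
      using c by (simp add: powr_divide powr_mult powr_minus_divide)
    finally show ?thesis .
  qed
  have "(\<integral>\<^sup>+t. ennreal (cmod (cauchy_kernel (x - t) y) powr q) \<partial>lborel) \<le>
     (\<integral>\<^sup>+t. ennreal (c powr (- q)) * ennreal ((1 + \<bar>x - t\<bar>) powr (- q)) \<partial>lborel)"
    using le by (intro nn_integral_mono) (simp add: ennreal_mult[symmetric] ennreal_leI)
  also have "\<dots> = ennreal (c powr (- q)) * (\<integral>\<^sup>+t. ennreal ((1 + \<bar>x - t\<bar>) powr (- q)) \<partial>lborel)"
    by (rule nn_integral_cmult) simp
  also have "(\<integral>\<^sup>+t. ennreal ((1 + \<bar>x - t\<bar>) powr (- q)) \<partial>lborel) = (\<integral>\<^sup>+t. ennreal ((1 + \<bar>- t\<bar>) powr (- q)) \<partial>lborel)"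
    using nn_integral_translate[of "\<lambda>t. ennreal ((1 + \<bar>x - t\<bar>) powr (- q))" x] by simp
  also have "ennreal (c powr (- q)) * \<dots> < \<infinity>"
    using nn_integral_one_plus_abs_powr[OF q] by (simp add: ennreal_mult_less_top)
  finally show ?thesis .
qed

text \<open>Young's inequality, as the kernel has a finite q-th power integral for the conjugate
  exponent q. Additivity of the operator and dominated convergence of the truncations both rest on
  this.\<close>

lemma integrable_cauchy_kernel_Lp:
  assumes p: "1 < p" and u: "u \<in> Lp_space p lborel" and z: "0 < Im z"
  shows "integrable lborel (\<lambda>t. cauchy_kernel (Re z - t) (Im z) * u t)"
proof (rule integrableI_bounded)
  have [measurable]: "u \<in> borel_measurable borel" using u by (simp add: Lp_space_def)
  show "(\<lambda>t. cauchy_kernel (Re z - t) (Im z) * u t) \<in> borel_measurable lborel" by simp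
  let ?k = "\<lambda>t. cauchy_kernel (Re z - t) (Im z)"
  define q where "q = p / (p - 1)"
  have q: "1 < q" "1 / q + 1 / p = 1" using p by (simp_all add: q_def field_simps)
  have fin: "pow_int p lborel u < \<infinity>" using u by (simp add: Lp_space_def)
  have "(\<integral>\<^sup>+t. ennreal (norm (?k t * u t)) \<partial>lborel) \<le>
    (\<integral>\<^sup>+t. ennreal (cmod (?k t) powr q) + ennreal (cmod (u t) powr p) \<partial>lborel)"
  proof (rule nn_integral_mono)
    fix t
    have "cmod (?k t) * cmod (u t) \<le> cmod (?k t) powr q / q + cmod (u t) powr p / p"
      using p q by (intro Youngs_inequality) auto
    also have "\<dots> \<le> cmod (?k t) powr q / 1 + cmod (u t) powr p / 1"
      using p q by (intro add_mono divide_left_mono) auto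
    finally show "ennreal (norm (?k t * u t)) \<le> ennreal (cmod (?k t) powr q) + ennreal (cmod (u t) powr p)"
      by (simp add: norm_mult ennreal_plus[symmetric] ennreal_leI del: ennreal_plus)
  qed
  also have "\<dots> = (\<integral>\<^sup>+t. ennreal (cmod (?k t) powr q) \<partial>lborel) + pow_int p lborel u"
    by (rule nn_integral_add) auto
  also have "\<dots> < \<infinity>" using fin nn_integral_cauchy_kernel_powr[OF q(1) z, of "Re z"] by simp
  finally show "(\<integral>\<^sup>+t. ennreal (norm (?k t * u t)) \<partial>lborel) < \<infinity>" .
qed

lemma Lp_norm_le_iff:
  assumes p: "0 < p" and a: "0 \<le> a"
  shows "Lp_norm p M f \<le> ennreal a \<longleftrightarrow> pow_int p M f \<le> ennreal (a powr p)"
proof (cases "\<integral>\<^sup>+x. ennreal (cmod (f x) powr p) \<partial>M" rule: ennreal_cases)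
  case (real r)
  have "r powr (1 / p) \<le> a \<longleftrightarrow> r \<le> a powr p"
  proof
    assume "r powr (1 / p) \<le> a"
    then have "(r powr (1 / p)) powr p \<le> a powr p" using p by (intro powr_mono2) auto
    then show "r \<le> a powr p" using p real by (simp add: powr_powr)
  next
    assume "r \<le> a powr p"
    then have "r powr (1 / p) \<le> (a powr p) powr (1 / p)" using p real by (intro powr_mono2) auto
    then show "r powr (1 / p) \<le> a" using p a by (simp add: powr_powr)
  qed
  then show ?thesis using real a by (simp add: Lp_norm_def Let_def ennreal_le_iff)
next
  case top
  then show ?thesis by (simp add: Lp_norm_def top_unique)
qed

text \<open>Boundedness of the Cauchy operator requires a finite Poisson norm for each measure; the
  bound on the supremum is then expressed through these norms themselves.\<close>

lemma poisson_opnorm_finite: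
  assumes \<mu>: "\<mu> \<in> well_projected upper_half_plane kx ky" and k: "0 \<le> kx" "0 \<le> ky" and p: "1 < p"
  shows "Lp_opnorm p lborel \<mu> poisson_integral < \<infinity>"
proof -
  define C where "C = 2 * (5 * kx + ky / pi) * p * (4 powr (p - 1) / (p - 1))"
  have C: "0 \<le> C" using k p by (simp add: C_def)
  have "Lp_opnorm p lborel \<mu> poisson_integral \<le> ennreal (C powr (1 / p))"
    unfolding Lp_opnorm_def
  proof (rule SUP_least)
    fix u :: "real \<Rightarrow> complex" assume "u \<in> {u \<in> Lp_space p lborel. Lp_norm p lborel u \<le> 1}"
    then have u: "u \<in> borel_measurable borel" "pow_int p lborel u < \<infinity>"
      "pow_int p lborel u \<le> 1"
      using Lp_norm_le_iff[of p 1 lborel u] p by (auto simp: Lp_space_def)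
    have "pow_int p \<mu> (poisson_integral u) \<le> ennreal C * pow_int p lborel u"
      unfolding C_def by (rule poisson_strong_type[OF \<mu> k p u(1,2)])
    also have "\<dots> \<le> ennreal C * 1" by (intro mult_left_mono u) simp
    also have "\<dots> = ennreal ((C powr (1 / p)) powr p)" using p C by (simp add: powr_powr)
    finally show "Lp_norm p \<mu> (poisson_integral u) \<le> ennreal (C powr (1 / p))"
      using p by (subst Lp_norm_le_iff) auto
  qed
  then show ?thesis by (rule le_less_trans) simp
qed

lemma poisson_integral_cmult: "poisson_integral (\<lambda>s. c * u s) z = c * poisson_integral u z"
proof -
  have "poisson_integral (\<lambda>s. c * u s) z = (LINT t|lborel. c * (of_real (poisson_kernel (Re z - t) (Im z)) * u t))"
    unfolding poisson_integral_def by (simp add: mult.left_commute)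
  then show ?thesis unfolding poisson_integral_def by simp
qed

text \<open>The operator norm is a supremum over the unit ball, so it is applied to g / B;
  homogeneity scales the result back.\<close>

lemma poisson_integral_opnorm_bound:
  assumes p: "1 < p" and B: "0 < B" and g: "g \<in> borel_measurable borel"
    and opnorm: "Lp_opnorm p lborel \<mu> poisson_integral = ennreal c" "0 \<le> c"
    and gB: "pow_int p lborel g \<le> ennreal (B powr p)"
    and [measurable]: "poisson_integral g \<in> borel_measurable \<mu>"
  shows "pow_int p \<mu> (poisson_integral g) \<le> ennreal ((c * B) powr p)"
proof -
  have [measurable]: "g \<in> borel_measurable borel" by (rule g)
  define v where "v = (\<lambda>s. of_real (1 / B) * g s)"
  have vp: "ennreal (cmod (of_real (1 / B) * w) powr p) = ennreal (B powr (- p)) * ennreal (cmod w powr p)" for w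
    using B by (simp add: norm_mult norm_divide powr_divide powr_minus_divide ennreal_mult[symmetric])
  have "pow_int p lborel v = ennreal (B powr (- p)) * pow_int p lborel g"
    unfolding v_def vp by (rule nn_integral_cmult) simp
  also have "\<dots> \<le> ennreal (B powr (- p)) * ennreal (B powr p)" by (intro mult_left_mono gB) simp
  also have "\<dots> = 1" using B by (simp add: ennreal_mult[symmetric] powr_add[symmetric])
  finally have v1: "pow_int p lborel v \<le> ennreal (1 powr p)" by simp
  then have "v \<in> Lp_space p lborel" "Lp_norm p lborel v \<le> 1"
    using p Lp_norm_le_iff[of p 1 lborel v] by (auto simp: Lp_space_def v_def intro: le_less_trans)
  then have "Lp_norm p \<mu> (poisson_integral v) \<le> ennreal c"
    unfolding opnorm(1)[symmetric] Lp_opnorm_def by (intro SUP_upper) simp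
  then have "pow_int p \<mu> (poisson_integral v) \<le> ennreal (c powr p)"
    using p opnorm by (simp add: Lp_norm_le_iff)
  moreover have "pow_int p \<mu> (poisson_integral v) = ennreal (B powr (- p)) * pow_int p \<mu> (poisson_integral g)"
    unfolding v_def poisson_integral_cmult vp by (rule nn_integral_cmult) simp
  ultimately have "ennreal (B powr p) * (ennreal (B powr (- p)) * pow_int p \<mu> (poisson_integral g))
      \<le> ennreal (B powr p) * ennreal (c powr p)" by (intro mult_left_mono) auto
  moreover have "ennreal (B powr p) * ennreal (B powr (- p)) = 1"
    using B by (simp add: ennreal_mult[symmetric] powr_add[symmetric])
  moreover have "ennreal (B powr p) * ennreal (c powr p) = ennreal ((c * B) powr p)"
    using B opnorm by (simp add: powr_mult ennreal_mult[symmetric] mult.commute)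
  ultimately show ?thesis by (simp add: mult.assoc[symmetric])
qed

text \<open>Raising a point moves it away from the real pole. The kernel at height Im z thus
  dominates all shifted ones in the limit that removes the shift.\<close>

lemma norm_cauchy_kernel_mono:
  assumes "0 < y" "y \<le> y'" shows "cmod (cauchy_kernel x y') \<le> cmod (cauchy_kernel x y)"
proof -
  have "cmod (Complex x y) \<le> cmod (Complex x y')"
    using assms by (auto simp: cmod_def intro!: real_sqrt_le_mono power_mono)
  moreover have "0 < cmod (Complex x y)" using assms by (simp add: complex_eq_iff)
  ultimately show ?thesis
    unfolding norm_cauchy_kernel by (intro divide_left_mono mult_pos_pos mult_left_mono) auto
qed

text \<open>Truncation and vertical shift share the index n, so a single dominated convergence
  removes both. Cutting off both domain and values makes \<open>v n\<close> integrable with bounded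
  support, as the line bounds require.\<close>

lemma cauchy_integral_truncation_tendsto:
  assumes p: "1 < p" and u: "u \<in> Lp_space p lborel" and z: "0 < Im z"
  defines "v \<equiv> \<lambda>n t. if \<bar>t\<bar> \<le> real n \<and> cmod (u t) \<le> real n then u t else 0"
  shows "(\<lambda>n. cauchy_integral (v n) (Complex (Re z) (Im z + 1 / real (Suc n)))) \<longlonglongrightarrow> cauchy_integral u z"
  unfolding cauchy_integral_def complex.sel
proof (rule integral_dominated_convergence)
  have [measurable]: "u \<in> borel_measurable borel" using u by (simp add: Lp_space_def)
  show "(\<lambda>t. cauchy_kernel (Re z - t) (Im z) * u t) \<in> borel_measurable lborel" by simp
  show "(\<lambda>t. cauchy_kernel (Re z - t) (Im z + 1 / real (Suc n)) * v n t) \<in> borel_measurable lborel" for n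
    unfolding v_def by measurable
  show "integrable lborel (\<lambda>t. cmod (cauchy_kernel (Re z - t) (Im z) * u t))"
    by (intro integrable_norm integrable_cauchy_kernel_Lp[OF p u z])
  show "AE t in lborel. cmod (cauchy_kernel (Re z - t) (Im z + 1 / real (Suc n)) * v n t)
      \<le> cmod (cauchy_kernel (Re z - t) (Im z) * u t)" for n
  proof (rule AE_I2)
    fix t
    have "cmod (cauchy_kernel (Re z - t) (Im z + 1 / real (Suc n))) * cmod (v n t) \<le> cmod (cauchy_kernel (Re z - t) (Im z)) * cmod (u t)"
      using z by (intro mult_mono norm_cauchy_kernel_mono) (auto simp: v_def)
    then show "cmod (cauchy_kernel (Re z - t) (Im z + 1 / real (Suc n)) * v n t) \<le> cmod (cauchy_kernel (Re z - t) (Im z) * u t)"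
      by (simp add: norm_mult)
  qed
  show "AE t in lborel. (\<lambda>n. cauchy_kernel (Re z - t) (Im z + 1 / real (Suc n)) * v n t)
      \<longlonglongrightarrow> cauchy_kernel (Re z - t) (Im z) * u t"
  proof (rule AE_I2)
    fix t
    obtain m :: nat where m: "max \<bar>t\<bar> (cmod (u t)) \<le> real m" using real_arch_simple by blast
    have "(\<lambda>n. v n t) \<longlonglongrightarrow> u t"
    proof (rule tendsto_eventually)
      show "\<forall>\<^sub>F n in sequentially. v n t = u t"
        using eventually_ge_at_top[of m] by eventually_elim (use m in \<open>auto simp: v_def\<close>)
    qed
    moreover have "(\<lambda>n. cauchy_kernel (Re z - t) (Im z + 1 / real (Suc n))) \<longlonglongrightarrow> cauchy_kernel (Re z - t) (Im z + 0)"
    proof -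
      have "(\<lambda>n. Im z + 1 / real (Suc n)) \<longlonglongrightarrow> Im z + 0"
        by (intro tendsto_add tendsto_const LIMSEQ_inverse_real_of_nat[unfolded inverse_eq_divide])
      then have "(\<lambda>n. Complex (Re z - t) (Im z + 1 / real (Suc n))) \<longlonglongrightarrow> Complex (Re z - t) (Im z + 0)"
        by (intro tendsto_Complex tendsto_const)
      moreover have "Complex (Re z - t) (Im z + 0) \<noteq> 0" using z by (simp add: complex_eq_iff)
      ultimately show ?thesis unfolding cauchy_kernel_def
        by (intro tendsto_mult[OF tendsto_const] tendsto_divide[OF tendsto_const])
    qed
    ultimately show "(\<lambda>n. cauchy_kernel (Re z - t) (Im z + 1 / real (Suc n)) * v n t)
      \<longlonglongrightarrow> cauchy_kernel (Re z - t) (Im z) * u t"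
      by (intro tendsto_mult) auto
  qed
qed

lemma cauchy_integral_measurable:
  assumes [measurable]: "u \<in> borel_measurable borel"
  shows "cauchy_integral u \<in> borel_measurable borel"
  unfolding cauchy_integral_def[abs_def] by measurable

lemma cauchy_integral_opnorm_bound:
  assumes \<mu>: "\<mu> \<in> well_projected upper_half_plane kx ky"
    and p: "1 < p" and p': "1 / p + 1 / p' = 1" and N: "0 < N"
    and opnorm: "Lp_opnorm p lborel \<mu> poisson_integral = ennreal c" "0 \<le> c"
    and u: "u \<in> Lp_space p lborel"
    and uN: "pow_int p lborel u \<le> ennreal (N powr p)"
  shows "pow_int p \<mu> (cauchy_integral u) \<le> ennreal ((c * ((1 + tan (pi / 2 * max (1 / p) (1 / p'))) * N)) powr p)"
proof -
  define B where "B = (1 + tan (pi / 2 * max (1 / p) (1 / p'))) * N"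
  have "0 < tan (pi / 2 * max (1 / p) (1 / p'))" by (rule pichorides_constant_pos[OF p p'])
  then have B: "0 < B" using N by (simp add: B_def)
  have [measurable]: "u \<in> borel_measurable borel" using u by (simp add: Lp_space_def)
  define v where "v = (\<lambda>n t. if \<bar>t\<bar> \<le> real n \<and> cmod (u t) \<le> real n then u t else 0)"
  have [measurable]: "v n \<in> borel_measurable borel" for n unfolding v_def by measurable
  have v_supp: "v n t = 0" if "real n < \<bar>t\<bar>" for n t using that by (simp add: v_def)
  have v_int: "integrable lborel (v n)" for n
    by (rule integrable_bounded_support[where B = "real n" and R = "real n"]) (auto simp: v_def)
  define g where "g = (\<lambda>n s. cauchy_integral (v n) (Complex s (1 / real (Suc n))))"
  have g_meas: "g n \<in> borel_measurable borel" for n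
    unfolding g_def cauchy_integral_def complex.sel by measurable
  have gB: "pow_int p lborel (g n) \<le> ennreal (B powr p)" for n
    unfolding g_def B_def
  proof (rule cauchy_integral_line_bound[OF p p' _ N v_int v_supp])
    have "pow_int p lborel (v n) \<le> pow_int p lborel u"
      using p by (intro nn_integral_mono) (auto simp: v_def)
    then show "pow_int p lborel (v n) \<le> ennreal (N powr p)" using uN by (rule order_trans)
  qed auto
  have Pg_meas: "poisson_integral (g n) \<in> borel_measurable \<mu>" for n
  proof (rule well_projected_measurable[OF \<mu>])
    have [measurable]: "g n \<in> borel_measurable borel" by (rule g_meas)
    show "poisson_integral (g n) \<in> borel_measurable borel" unfolding poisson_integral_def[abs_def] by measurable
  qed
  have bound: "pow_int p \<mu> (poisson_integral (g n)) \<le> ennreal ((c * B) powr p)" for n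
    by (rule poisson_integral_opnorm_bound[OF p B g_meas opnorm gB Pg_meas])
  have lim: "(\<lambda>n. ennreal (cmod (poisson_integral (g n) z) powr p)) \<longlonglongrightarrow> ennreal (cmod (cauchy_integral u z) powr p)"
    if "z \<in> space \<mu>" for z
  proof -
    have z: "0 < Im z" using that space_well_projected[OF \<mu>] by (simp add: upper_half_plane_def)
    have "poisson_integral (g n) z = cauchy_integral (v n) (Complex (Re z) (Im z + 1 / real (Suc n)))" for n
      unfolding g_def by (rule poisson_integral_cauchy_integral[OF v_int z]) simp
    then have "(\<lambda>n. poisson_integral (g n) z) \<longlonglongrightarrow> cauchy_integral u z"
      using cauchy_integral_truncation_tendsto[OF p u z] unfolding v_def by simp
    then show ?thesis using p by (intro tendsto_ennrealI tendsto_powr' tendsto_norm tendsto_const) auto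
  qed
  have "pow_int p \<mu> (cauchy_integral u) = (\<integral>\<^sup>+z. liminf (\<lambda>n. ennreal (cmod (poisson_integral (g n) z) powr p)) \<partial>\<mu>)"
    using lim by (intro nn_integral_cong lim_imp_Liminf[symmetric]) auto
  also have "\<dots> \<le> liminf (\<lambda>n. \<integral>\<^sup>+z. ennreal (cmod (poisson_integral (g n) z) powr p) \<partial>\<mu>)"
    using Pg_meas by (intro nn_integral_liminf) measurable
  also have "\<dots> \<le> ennreal ((c * B) powr p)"
    using bound by (intro Liminf_le) auto
  finally show ?thesis by (simp add: B_def)
qed

lemma cauchy_integral_cong_AE:
  assumes "u \<in> borel_measurable borel" "w \<in> borel_measurable borel" "AE x in lborel. u x = w x"
  shows "cauchy_integral u z = cauchy_integral w z"
  unfolding cauchy_integral_def using assms by (intro integral_cong_AE) (auto elim: eventually_mono)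

lemma cauchy_integral_Lp_norm_le:
  assumes \<mu>: "\<mu> \<in> well_projected upper_half_plane kx ky"
    and p: "1 < p" and p': "1 / p + 1 / p' = 1"
    and c: "Lp_opnorm p lborel \<mu> poisson_integral = ennreal c" "0 \<le> c"
    and u: "u \<in> Lp_space p lborel"
  shows "Lp_norm p \<mu> (cauchy_integral u) \<le>
    ennreal (c * (1 + tan (pi / 2 * max (1 / p) (1 / p')))) * Lp_norm p lborel u"
proof -
  define T where "T = tan (pi / 2 * max (1 / p) (1 / p'))"
  have T: "0 < T" unfolding T_def by (rule pichorides_constant_pos[OF p p'])
  have [measurable]: "u \<in> borel_measurable borel" using u by (simp add: Lp_space_def)
  obtain X where X: "pow_int p lborel u = ennreal X" "0 \<le> X"
    using u by (cases "\<integral>\<^sup>+x. ennreal (cmod (u x) powr p) \<partial>lborel" rule: ennreal_cases) (auto simp: Lp_space_def)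
  show ?thesis
  \<comment> \<open>The scaling argument asks for a positive norm; a function of norm 0 vanishes
    almost everywhere, and its Cauchy integral is identically 0.\<close>
  proof (cases "X = 0")
    case True
    then have "pow_int p lborel u = 0" using X by simp
    then have "AE x in lborel. ennreal (cmod (u x) powr p) = 0" by (subst (asm) nn_integral_0_iff_AE) auto
    then have "AE x in lborel. u x = 0" by eventually_elim auto
    then have "cauchy_integral u z = cauchy_integral (\<lambda>_. 0) z" for z by (intro cauchy_integral_cong_AE) auto
    then have "cauchy_integral u z = 0" for z by (simp add: cauchy_integral_def)
    then show ?thesis by (simp add: Lp_norm_def)
  next
    case False
    define N where "N = X powr (1 / p)"
    have N: "0 < N" "N powr p = X" using False X p by (simp_all add: N_def powr_powr)
    have "Lp_norm p lborel u = ennreal N" using X by (simp add: Lp_norm_def Let_def N_def)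
    moreover have "pow_int p \<mu> (cauchy_integral u) \<le> ennreal ((c * ((1 + T) * N)) powr p)"
      unfolding T_def using N X by (intro cauchy_integral_opnorm_bound[OF \<mu> p p' _ c u]) auto
    then have "Lp_norm p \<mu> (cauchy_integral u) \<le> ennreal (c * ((1 + T) * N))"
      using p c T N by (subst Lp_norm_le_iff) auto
    ultimately show ?thesis using c T N by (simp add: T_def ennreal_mult[symmetric] mult.assoc)
  qed
qed

theorem theorem5:
  fixes kx ky p p' :: real
  assumes "0 \<le> kx" and "0 \<le> ky"
    and "1 < p" and "1 / p + 1 / p' = 1"
  shows "(\<forall>\<mu> \<in> well_projected upper_half_plane kx ky.
            bounded_Lp_operator p lborel \<mu> cauchy_integral)
       \<and> K4 p kx ky \<le> K3 p kx ky * ennreal (1 + tan (pi / 2 * max (1 / p) (1 / p')))"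
proof -
  note k = assms(1,2) and p = assms(3) and p' = assms(4)
  define T where "T = tan (pi / 2 * max (1 / p) (1 / p'))"
  have T: "0 < T" unfolding T_def by (rule pichorides_constant_pos[OF p p'])
  have opnorm: "\<exists>c\<ge>0. Lp_opnorm p lborel \<mu> poisson_integral = ennreal c"
    if "\<mu> \<in> well_projected upper_half_plane kx ky" for \<mu>
    using poisson_opnorm_finite[OF that k p] by (cases "Lp_opnorm p lborel \<mu> poisson_integral" rule: ennreal_cases) auto
  have "bounded_Lp_operator p lborel \<mu> cauchy_integral"
    if \<mu>: "\<mu> \<in> well_projected upper_half_plane kx ky" for \<mu>
  proof -
    obtain c where c: "0 \<le> c" "Lp_opnorm p lborel \<mu> poisson_integral = ennreal c" using opnorm[OF \<mu>] by auto
    have Im_pos: "0 < Im z" if "z \<in> space \<mu>" for z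
      using that space_well_projected[OF \<mu>] by (simp add: upper_half_plane_def)
    have meas: "u \<in> borel_measurable borel" if "u \<in> Lp_space p lborel" for u using that by (simp add: Lp_space_def)
    have norm_le: "Lp_norm p \<mu> (cauchy_integral u) \<le> ennreal (c * (1 + T)) * Lp_norm p lborel u"
      if "u \<in> Lp_space p lborel" for u
      unfolding T_def using cauchy_integral_Lp_norm_le[OF \<mu> p p' c(2,1) that] .
    have "cauchy_integral u \<in> Lp_space p \<mu>" if u: "u \<in> Lp_space p lborel" for u
    proof -
      have "Lp_norm p \<mu> (cauchy_integral u) < \<infinity>"
      proof (rule le_less_trans[OF norm_le[OF u]])
        have "Lp_norm p lborel u < \<infinity>" using u by (auto simp: Lp_norm_def Lp_space_def Let_def less_top)
        then show "ennreal (c * (1 + T)) * Lp_norm p lborel u < \<infinity>" by (simp add: ennreal_mult_less_top)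
      qed
      then have "pow_int p \<mu> (cauchy_integral u) < \<infinity>"
        by (auto simp: Lp_norm_def Let_def top.not_eq_extremum split: if_splits)
      moreover have "cauchy_integral u \<in> borel_measurable \<mu>"
        by (intro well_projected_measurable[OF \<mu>] cauchy_integral_measurable meas u)
      ultimately show ?thesis by (simp add: Lp_space_def)
    qed
    moreover have "AE z in \<mu>. cauchy_integral u z = cauchy_integral w z"
      if "u \<in> Lp_space p lborel" "w \<in> Lp_space p lborel" "AE x in lborel. u x = w x" for u w
      using cauchy_integral_cong_AE[OF meas meas, of u w] that by simp
    moreover have "AE z in \<mu>. cauchy_integral (\<lambda>x. u x + w x) z = cauchy_integral u z + cauchy_integral w z"
      if "u \<in> Lp_space p lborel" "w \<in> Lp_space p lborel" for u w
    proof (rule AE_I2)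
      fix z assume "z \<in> space \<mu>"
      note I = integrable_cauchy_kernel_Lp[OF p _ Im_pos[OF this]]
      show "cauchy_integral (\<lambda>x. u x + w x) z = cauchy_integral u z + cauchy_integral w z"
        unfolding cauchy_integral_def distrib_left by (rule Bochner_Integration.integral_add[OF I I]) (use that in auto)
    qed
    \<comment> \<open>Scalars commute with the Bochner integral even where it takes its default
      value; additivity, in contrast, relied on convergence at every point of the
      half-plane.\<close>
    moreover have "AE z in \<mu>. cauchy_integral (\<lambda>x. a * u x) z = a * cauchy_integral u z" for u a
      unfolding cauchy_integral_def by (simp add: mult.left_commute)
    moreover have "\<exists>C::real. 0 \<le> C \<and> (\<forall>u\<in>Lp_space p lborel. Lp_norm p \<mu> (cauchy_integral u) \<le> ennreal C * Lp_norm p lborel u)"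
      using norm_le c T by (intro exI[of _ "c * (1 + T)"]) auto
    ultimately show ?thesis unfolding bounded_Lp_operator_def by blast
  qed
  moreover have "K4 p kx ky \<le> K3 p kx ky * ennreal (1 + T)"
    unfolding K4_def
  proof (rule SUP_least)
    fix \<mu> assume \<mu>: "\<mu> \<in> well_projected upper_half_plane kx ky"
    obtain c where c: "0 \<le> c" "Lp_opnorm p lborel \<mu> poisson_integral = ennreal c" using opnorm[OF \<mu>] by auto
    have "Lp_opnorm p lborel \<mu> cauchy_integral \<le> ennreal c * ennreal (1 + T)"
      unfolding Lp_opnorm_def
    proof (rule SUP_least)
      fix u :: "real \<Rightarrow> complex" assume "u \<in> {u \<in> Lp_space p lborel. Lp_norm p lborel u \<le> 1}"
      then have u: "u \<in> Lp_space p lborel" "Lp_norm p lborel u \<le> 1" by auto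
      have "Lp_norm p \<mu> (cauchy_integral u) \<le> ennreal (c * (1 + T)) * Lp_norm p lborel u"
        unfolding T_def by (rule cauchy_integral_Lp_norm_le[OF \<mu> p p' c(2,1) u(1)])
      also have "\<dots> \<le> ennreal (c * (1 + T)) * 1" by (intro mult_left_mono u) simp
      finally show "Lp_norm p \<mu> (cauchy_integral u) \<le> ennreal c * ennreal (1 + T)"
        using c T ennreal_mult[of c "1 + T"] by simp
    qed
    \<comment> \<open>The estimate is made for each measure with its own Poisson norm; the supremum
      enters only now.\<close>
    also have "ennreal c \<le> K3 p kx ky"
      unfolding K3_def c(2)[symmetric] using \<mu> by (rule SUP_upper)
    finally show "Lp_opnorm p lborel \<mu> cauchy_integral \<le> K3 p kx ky * ennreal (1 + T)"
      by (simp add: mult_right_mono)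
  qed
  ultimately show ?thesis unfolding T_def by blast
qed

end
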